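(* Let $P_0$ be non-atomic and let $p_\varepsilon(\cdot)$ be the eppf of an $\varepsilon$-NormCRM$(\rho,\kappa P_0)$ (defined for all $\varepsilon>0$ with $\Lambda_\varepsilon>0$, hence for all sufficiently small $\varepsilon>0$). Then for any sequence $n_1,\dots,n_k$ of positive integers with $k>0$ and $\sum_{i=1}^k n_i=n$, $$\lim_{\varepsilon\to0}p_\varepsilon(n_1,\dots,n_k)=p_0(n_1,\dots,n_k),$$ where $p_0(\cdot)$ is the eppf of the NormCRM$(\rho,\kappa P_0)$, which is given by $$p_0(n_1,\dots,n_k)=\int_0^{+\infty}\frac{u^{n-1}}{\Gamma(n)}\exp\Big\{\kappa\int_0^{+\infty}(e^{-us}-1)\rho(s)\,ds\Big\}\Big(\prod_{i=1}^k\int_0^{+\infty}\kappa\, s^{n_i}e^{-us}\rho(s)\,ds\Big)\,du .$$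
   Context: Setting. $\Theta\subset\mathbb{R}^m$ is a Borel set, $P_0$ is a probability measure on $\Theta$, $\kappa>0$, and $\rho:(0,+\infty)\to[0,+\infty)$ is measurable with $\int_0^{+\infty}\min\{1,s\}\rho(s)\,ds<\infty$ and $\int_0^{+\infty}\rho(s)\,ds=+\infty$. NormCRM$(\rho,\kappa P_0)$ (homogeneous normalized completely random measure): let $\{J_j\}_{j\ge1}$ be the points of a Poisson process on $(0,+\infty)$ with intensity $\kappa\rho(s)\,ds$, and, independently, let $\tau_1,\tau_2,\dots$ be iid from $P_0$. Then $T=\sum_{j\ge1}J_j\in(0,\infty)$ a.s., and $P=\sum_{j\ge1}\frac{J_j}{T}\delta_{\tau_j}$ is a NormCRM$(\rho,\kappa P_0)$. For $\varepsilon>0$ put $\Lambda_\varepsilon:=\kappa\int_\varepsilon^{+\infty}\rho(s)\,ds$ (which is finite) and, when $\Lambda_\varepsilon>0$, let $\rho_\varepsilon(s):=\frac{\kappa\rho(s)}{\Lambda_\varepsilon}\mathbb{I}_{(\varepsilon,+\infty)}(s)$, a probability density. $\varepsilon$-NormCRM$(\rho,\kappa P_0)$: let $N_\varepsilon\sim\text{Poisson}(\Lambda_\varepsilon)$; conditionally on $N_\varepsilon$, let $J_0,J_1,\dots,J_{N_\varepsilon}$ be iid with density $\rho_\varepsilon$ and, independently of these, let $\tau_0,\dots,\tau_{N_\varepsilon}$ be iid from $P_0$. With $T_\varepsilon=\sum_{j=0}^{N_\varepsilon}J_j$, the random probability measure $P_\varepsilon=\sum_{j=0}^{N_\varepsilon}\frac{J_j}{T_\varepsilon}\delta_{\tau_j}$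 is called an $\varepsilon$-NormCRM$(\rho,\kappa P_0)$. Eppf (exchangeable partition probability function): let $\theta_1,\dots,\theta_n$ be a sample from an (a.s. discrete) random probability measure $Q$, i.e. conditionally on $Q$ they are iid from $Q$. Ties among the $\theta_i$ induce a random partition of $\{1,\dots,n\}$ ($i$ and $j$ are in the same block iff $\theta_i=\theta_j$). The eppf of $Q$ evaluated at $(n_1,\dots,n_k)$ is the probability that this random partition equals a given partition $\{C_1,\dots,C_k\}$ of $\{1,\dots,n\}$ with block sizes $\#C_i=n_i$. *)

theory Defs
  imports "HOL-Probability.Probability"
begin

definition atom :: "'a measure \<Rightarrow> 'a set \<Rightarrow> bool" where
  "atom \<mu> A \<longleftrightarrow> A \<in> sets \<mu> \<and> emeasure \<mu> A > 0 \<and>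
     (\<forall>B\<in>sets \<mu>. B \<subseteq> A \<and> emeasure \<mu> B < emeasure \<mu> A \<longrightarrow> emeasure \<mu> B = 0)"

definition non_atomic :: "'a measure \<Rightarrow> bool" where
  "non_atomic \<mu> \<longleftrightarrow> (\<nexists>A. atom \<mu> A)"

text \<open>A function \<rho> on the positive half-line is represented by a total function on the reals;
  its values outside of the half-line are never used.\<close>

definition crm_intensity :: "(real \<Rightarrow> real) \<Rightarrow> real \<Rightarrow> real measure" where
  "crm_intensity \<rho> \<kappa> = density lborel (\<lambda>s. indicator {0<..} s * ennreal (\<kappa> * \<rho> s))"

definition point_count :: "(nat \<Rightarrow> 'w \<Rightarrow> real) \<Rightarrow> real set \<Rightarrow> 'w \<Rightarrow> ennreal" where
  "point_count J A \<omega> = (\<Sum>j. indicator A (J j \<omega>))"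

text \<open>The sequence \<open>J\<close> enumerates the points of a Poisson process on the positive half-line whose
  intensity \<open>\<mu>\<close> has infinite total mass, so that there are infinitely many points. The Poisson
  weights are written out because the library's \<open>poisson_pmf\<close> excludes the rate 0.\<close>

definition poisson_process_points :: "'w measure \<Rightarrow> real measure \<Rightarrow> (nat \<Rightarrow> 'w \<Rightarrow> real) \<Rightarrow> bool" where
  "poisson_process_points M \<mu> J \<longleftrightarrow>
     (\<forall>j. J j \<in> borel_measurable M \<and> (\<forall>\<omega>\<in>space M. 0 < J j \<omega>)) \<and>
     (\<forall>A\<in>sets borel. emeasure \<mu> A < \<infinity> \<longrightarrow>
        (\<forall>k. \<P>(\<omega> in M. point_count J A \<omega> = of_nat k)
               = measure \<mu> A ^ k / fact k * exp (- measure \<mu> A))) \<and>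
     (\<forall>A\<in>sets borel. emeasure \<mu> A = \<infinity> \<longrightarrow> (AE \<omega> in M. point_count J A \<omega> = \<infinity>)) \<and>
     (\<forall>(I :: nat set) A. finite I \<and> (\<forall>i\<in>I. A i \<in> sets borel) \<and> disjoint_family_on A I \<longrightarrow>
        prob_space.indep_vars M (\<lambda>_. borel) (\<lambda>i. point_count J (A i)) I)"

text \<open>A random probability measure on \<open>space P0\<close> is a measurable map into \<open>prob_algebra P0\<close>.
  The series representation is required almost surely only, since the sum of all jumps may be
  infinite on a null set.\<close>

definition norm_crm ::
  "(real \<Rightarrow> real) \<Rightarrow> real \<Rightarrow> 'a measure \<Rightarrow> 'w measure \<Rightarrow> ('w \<Rightarrow> 'a measure) \<Rightarrow> bool" where
  "norm_crm \<rho> \<kappa> P0 M P \<longleftrightarrow>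
     prob_space M \<and> P \<in> M \<rightarrow>\<^sub>M prob_algebra P0 \<and>
     (\<exists>J \<tau>.
        poisson_process_points M (crm_intensity \<rho> \<kappa>) J \<and>
        prob_space.indep_vars M (\<lambda>_. P0) \<tau> (UNIV :: nat set) \<and>
        (\<forall>j. distr M P0 (\<tau> j) = P0) \<and>
        prob_space.indep_set M
          (sets (vimage_algebra (space M) (\<lambda>\<omega> j. J j \<omega>) (\<Pi>\<^sub>M j\<in>(UNIV :: nat set). borel)))
          (sets (vimage_algebra (space M) (\<lambda>\<omega> j. \<tau> j \<omega>) (\<Pi>\<^sub>M j\<in>(UNIV :: nat set). P0))) \<and>
        (AE \<omega> in M. \<forall>A\<in>sets P0.
           emeasure (P \<omega>) A =
             (\<Sum>j. ennreal (J j \<omega>) / (\<Sum>i. ennreal (J i \<omega>)) * indicator A (\<tau> j \<omega>))))"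

definition Lambda_eps :: "(real \<Rightarrow> real) \<Rightarrow> real \<Rightarrow> real \<Rightarrow> real" where
  "Lambda_eps \<rho> \<kappa> \<epsilon> = \<kappa> * (LINT s:{\<epsilon><..}|lborel. \<rho> s)"

definition rho_eps :: "(real \<Rightarrow> real) \<Rightarrow> real \<Rightarrow> real \<Rightarrow> real \<Rightarrow> real" where
  "rho_eps \<rho> \<kappa> \<epsilon> s = \<kappa> * \<rho> s / Lambda_eps \<rho> \<kappa> \<epsilon> * indicator {\<epsilon><..} s"

text \<open>The conditional law of the jumps and locations given \<open>N\<close> is specified on measurable rectangles;
  jumps and locations with an index greater than \<open>N\<close> play no role.\<close>

definition eps_norm_crm ::
  "(real \<Rightarrow> real) \<Rightarrow> real \<Rightarrow> 'a measure \<Rightarrow> real \<Rightarrow> 'w measure \<Rightarrow> ('w \<Rightarrow> 'a measure) \<Rightarrow> bool" where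
  "eps_norm_crm \<rho> \<kappa> P0 \<epsilon> M P \<longleftrightarrow>
     prob_space M \<and> P \<in> M \<rightarrow>\<^sub>M prob_algebra P0 \<and>
     (\<exists>N J \<tau>.
        N \<in> M \<rightarrow>\<^sub>M count_space UNIV \<and>
        (\<forall>j. J j \<in> borel_measurable M) \<and> (\<forall>j. \<tau> j \<in> M \<rightarrow>\<^sub>M P0) \<and>
        distr M (count_space UNIV) N = measure_pmf (poisson_pmf (Lambda_eps \<rho> \<kappa> \<epsilon>)) \<and>
        (\<forall>(n :: nat) A B. (\<forall>j\<le>n. A j \<in> sets borel \<and> B j \<in> sets P0) \<longrightarrow>
           \<P>(\<omega> in M. (\<forall>j\<le>n. J j \<omega> \<in> A j \<and> \<tau> j \<omega> \<in> B j) \<bar> N \<omega> = n) =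
             (\<Prod>j\<le>n. measure (density lborel (\<lambda>s. ennreal (rho_eps \<rho> \<kappa> \<epsilon> s))) (A j)) *
             (\<Prod>j\<le>n. measure P0 (B j))) \<and>
        (AE \<omega> in M. \<forall>A\<in>sets P0.
           emeasure (P \<omega>) A =
             (\<Sum>j\<le>N \<omega>. ennreal (J j \<omega>) / (\<Sum>i\<le>N \<omega>. ennreal (J i \<omega>)) * indicator A (\<tau> j \<omega>))))"

text \<open>The law of a sample \<open>\<theta>\<^sub>1, \<dots>, \<theta>\<^sub>n\<close> that is, conditionally on \<open>Q\<close>, iid from \<open>Q\<close>.\<close>

definition sample_law :: "'w measure \<Rightarrow> ('w \<Rightarrow> 'a measure) \<Rightarrow> nat \<Rightarrow> (nat \<Rightarrow> 'a) measure" where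
  "sample_law M Q n = M \<bind> (\<lambda>\<omega>. \<Pi>\<^sub>M i\<in>{1..n}. Q \<omega>)"

definition tie_partition :: "nat \<Rightarrow> (nat \<Rightarrow> 'a) \<Rightarrow> nat set set" where
  "tie_partition n \<theta> = {1..n} // {(i, j). i \<in> {1..n} \<and> j \<in> {1..n} \<and> \<theta> i = \<theta> j}"

definition blocks_of_sizes :: "nat list \<Rightarrow> nat set list \<Rightarrow> bool" where
  "blocks_of_sizes ns C \<longleftrightarrow>
     partition_on {1..sum_list ns} (set C) \<and> distinct C \<and> map card C = ns"

text \<open>The description is proper for positive sizes: such a \<open>C\<close> exists, and since a sample from a
  random probability measure is exchangeable, all such \<open>C\<close> give the same probability.\<close>

definition eppf :: "'w measure \<Rightarrow> ('w \<Rightarrow> 'a measure) \<Rightarrow> nat list \<Rightarrow> real" where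
  "eppf M Q ns = (THE p. \<forall>C. blocks_of_sizes ns C \<longrightarrow>
     \<P>(\<theta> in sample_law M Q (sum_list ns). tie_partition (sum_list ns) \<theta> = set C) = p)"

end

theory Submission
  imports Defs "HOL-Real_Asymp.Real_Asymp"
begin

text \<open>
  Let \<open>Q\<close> be a probability measure with atoms of mass \<open>w\<^sub>j\<close> at distinct locations. A sample from \<open>Q\<close>
  has ties exactly as prescribed by the blocks \<open>C\<^sub>1, \<dots>, C\<^sub>k\<close> iff each block picks an atom and different
  blocks pick different atoms. So the probability of this event is the sum of \<open>\<Prod>\<^sub>i w(l\<^sub>i) ^ n\<^sub>i\<close> over the
  lists \<open>l\<close> of \<open>k\<close> distinct indices (\<open>emeasure_tie_partition_discrete\<close>). It does not involve the
  locations; these only have to be distinct, which holds almost surely since \<open>P0\<close> is diffuse.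
  For \<open>w\<^sub>j = J\<^sub>j / T\<close> the factor \<open>T\<^sup>-\<^sup>n\<close> is the integral of \<open>u ^ (n - 1) / \<Gamma> n * exp (- u T)\<close> over
  \<open>u > 0\<close>. What is left is, for fixed \<open>u\<close>, the expectation of a sum over lists of distinct jumps
  of products, with a factor \<open>exp (- u J\<^sub>j)\<close> for each jump (\<open>nn_integral_normalized_weights\<close>).

  For the points of a Poisson process with intensity \<open>\<mu>\<close> this expectation is a product, by the
  multivariate Campbell-Mecke formula (\<open>poisson_campbell_mecke\<close>). The case of no chosen point is the
  Laplace functional. One more point is obtained by differentiating with respect to
  the function in the exponent. The formula is set up such that the chosen points do not contribute to
  the exponential; therefore the derivative only chooses points that are new, and no diagonal terms
  arise. This gives the integral formula for \<open>p\<^sub>0\<close> (\<open>eppf_norm_crm\<close>).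

  For the truncated measure the jumps are, given their number, iid, and the expectation is an explicit
  Poisson mixture. A common
  integrable majorant of the integrands is not evident as \<open>\<epsilon>\<close> tends to 0, since the exponential factor of \<open>p\<^sub>\<epsilon>\<close>
  stays away from 0 for large \<open>u\<close>. Fatou's lemma takes its place: it shows that the lower limit of
  \<open>p\<^sub>\<epsilon>\<close> is at least \<open>p\<^sub>0\<close>, and for this a convenient lower bound of \<open>p\<^sub>\<epsilon>\<close> suffices (\<open>eppf_eps_ge\<close>,
  \<open>eps_lower_bound_liminf\<close>). This holds for each of the finitely many partitions of \<open>{1..n}\<close>. The
  probabilities of all partitions add up to 1 before and in the limit, so mass gained by one
  partition would be missing from the others (\<open>tendsto_of_lower_bounds_and_total_mass\<close>).
\<close>

section \<open>The exponential of a negative extended real\<close>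

text \<open>Total masses such as \<open>\<Sum>j. h (J j)\<close> may be infinite, and then \<open>exp (- \<dots>)\<close> has to be 0. With this convention no
  finiteness has to be carried through the computations.\<close>

definition expm :: "ennreal \<Rightarrow> ennreal" where
  "expm x = (if x = \<infinity> then 0 else ennreal (exp (- enn2real x)))"

lemma expm_simps [simp]: "expm 0 = 1" "expm \<top> = 0" "0 \<le> r \<Longrightarrow> expm (ennreal r) = ennreal (exp (- r))"
  by (auto simp: expm_def)

lemma expm_le_1: "expm x \<le> 1"
  by (cases x) auto

lemma expm_finite [simp]: "expm x < \<top>" "expm x \<noteq> \<top>"
  by (auto simp: expm_def)

lemma expm_add: "expm (x + y) = expm x * expm y"
  by (cases x; cases y) (auto simp: exp_diff exp_minus divide_inverse simp flip: ennreal_plus ennreal_mult)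

lemma expm_sum: "finite I \<Longrightarrow> expm (sum f I) = (\<Prod>i\<in>I. expm (f i))"
  by (induction I rule: finite_induct) (auto simp: expm_add)

lemma expm_antimono: "x \<le> y \<Longrightarrow> expm y \<le> expm x"
  by (cases x; cases y) (auto simp: top_unique)

lemma expm_LIMSEQ:
  assumes "incseq X"
  shows "(\<lambda>n. expm (X n)) \<longlonglongrightarrow> expm (SUP n. X n)"
proof (cases "(SUP n. X n) = \<top>")
  case False
  then obtain r where r: "(SUP n. X n) = ennreal r" "r \<ge> 0" by (cases "SUP n. X n") auto
  have lim: "X \<longlonglongrightarrow> ennreal r" using LIMSEQ_SUP[OF assms] r by simp
  have fin: "X n \<noteq> \<top>" for n
    using SUP_upper[of n UNIV X] r by (metis UNIV_I ennreal_less_top less_top not_less top_unique)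
  have "(\<lambda>n. ennreal (exp (- enn2real (X n)))) \<longlonglongrightarrow> ennreal (exp (- r))"
    by (intro tendsto_intros lim r(2))
  then show ?thesis using r fin by (simp add: expm_def)
next
  case True
  have lim: "X \<longlonglongrightarrow> \<top>" using LIMSEQ_SUP[OF assms] True by simp
  show ?thesis unfolding True
  proof (rule tendsto_sandwich[of "\<lambda>_. 0"])
    show "\<forall>\<^sub>F n in sequentially. expm (X n) \<le> inverse (X n)"
    proof (rule always_eventually, rule allI)
      fix n show "expm (X n) \<le> inverse (X n)"
      proof (cases "X n")
        case (real r)
        have "r \<le> exp r"
          using exp_ge_add_one_self[of r] by linarith
        then have "exp (- r) * r \<le> 1"
          by (simp add: exp_minus field_simps)
        then have "r > 0 \<Longrightarrow> exp (- r) \<le> inverse r" by (simp add: field_simps)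
        with real show ?thesis by (cases "r = 0") (auto simp: inverse_ennreal)
      qed auto
    qed
    show "(\<lambda>n. inverse (X n)) \<longlonglongrightarrow> expm \<top>"
      using continuous_on_tendsto_compose[OF continuous_on_inverse_ennreal[OF continuous_on_id] lim, of UNIV] by simp
  qed auto
qed

lemma measurable_expm [measurable]: "expm \<in> borel_measurable borel"
  unfolding expm_def by measurable

lemma expm_quot_ennreal:
  assumes "0 \<le> r"
  shows "2 ^ m * (1 - expm (ennreal r / 2 ^ m)) = ennreal (2 ^ m * (1 - exp (- (r / 2 ^ m))))"
proof -
  have p: "(2 ^ m :: ennreal) = ennreal (2 ^ m)"
    by (simp flip: ennreal_numeral add: ennreal_power)
  have d: "ennreal r / 2 ^ m = ennreal (r / 2 ^ m)"
    using assms by (simp add: p divide_ennreal)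
  have "1 - expm (ennreal r / 2 ^ m) = ennreal 1 - ennreal (exp (- (r / 2 ^ m)))"
    using assms by (subst d, subst expm_simps(3)) auto
  also have "\<dots> = ennreal (1 - exp (- (r / 2 ^ m)))"
    by (rule ennreal_minus) simp
  finally show ?thesis
    using assms by (simp add: p ennreal_mult)
qed

lemma expm_quot_top: "2 ^ m * (1 - expm (\<top> / 2 ^ m)) = ennreal (2 ^ m)"
proof -
  have "(\<top> :: ennreal) / 2 ^ m = \<top>"
    by (simp add: ennreal_top_divide power_eq_top_ennreal)
  then show ?thesis
    by (simp flip: ennreal_numeral add: ennreal_power)
qed

text \<open>Dyadic step sizes make the monotonicity of the difference quotient elementary: for \<open>b = exp (- x / 2 ^ (m + 1))\<close>
  it amounts to \<open>1 - b\<^sup>2 \<le> 2 (1 - b)\<close>. Monotonicity allows monotone convergence to be used for derivatives.\<close>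

lemma expm_quot_mono: "incseq (\<lambda>m. 2 ^ m * (1 - expm (x / 2 ^ m)))"
proof (rule incseq_SucI)
  fix m
  show "2 ^ m * (1 - expm (x / 2 ^ m)) \<le> 2 ^ Suc m * (1 - expm (x / 2 ^ Suc m))"
  proof (cases x)
    case (real r)
    define b where "b = exp (- (r / 2 ^ Suc m))"
    have b: "0 \<le> b" "b \<le> 1" using real by (auto simp: b_def)
    have b2: "exp (- (r / 2 ^ m)) = b * b" "exp (- (r / 2 ^ Suc m)) = b"
      by (simp_all add: b_def flip: exp_add)
    have *: "2 ^ m * (1 - expm (x / 2 ^ m)) = ennreal (2 ^ m * (1 - exp (- (r / 2 ^ m))))" for m
      using real by (simp only: expm_quot_ennreal)
    have "(1 - b * b) \<le> 2 * (1 - b)"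
      using sum_squares_ge_zero[of "1 - b" 0] by (simp add: algebra_simps)
    then have "2 ^ m * (1 - b * b) \<le> 2 ^ m * (2 * (1 - b))"
      by (intro mult_left_mono) auto
    then show ?thesis unfolding * b2 by (intro ennreal_leI) (simp add: mult_ac)
  next
    case top
    show ?thesis unfolding top expm_quot_top by (intro ennreal_leI) simp
  qed
qed

lemma expm_quot_SUP: "(SUP m. 2 ^ m * (1 - expm (x / 2 ^ m))) = x"
proof (rule LIMSEQ_unique[OF LIMSEQ_SUP[OF expm_quot_mono]])
  show "(\<lambda>m. 2 ^ m * (1 - expm (x / 2 ^ m))) \<longlonglongrightarrow> x"
  proof (cases x)
    case (real r)
    have *: "2 ^ m * (1 - expm (x / 2 ^ m)) = ennreal (2 ^ m * (1 - exp (- (r / 2 ^ m))))" for m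
      using real by (simp only: expm_quot_ennreal)
    have "((\<lambda>y. (1 - exp (- (r * y))) / y) \<longlongrightarrow> r) (at_right 0)"
      by real_asymp
    moreover have "filterlim (\<lambda>m. (1/2) ^ m :: real) (at_right 0) sequentially"
      by real_asymp
    ultimately have "(\<lambda>m. (1 - exp (- (r * (1/2)^m))) / (1/2)^m) \<longlonglongrightarrow> r"
      by (rule filterlim_compose)
    also have "(\<lambda>m. (1 - exp (- (r * (1/2)^m))) / (1/2)^m) = (\<lambda>m. 2 ^ m * (1 - exp (- (r / 2 ^ m))))"
      by (auto simp: fun_eq_iff power_divide field_simps)
    finally show ?thesis unfolding * unfolding real by (intro tendsto_intros)
  next
    case top
    have "filterlim (\<lambda>m. 2 ^ m :: real) at_top sequentially" by real_asymp
    then show ?thesis unfolding top expm_quot_top by (simp add: ennreal_tendsto_top_eq_at_top)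
  qed
qed

lemma SUP_diag:
  fixes g :: "nat \<Rightarrow> nat \<Rightarrow> 'a :: complete_lattice"
  assumes "\<And>p p' q q'. p \<le> p' \<Longrightarrow> q \<le> q' \<Longrightarrow> g p q \<le> g p' q'"
  shows "(SUP m. g m m) = (SUP q. SUP p. g p q)"
proof (rule antisym)
  show "(SUP m. g m m) \<le> (SUP q. SUP p. g p q)"
    by (rule SUP_least, rule SUP_upper2, simp, rule SUP_upper, simp)
  show "(SUP q. SUP p. g p q) \<le> (SUP m. g m m)"
    by (intro SUP_least, rule_tac i="max p q" in SUP_upper2) (auto intro: assms)
qed

text \<open>A difference quotient in which the increment itself improves with the step size: by monotonicity in both places
  the diagonal supremum is an iterated one.\<close>

lemma expm_quot_SUP2:
  assumes "incseq y"
  shows "(SUP m. 2 ^ m * (1 - expm (y m / 2 ^ m))) = (SUP m. y m)"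
proof -
  have "(SUP m. 2 ^ m * (1 - expm (y m / 2 ^ m))) = (SUP q. SUP p. 2 ^ p * (1 - expm (y q / 2 ^ p)))"
  proof (rule SUP_diag)
    fix p p' q q' :: nat assume pq: "p \<le> p'" "q \<le> q'"
    have "2 ^ p * (1 - expm (y q / 2 ^ p)) \<le> 2 ^ p' * (1 - expm (y q / 2 ^ p'))"
      using incseqD[OF expm_quot_mono pq(1)] .
    also have "\<dots> \<le> 2 ^ p' * (1 - expm (y q' / 2 ^ p'))"
      by (intro mult_left_mono ennreal_minus_mono expm_antimono divide_right_mono_ennreal)
         (auto intro: incseqD[OF assms pq(2)])
    finally show "2 ^ p * (1 - expm (y q / 2 ^ p)) \<le> 2 ^ p' * (1 - expm (y q' / 2 ^ p'))" .
  qed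
  then show ?thesis by (simp add: expm_quot_SUP)
qed

section \<open>The Laplace functional of a Poisson process\<close>

text \<open>The generating function of the Poisson distribution. The weights add up to 1, so \<open>X\<close> is almost surely
  a natural number although its type allows other values.\<close>

lemma poisson_expm:
  assumes "prob_space M" and [measurable]: "X \<in> borel_measurable M" and "0 \<le> r" "0 \<le> c"
    and X: "\<And>k. \<P>(\<omega> in M. X \<omega> = of_nat k) = r ^ k / fact k * exp (- r)"
  shows "(\<integral>\<^sup>+\<omega>. expm (ennreal c * X \<omega>) \<partial>M) = expm (ennreal r * (1 - expm (ennreal c)))"
proof -
  interpret prob_space M by fact
  define p where "p k = r ^ k / fact k * exp (- r)" for k :: nat
  define E where "E k = {\<omega>\<in>space M. X \<omega> = of_nat k}" for k
  have [measurable]: "E k \<in> sets M" for k unfolding E_def by measurable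
  have disj: "disjoint_family E" by (auto simp: disjoint_family_on_def E_def)
  have p0: "p k \<ge> 0" for k using \<open>0 \<le> r\<close> by (simp add: p_def)
  have emE: "emeasure M (E k) = ennreal (p k)" for k
    using X[of k] by (simp add: p_def E_def emeasure_eq_measure)
  have exps: "(\<lambda>k. y ^ k / fact k * exp (- r)) sums (exp y * exp (- r))" for y :: real
    using sums_mult2[OF exp_converges[of y], of "exp (- r)"] by (simp add: divide_inverse mult_ac)
  have "emeasure M (\<Union>k. E k) = (\<Sum>k. ennreal (p k))"
    by (subst suminf_emeasure[OF _ disj, of M, symmetric]) (auto simp: emE)
  also have "\<dots> = ennreal 1"
    using exps[of r] by (intro suminf_ennreal_eq p0) (auto simp: p_def simp flip: exp_add)
  finally have "AE \<omega> in M. \<omega> \<in> (\<Union>k. E k)"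
    by (subst AE_in_set_eq_1) (auto simp: emeasure_eq_measure)
  then have "(\<integral>\<^sup>+\<omega>. expm (ennreal c * X \<omega>) \<partial>M) =
      (\<integral>\<^sup>+\<omega>. (\<Sum>k. ennreal (exp (- (c * real k))) * indicator (E k) \<omega>) \<partial>M)"
  proof (intro nn_integral_cong_AE, eventually_elim)
    case (elim \<omega>)
    then obtain k where k: "\<omega> \<in> E k" by auto
    have "ennreal c * of_nat k = ennreal (c * real k)"
      using \<open>0 \<le> c\<close> by (simp add: ennreal_mult flip: ennreal_of_nat_eq_real_of_nat)
    then have "expm (ennreal c * of_nat k) = ennreal (exp (- (c * real k)))"
      using \<open>0 \<le> c\<close> by simp
    moreover have "X \<omega> = of_nat k" using k by (simp add: E_def)
    ultimately show ?case
      using suminf_cmult_indicator[OF disj k, of "\<lambda>k. ennreal (exp (- (c * real k)))"] by simp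
  qed
  also have "\<dots> = (\<Sum>k. ennreal (exp (- (c * real k))) * ennreal (p k))"
    by (subst nn_integral_suminf) (auto simp: nn_integral_cmult_indicator emE)
  also have "\<dots> = (\<Sum>k. ennreal ((r * exp (- c)) ^ k / fact k * exp (- r)))"
    by (intro arg_cong[where f=suminf] ext)
       (simp add: p_def power_mult_distrib ennreal_mult'[symmetric] exp_of_nat_mult[symmetric] mult_ac)
  also have "\<dots> = ennreal (exp (r * exp (- c)) * exp (- r))"
    using \<open>0 \<le> r\<close> by (intro suminf_ennreal_eq exps) auto
  also have "\<dots> = ennreal (exp (- (r * (1 - exp (- c)))))"
    by (simp add: algebra_simps flip: exp_add)
  also have "\<dots> = expm (ennreal (r * (1 - exp (- c))))"
    using assms by (subst expm_simps) auto
  also have "ennreal (r * (1 - exp (- c))) = ennreal r * (1 - expm (ennreal c))"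
    using assms ennreal_minus[of "exp (- c)" 1] by (simp add: ennreal_mult)
  finally show ?thesis .
qed

lemma measurable_point_count:
  assumes "\<And>j. J j \<in> borel_measurable M" "A \<in> sets borel"
  shows "point_count J A \<in> borel_measurable M"
  using assms unfolding point_count_def by measurable

lemma expm_point_counts:
  assumes "prob_space M" and "poisson_process_points M \<mu> J"
    and A: "\<And>i. i < n \<Longrightarrow> A i \<in> sets borel" "\<And>i. i < n \<Longrightarrow> emeasure \<mu> (A i) < \<infinity>"
    and "disjoint_family_on A {..<n::nat}" and c: "\<And>i. i < n \<Longrightarrow> 0 \<le> c i"
  shows "(\<integral>\<^sup>+\<omega>. expm (\<Sum>i<n. ennreal (c i) * point_count J (A i) \<omega>) \<partial>M)
    = expm (\<Sum>i<n. (1 - expm (ennreal (c i))) * emeasure \<mu> (A i))"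
proof -
  interpret prob_space M by fact
  note pp = \<open>poisson_process_points M \<mu> J\<close>[unfolded poisson_process_points_def]
  have [measurable]: "J j \<in> borel_measurable M" for j using pp by auto
  have "indep_vars (\<lambda>_. borel) (\<lambda>i. point_count J (A i)) {..<n}"
    using pp assms by auto
  then have ind: "indep_vars (\<lambda>_. borel) (\<lambda>i \<omega>. expm (ennreal (c i) * point_count J (A i) \<omega>)) {..<n}"
    by (rule indep_vars_compose2) measurable
  have "(\<integral>\<^sup>+\<omega>. expm (\<Sum>i<n. ennreal (c i) * point_count J (A i) \<omega>) \<partial>M) =
      (\<Prod>i<n. \<integral>\<^sup>+\<omega>. expm (ennreal (c i) * point_count J (A i) \<omega>) \<partial>M)"
    by (simp add: expm_sum indep_vars_nn_integral[OF _ ind])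
  also have "\<dots> = (\<Prod>i<n. expm ((1 - expm (ennreal (c i))) * emeasure \<mu> (A i)))"
  proof (intro prod.cong refl)
    fix i assume "i \<in> {..<n}"
    then have i: "i < n" by simp
    have eq: "emeasure \<mu> (A i) = ennreal (measure \<mu> (A i))"
      using A(2)[OF i] by (intro emeasure_eq_ennreal_measure) auto
    show "(\<integral>\<^sup>+\<omega>. expm (ennreal (c i) * point_count J (A i) \<omega>) \<partial>M)
        = expm ((1 - expm (ennreal (c i))) * emeasure \<mu> (A i))"
      unfolding eq mult.commute[of "1 - _"]
      by (rule poisson_expm)
         (use pp A i c in \<open>auto intro!: prob_space_axioms measurable_point_count\<close>)
  qed
  also have "\<dots> = expm (\<Sum>i<n. (1 - expm (ennreal (c i))) * emeasure \<mu> (A i))"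
    by (simp add: expm_sum)
  finally show ?thesis .
qed

text \<open>A simple function takes each of its finitely many nonzero values on one of finitely many disjoint sets, and the numbers of points in
  these sets are independent Poisson variables.\<close>

lemma laplace_simple:
  assumes "prob_space M" and "poisson_process_points M \<mu> J" and [measurable_cong]: "sets \<mu> = sets borel"
    and V: "simple_function borel V" "\<And>s. V s < \<top>"
    and B: "B \<in> sets borel" "emeasure \<mu> B < \<infinity>" "\<And>s. s \<notin> B \<Longrightarrow> V s = (0::ennreal)"
  shows "(\<integral>\<^sup>+\<omega>. expm (\<Sum>j. V (J j \<omega>)) \<partial>M) = expm (\<integral>\<^sup>+s. 1 - expm (V s) \<partial>\<mu>)"
proof -
  have "finite (range V - {0})" using V(1) by (auto simp: simple_function_def)
  then obtain g n where g: "bij_betw g {..<n::nat} (range V - {0})"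
    using ex_bij_betw_nat_finite by (metis atLeast0LessThan)
  define A where "A i = V -` {g i}" for i
  define c where "c i = enn2real (g i)" for i
  have gi: "g i \<in> range V" "g i \<noteq> 0" if "i < n" for i
    using bij_betwE[OF g] that by auto
  have c: "ennreal (c i) = g i" if "i < n" for i
    using gi[OF that] V(2) by (auto simp: c_def)
  have V_meas [measurable]: "V \<in> borel_measurable borel" using V(1) by (rule borel_measurable_simple_function)
  have A [measurable]: "A i \<in> sets borel" for i
    using measurable_sets[OF V_meas, of "{g i}"] by (simp add: A_def)
  have AB: "A i \<subseteq> B" if "i < n" for i
    using gi(2)[OF that] B(3) unfolding A_def by (metis singletonD subsetI vimageE)
  have finA: "emeasure \<mu> (A i) < \<infinity>" if "i < n" for i
    using emeasure_mono[OF AB[OF that], of \<mu>] B assms(3) by (auto intro: le_less_trans)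
  have disj: "disjoint_family_on A {..<n}"
    using bij_betw_imp_inj_on[OF g] by (auto simp: disjoint_family_on_def A_def inj_on_def)
  have decomp: "f (V s) = (\<Sum>i<n. f (ennreal (c i)) * indicator (A i) s)" if "f 0 = 0" for f :: "ennreal \<Rightarrow> ennreal" and s
  proof -
    have "(\<Sum>i<n. f (ennreal (c i)) * indicator (A i) s) = (\<Sum>i<n. (\<lambda>v. f v * indicator {V s} v) (g i))"
      by (intro sum.cong refl) (auto simp: c A_def split: split_indicator)
    also have "\<dots> = (\<Sum>v\<in>range V - {0}. f v * indicator {V s} v)"
      by (rule sum.reindex_bij_betw[OF g])
    also have "\<dots> = (\<Sum>v\<in>range V - {0}. if v = V s then f v else 0)"
      by (intro sum.cong refl) auto
    also have "\<dots> = f (V s)"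
      using \<open>finite (range V - {0})\<close> that by (auto simp: sum.delta)
    finally show ?thesis ..
  qed
  have "(\<Sum>j. V (J j \<omega>)) = (\<Sum>i<n. ennreal (c i) * point_count J (A i) \<omega>)" for \<omega>
    unfolding point_count_def
    by (subst decomp[of "\<lambda>x. x"])
       (simp_all add: suminf_sum[OF summableI] ennreal_suminf_cmult del: sum_mult_indicator)
  then have "(\<integral>\<^sup>+\<omega>. expm (\<Sum>j. V (J j \<omega>)) \<partial>M) =
      (\<integral>\<^sup>+\<omega>. expm (\<Sum>i<n. ennreal (c i) * point_count J (A i) \<omega>) \<partial>M)" by simp
  also have "\<dots> = expm (\<Sum>i<n. (1 - expm (ennreal (c i))) * emeasure \<mu> (A i))"
    by (rule expm_point_counts) (use assms finA disj in \<open>auto simp: c_def\<close>)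
  also have "(\<Sum>i<n. (1 - expm (ennreal (c i))) * emeasure \<mu> (A i)) = (\<integral>\<^sup>+s. 1 - expm (V s) \<partial>\<mu>)"
    by (subst decomp[of "\<lambda>x. 1 - expm x"]) (simp_all add: nn_integral_sum nn_integral_cmult_indicator assms(3) del: sum_mult_indicator)
  finally show ?thesis .
qed

text \<open>Approximation from below by simple functions that vanish outside of sets of finite measure. The left-hand side converges because it is
  bounded by 1, the right-hand side by monotone convergence.\<close>

lemma laplace_functional:
  assumes "prob_space M" and pp: "poisson_process_points M \<mu> J" and sets [measurable_cong]: "sets \<mu> = sets borel"
    and "sigma_finite_measure \<mu>" and h [measurable]: "h \<in> borel_measurable borel"
  shows "(\<integral>\<^sup>+\<omega>. expm (\<Sum>j. h (J j \<omega>)) \<partial>M) = expm (\<integral>\<^sup>+s. 1 - expm (h s) \<partial>\<mu>)"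
proof -
  interpret prob_space M by fact
  interpret S: sigma_finite_measure \<mu> by fact
  have J [measurable]: "J j \<in> borel_measurable M" for j using pp by (auto simp: poisson_process_points_def)
  obtain U where U: "\<And>i. simple_function borel (U i)" "incseq U" "\<And>i s. U i s < \<top>"
      "\<And>s. (SUP i. U i s) = h s"
    using borel_measurable_implies_simple_function_sequence'[OF h] by blast
  obtain B :: "nat \<Rightarrow> real set" where B: "range B \<subseteq> sets \<mu>" "(\<Union>i. B i) = space \<mu>" "\<And>i. emeasure \<mu> (B i) \<noteq> \<infinity>" "incseq B"
    using S.sigma_finite_incseq by metis
  have Bs [measurable]: "B i \<in> sets borel" for i using B(1) sets by auto
  define V where "V i s = U i s * indicator (B i) s" for i s
  have V: "simple_function borel (V i)" for i
    unfolding V_def by (intro simple_function_mult U simple_function_indicator) auto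
  have V_meas [measurable]: "V i \<in> borel_measurable borel" for i
    using V by (rule borel_measurable_simple_function)
  have Vfin: "V i s < \<top>" for i s using U(3) by (auto simp: V_def split: split_indicator)
  have Vinc: "incseq (\<lambda>i. V i s)" for s
    using U(2) B(4) by (auto simp: V_def incseq_def le_fun_def subset_eq split: split_indicator)
  have Vlim: "(\<lambda>i. V i s) \<longlonglongrightarrow> h s" for s
  proof -
    have "s \<in> (\<Union>i. B i)" using B(2) sets_eq_imp_space_eq[OF sets] by simp
    then obtain i0 where "s \<in> B i0" by auto
    then have ev: "\<forall>\<^sub>F i in sequentially. U i s = V i s"
      using B(4) by (intro eventually_sequentiallyI[of i0]) (auto simp: V_def incseq_def split: split_indicator)
    have "incseq (\<lambda>i. U i s)" using U(2) by (auto simp: incseq_def le_fun_def)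
    from LIMSEQ_SUP[OF this] have "(\<lambda>i. U i s) \<longlonglongrightarrow> h s" using U(4) by simp
    then show ?thesis using ev by (rule Lim_transform_eventually)
  qed
  have VSUP: "(SUP i. V i s) = h s" for s
    using LIMSEQ_unique[OF LIMSEQ_SUP[OF Vinc] Vlim] .
  have "(\<lambda>m. \<integral>\<^sup>+\<omega>. expm (\<Sum>j. V m (J j \<omega>)) \<partial>M) \<longlonglongrightarrow> (\<integral>\<^sup>+\<omega>. expm (\<Sum>j. h (J j \<omega>)) \<partial>M)"
  proof (rule nn_integral_dominated_convergence[where w = "\<lambda>_. 1"])
    show "AE \<omega> in M. (\<lambda>m. expm (\<Sum>j. V m (J j \<omega>))) \<longlonglongrightarrow> expm (\<Sum>j. h (J j \<omega>))"
    proof (rule AE_I2)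
      fix \<omega>
      have "(SUP m. \<Sum>j. V m (J j \<omega>)) = (\<Sum>j. SUP m. V m (J j \<omega>))"
        using Vinc by (intro ennreal_suminf_SUP_eq[symmetric]) auto
      moreover have "incseq (\<lambda>m. \<Sum>j. V m (J j \<omega>))"
        using Vinc by (auto simp: incseq_def intro!: suminf_le)
      ultimately show "(\<lambda>m. expm (\<Sum>j. V m (J j \<omega>))) \<longlonglongrightarrow> expm (\<Sum>j. h (J j \<omega>))"
        using expm_LIMSEQ[of "\<lambda>m. \<Sum>j. V m (J j \<omega>)"] by (simp add: VSUP)
    qed
  qed (auto simp: expm_le_1 emeasure_space_1)
  moreover have "(\<lambda>m. \<integral>\<^sup>+\<omega>. expm (\<Sum>j. V m (J j \<omega>)) \<partial>M) \<longlonglongrightarrow> expm (\<integral>\<^sup>+s. 1 - expm (h s) \<partial>\<mu>)"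
  proof -
    have inc: "incseq (\<lambda>m. 1 - expm (V m s))" for s
      using Vinc[of s] by (auto simp: incseq_def intro!: ennreal_minus_mono expm_antimono)
    have "(\<lambda>m. 1 - expm (V m s)) \<longlonglongrightarrow> 1 - expm (h s)" for s
      using expm_LIMSEQ[OF Vinc[of s]] unfolding VSUP by (intro tendsto_intros) auto
    then have sup: "(SUP m. 1 - expm (V m s)) = 1 - expm (h s)" for s
      using LIMSEQ_unique[OF LIMSEQ_SUP[OF inc]] by blast
    have "(\<integral>\<^sup>+s. (SUP m. 1 - expm (V m s)) \<partial>\<mu>) = (SUP m. \<integral>\<^sup>+s. 1 - expm (V m s) \<partial>\<mu>)"
      using inc by (intro nn_integral_monotone_convergence_SUP) (auto simp: incseq_def le_fun_def)
    moreover have "incseq (\<lambda>m. \<integral>\<^sup>+s. 1 - expm (V m s) \<partial>\<mu>)"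
      using inc by (auto simp: incseq_def intro!: nn_integral_mono)
    ultimately have "(\<lambda>m. expm (\<integral>\<^sup>+s. 1 - expm (V m s) \<partial>\<mu>)) \<longlonglongrightarrow> expm (\<integral>\<^sup>+s. 1 - expm (h s) \<partial>\<mu>)"
      using expm_LIMSEQ[of "\<lambda>m. \<integral>\<^sup>+s. 1 - expm (V m s) \<partial>\<mu>"] by (simp add: sup)
    moreover have "(\<integral>\<^sup>+\<omega>. expm (\<Sum>j. V m (J j \<omega>)) \<partial>M) = expm (\<integral>\<^sup>+s. 1 - expm (V m s) \<partial>\<mu>)" for m
      by (rule laplace_simple[where B="B m"])
         (use assms V Vfin B(3) in \<open>auto simp: less_top\<close>, simp add: V_def)
    ultimately show ?thesis by simp
  qed
  ultimately show ?thesis by (rule LIMSEQ_unique)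
qed

section \<open>Sums over distinct points of a Poisson process\<close>

lemma borel_measurable_nn_integral_count_space:
  assumes "countable I" "\<And>i. i \<in> I \<Longrightarrow> f i \<in> borel_measurable M"
  shows "(\<lambda>x. \<integral>\<^sup>+i. f i x \<partial>count_space I) \<in> borel_measurable M"
proof (cases "finite I")
  case True
  with assms show ?thesis by (simp add: nn_integral_count_space_finite)
next
  case False
  note bij = bij_betw_from_nat_into[OF assms(1) False]
  have "(\<lambda>x. \<integral>\<^sup>+i. f i x \<partial>count_space I) = (\<lambda>x. \<Sum>n. f (from_nat_into I n) x)"
    by (subst nn_integral_bij_count_space[OF bij, symmetric]) (rule ext, rule nn_integral_count_space_nat)
  moreover have [measurable]: "f (from_nat_into I n) \<in> borel_measurable M" for n
    using False by (intro assms from_nat_into) auto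
  ultimately show ?thesis by simp
qed

lemma nn_integral_count_space_remove:
  assumes "j \<in> S"
  shows "(\<integral>\<^sup>+i. g i \<partial>count_space S) = g j + (\<integral>\<^sup>+i. g i \<partial>count_space (S - {j}))"
proof -
  have "(\<integral>\<^sup>+i. g i \<partial>count_space S) = (\<integral>\<^sup>+i. g i * indicator {j} i + g i * indicator (S - {j}) i \<partial>count_space UNIV)"
    using assms by (subst nn_integral_count_space_indicator) (auto intro!: nn_integral_cong split: split_indicator)
  also have "\<dots> = (\<integral>\<^sup>+i. g i * indicator {j} i \<partial>count_space UNIV) + (\<integral>\<^sup>+i. g i \<partial>count_space (S - {j}))"
    by (subst nn_integral_add) (auto simp: nn_integral_count_space_indicator)
  finally show ?thesis
    by (simp add: nn_integral_count_space_indicator[symmetric] nn_integral_count_space_finite)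
qed

definition distinct_lists :: "nat \<Rightarrow> 'a set \<Rightarrow> 'a list set" where
  "distinct_lists k S = {l. length l = k \<and> distinct l \<and> set l \<subseteq> S}"

lemma distinct_lists_0 [simp]: "distinct_lists 0 S = {[]}"
  by (auto simp: distinct_lists_def)

lemma countable_distinct_lists [simp]: "countable (distinct_lists k (S :: 'a :: countable set))"
  by auto

text \<open>The head of the list is chosen last, which fits the induction of \<open>poisson_campbell_mecke\<close>: it adds a point that differs from those
  already chosen.\<close>

lemma nn_integral_distinct_lists_Suc:
  "(\<integral>\<^sup>+l. F l \<partial>count_space (distinct_lists (Suc k) S)) =
     (\<integral>\<^sup>+l. \<integral>\<^sup>+j. F (j # l) \<partial>count_space (S - set l) \<partial>count_space (distinct_lists k S))"
proof -
  let ?D = "Sigma (distinct_lists k S) (\<lambda>l. S - set l)"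
  have "bij_betw (\<lambda>(l, j). j # l) ?D (distinct_lists (Suc k) S)"
  proof (rule bij_betw_imageI)
    show "inj_on (\<lambda>(l, j). j # l) ?D" by (auto simp: inj_on_def)
    show "(\<lambda>(l, j). j # l) ` ?D = distinct_lists (Suc k) S"
    proof (intro set_eqI iffI)
      fix l assume "l \<in> distinct_lists (Suc k) S"
      then obtain j l' where "l = j # l'" "(l', j) \<in> ?D"
        by (cases l) (auto simp: distinct_lists_def)
      then show "l \<in> (\<lambda>(l, j). j # l) ` ?D" by force
    qed (auto simp: distinct_lists_def)
  qed
  then have "(\<integral>\<^sup>+l. F l \<partial>count_space (distinct_lists (Suc k) S)) = (\<integral>\<^sup>+(l, j). F (j # l) \<partial>count_space ?D)"
    by (subst nn_integral_bij_count_space[symmetric]) (auto intro!: nn_integral_cong)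
  also have "\<dots> = (\<integral>\<^sup>+l. \<integral>\<^sup>+j. F (j # l) * indicator ?D (l, j) \<partial>count_space UNIV \<partial>count_space UNIV)"
    by (simp add: nn_integral_count_space_indicator case_prod_beta nn_integral_fst_count_space
        flip: nn_integral_fst_count_space)
  also have "\<dots> = (\<integral>\<^sup>+l. (\<integral>\<^sup>+j. F (j # l) \<partial>count_space (S - set l)) * indicator (distinct_lists k S) l \<partial>count_space UNIV)"
    by (intro nn_integral_cong)
       (auto simp: nn_integral_count_space_indicator intro!: nn_integral_cong split: split_indicator)
  finally show ?thesis by (simp add: nn_integral_count_space_indicator)
qed

lemma measurable_prod_list_map2:
  assumes "\<And>x y. x \<in> set xs \<Longrightarrow> (\<lambda>\<omega>. g x y \<omega>) \<in> borel_measurable M"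
  shows "(\<lambda>\<omega>. prod_list (map2 (\<lambda>x y. g x y \<omega>) xs ys) :: ennreal) \<in> borel_measurable M"
  using assms
proof (induction xs ys rule: list_induct2')
  case (4 x xs y ys)
  have [measurable]: "(\<lambda>\<omega>. g x y \<omega>) \<in> borel_measurable M" using 4 by auto
  have [measurable]: "(\<lambda>\<omega>. prod_list (map2 (\<lambda>x y. g x y \<omega>) xs ys)) \<in> borel_measurable M"
    using 4 by auto
  show ?case by simp
qed auto

text \<open>Written as a sum, the identity can be integrated even where integrals are infinite.\<close>

lemma expm_split: "expm a = expm (a + b) + expm a * (1 - expm b)"
proof -
  have "expm a * expm b + expm a * (1 - expm b) = expm a * (expm b + (1 - expm b))"
    by (simp add: distrib_left)
  also have "expm b + (1 - expm b) = 1"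
    by (rule add_diff_inverse_ennreal) (rule expm_le_1)
  finally show ?thesis by (simp add: expm_add)
qed

lemma one_minus_expm_add: "1 - expm (a + b) = (1 - expm a) + expm a * (1 - expm b)"
proof -
  have "1 = (1 - expm a) + expm a * (1 - expm b) + expm (a + b)"
    using expm_split[of a b] add_diff_inverse_ennreal[OF expm_le_1[of a]] by (simp add: add_ac)
  then show ?thesis by (metis ennreal_add_diff_cancel_right expm_finite(2) infinity_ennreal_def)
qed

text \<open>The points of \<open>l\<close> contribute \<open>f\<close> and all others contribute \<open>exp (- h)\<close>. In the induction step \<open>h\<close> is replaced by \<open>h + t \<phi>\<close>,
  where \<open>\<phi> = f exp h\<close> for the new function \<open>f\<close>. The derivative at \<open>t = 0\<close> of the sum on the left picks a point outside
  of \<open>l\<close> with weight \<open>\<phi>\<close>, and its factor \<open>exp (- h)\<close> turns this into \<open>f\<close>. On the right-hand side only the last factor depends on \<open>t\<close>, and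
  its derivative produces the integral of \<open>\<phi> exp (- h) = f\<close>.\<close>

lemma poisson_campbell_mecke:
  assumes "prob_space M" and pp: "poisson_process_points M \<mu> J" and sets [measurable_cong]: "sets \<mu> = sets borel"
    and "sigma_finite_measure \<mu>"
    and "\<And>f. f \<in> set fs \<Longrightarrow> f \<in> borel_measurable borel"
    and "\<And>f s. f \<in> set fs \<Longrightarrow> f s < \<top>"
    and "\<And>f. f \<in> set fs \<Longrightarrow> (\<integral>\<^sup>+s. f s \<partial>\<mu>) < \<top>"
    and "h \<in> borel_measurable borel" "\<And>s. h s < \<top>"
  shows "(\<integral>\<^sup>+\<omega>. \<integral>\<^sup>+l. prod_list (map2 (\<lambda>f j. f (J j \<omega>)) fs l)
             * expm (\<integral>\<^sup>+j. h (J j \<omega>) \<partial>count_space (UNIV - set l))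
           \<partial>count_space (distinct_lists (length fs) UNIV) \<partial>M)
       = prod_list (map (\<lambda>f. \<integral>\<^sup>+s. f s \<partial>\<mu>) fs) * expm (\<integral>\<^sup>+s. 1 - expm (h s) \<partial>\<mu>)"
  using assms(5-)
proof (induction fs arbitrary: h)
  case Nil
  then show ?case
    using laplace_functional[OF assms(1-4)]
    by (simp add: nn_integral_count_space_finite nn_integral_count_space_nat)
next
  case (Cons f fs)
  have J [measurable]: "J j \<in> borel_measurable M" for j using pp by (auto simp: poisson_process_points_def)
  have [measurable]: "f \<in> borel_measurable borel" "h \<in> borel_measurable borel"
    using Cons.prems by auto
  have f_fin: "f s < \<top>" "h s < \<top>" for s using Cons.prems by auto
  \<comment> \<open>the inverse is harmless: \<open>expm (h s)\<close> is positive because \<open>h s\<close> is finite\<close>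
  define \<phi> where "\<phi> s = f s * inverse (expm (h s))" for s
  have [measurable]: "\<phi> \<in> borel_measurable borel" unfolding \<phi>_def by measurable
  have expm_h: "expm (h s) \<noteq> 0" for s using f_fin(2)[of s] by (cases "h s") auto
  have \<phi>_fin: "\<phi> s < \<top>" for s
    using f_fin(1)[of s] expm_h[of s] by (simp add: \<phi>_def ennreal_mult_eq_top_iff ennreal_inverse_eq_top_iff less_top[symmetric])
  have \<phi>: "expm (h s) * \<phi> s = f s" for s
    using expm_h[of s] ennreal_divide_self[of "expm (h s)"] by (simp add: \<phi>_def divide_ennreal_def mult_ac)
  define R where "R l \<omega> = prod_list (map2 (\<lambda>f j. f (J j \<omega>)) fs l)" for l \<omega>
  define H where "H l \<omega> = (\<integral>\<^sup>+j. h (J j \<omega>) \<partial>count_space (UNIV - set l))" for l \<omega>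
  define \<Phi> where "\<Phi> l \<omega> = (\<integral>\<^sup>+j. \<phi> (J j \<omega>) \<partial>count_space (UNIV - set l))" for l \<omega>
  define a where "a = prod_list (map (\<lambda>f. \<integral>\<^sup>+s. f s \<partial>\<mu>) fs)"
  define \<psi> where "\<psi> h = (\<integral>\<^sup>+s. 1 - expm (h s) \<partial>\<mu>)" for h
  let ?D = "distinct_lists (length fs) (UNIV :: nat set)"
  have [measurable]: "R l \<in> borel_measurable M" for l
    unfolding R_def using Cons.prems(1) by (intro measurable_prod_list_map2) (auto intro: measurable_compose[OF J])
  have [measurable]: "H l \<in> borel_measurable M" "\<Phi> l \<in> borel_measurable M" for l
    unfolding H_def \<Phi>_def by (intro borel_measurable_nn_integral_count_space; simp)+
  have a_fin: "a < \<top>"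
    using Cons.prems(3) unfolding a_def by (induction fs) (auto simp: ennreal_mult_less_top)
  have insert: "(\<integral>\<^sup>+j. f (J j \<omega>) * R l \<omega> * expm (\<integral>\<^sup>+i. h (J i \<omega>) \<partial>count_space (UNIV - set (j # l))) \<partial>count_space (UNIV - set l))
      = R l \<omega> * (expm (H l \<omega>) * \<Phi> l \<omega>)" for l \<omega>
  proof -
    have "f (J j \<omega>) * R l \<omega> * expm (\<integral>\<^sup>+i. h (J i \<omega>) \<partial>count_space (UNIV - set (j # l)))
      = R l \<omega> * (expm (H l \<omega>) * \<phi> (J j \<omega>))" if "j \<in> UNIV - set l" for j
    proof -
      have "UNIV - set (j # l) = UNIV - set l - {j}" by auto
      then have "H l \<omega> = h (J j \<omega>) + (\<integral>\<^sup>+i. h (J i \<omega>) \<partial>count_space (UNIV - set (j # l)))"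
        unfolding H_def using nn_integral_count_space_remove[OF that] by simp
      then show ?thesis
        by (simp add: expm_add \<phi>[symmetric, of "J j \<omega>"] mult_ac)
    qed
    then show ?thesis
      unfolding \<Phi>_def by (simp add: nn_integral_cmult mult.assoc[symmetric] cong: nn_integral_cong_simp)
  qed
  \<comment> \<open>the increment of the summand of \<open>l\<close> when \<open>h\<close> is replaced by \<open>h + \<phi> / 2 ^ m\<close>; \<open>2 ^ m * D m l \<omega>\<close> is the difference quotient\<close>
  define D where "D m l \<omega> = R l \<omega> * (expm (H l \<omega>) * (1 - expm (\<Phi> l \<omega> / 2 ^ m)))" for m :: nat and l \<omega>
  have [measurable]: "D m l \<in> borel_measurable M" for m l unfolding D_def by measurable
  have D_inc: "incseq (\<lambda>m. 2 ^ m * D m l \<omega>)" for l \<omega>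
  proof -
    have "incseq (\<lambda>m. R l \<omega> * expm (H l \<omega>) * (2 ^ m * (1 - expm (\<Phi> l \<omega> / 2 ^ m))))"
      using expm_quot_mono[of "\<Phi> l \<omega>"] unfolding incseq_def by (auto intro!: mult_left_mono)
    then show ?thesis by (simp add: D_def mult_ac)
  qed
  have D_sup: "(SUP m. 2 ^ m * D m l \<omega>) = R l \<omega> * (expm (H l \<omega>) * \<Phi> l \<omega>)" for l \<omega>
  proof -
    have "(SUP m. 2 ^ m * D m l \<omega>) = (SUP m. R l \<omega> * expm (H l \<omega>) * (2 ^ m * (1 - expm (\<Phi> l \<omega> / 2 ^ m))))"
      by (simp add: D_def mult_ac)
    also have "\<dots> = R l \<omega> * expm (H l \<omega>) * \<Phi> l \<omega>"
      by (simp add: SUP_mult_left_ennreal[symmetric] expm_quot_SUP)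
    finally show ?thesis by (simp add: mult_ac)
  qed
  define b where "b m = (\<integral>\<^sup>+s. expm (h s) * (1 - expm (\<phi> s / 2 ^ m)) \<partial>\<mu>)" for m :: nat
  have D_int: "(\<integral>\<^sup>+\<omega>. \<integral>\<^sup>+l. D m l \<omega> \<partial>count_space ?D \<partial>M) = a * expm (\<psi> h) * (1 - expm (b m))" for m
  proof -
    let ?h = "\<lambda>s. h s + \<phi> s / 2 ^ m"
    have h': "?h s < \<top>" for s
      using f_fin(2) \<phi>_fin[of s] by (simp add: less_top[symmetric] ennreal_divide_eq_top_iff)
    have H': "(\<integral>\<^sup>+j. ?h (J j \<omega>) \<partial>count_space (UNIV - set l)) = H l \<omega> + \<Phi> l \<omega> / 2 ^ m" for l \<omega>
      by (simp add: H_def \<Phi>_def nn_integral_add nn_integral_divide)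
    have X: "(\<integral>\<^sup>+\<omega>. \<integral>\<^sup>+l. R l \<omega> * expm (H l \<omega>) \<partial>count_space ?D \<partial>M) = a * expm (\<psi> h)"
      unfolding R_def H_def a_def \<psi>_def by (rule Cons.IH) (use Cons.prems in auto)
    have Y: "(\<integral>\<^sup>+\<omega>. \<integral>\<^sup>+l. R l \<omega> * expm (H l \<omega> + \<Phi> l \<omega> / 2 ^ m) \<partial>count_space ?D \<partial>M) = a * expm (\<psi> ?h)"
      unfolding R_def H'[symmetric] a_def \<psi>_def by (rule Cons.IH) (use Cons.prems h' in auto)
    \<comment> \<open>the integrals are added before the finite one is subtracted, so the summands themselves may be infinite\<close>
    have "a * expm (\<psi> h) = (\<integral>\<^sup>+\<omega>. \<integral>\<^sup>+l. R l \<omega> * expm (H l \<omega> + \<Phi> l \<omega> / 2 ^ m) + D m l \<omega> \<partial>count_space ?D \<partial>M)"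
      unfolding X[symmetric] D_def distrib_left[symmetric] expm_split[symmetric] ..
    also have "\<dots> = a * expm (\<psi> ?h) + (\<integral>\<^sup>+\<omega>. \<integral>\<^sup>+l. D m l \<omega> \<partial>count_space ?D \<partial>M)"
      unfolding Y[symmetric]
      by (simp add: nn_integral_add borel_measurable_nn_integral_count_space)
    finally have "(\<integral>\<^sup>+\<omega>. \<integral>\<^sup>+l. D m l \<omega> \<partial>count_space ?D \<partial>M) = a * expm (\<psi> h) - a * expm (\<psi> ?h)"
      using a_fin by (simp add: ennreal_mult_eq_top_iff)
    also have "\<psi> ?h = \<psi> h + b m"
      unfolding \<psi>_def b_def one_minus_expm_add by (intro nn_integral_add) measurable
    also have "a * expm (\<psi> h) - a * expm (\<psi> h + b m) = a * expm (\<psi> h) * (1 - expm (b m))"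
      using a_fin by (simp add: expm_add ennreal_right_diff_distrib ennreal_mult_eq_top_iff mult.assoc)
    finally show ?thesis .
  qed
  \<comment> \<open>the quotients \<open>y\<close> increase to the integral of \<open>f\<close>, and the outer exponential is differentiated along them\<close>
  define y where "y m = 2 ^ m * b m" for m
  have b_y: "b m = y m / 2 ^ m" for m
    by (simp add: y_def ennreal_mult_divide_eq power_eq_top_ennreal mult.commute[of "2 ^ m"])
  have y_alt: "y m = (\<integral>\<^sup>+s. expm (h s) * (2 ^ m * (1 - expm (\<phi> s / 2 ^ m))) \<partial>\<mu>)" for m
    unfolding y_def b_def by (subst nn_integral_cmult[symmetric]) (auto simp: mult_ac)
  have inc: "incseq (\<lambda>m. expm (h s) * (2 ^ m * (1 - expm (\<phi> s / 2 ^ m))))" for s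
    using expm_quot_mono[of "\<phi> s"] unfolding incseq_def by (auto intro!: mult_left_mono)
  then have y_inc: "incseq y"
    unfolding y_alt incseq_def by (auto intro!: nn_integral_mono)
  have y_sup: "(SUP m. y m) = (\<integral>\<^sup>+s. f s \<partial>\<mu>)"
    unfolding y_alt using inc
    by (subst nn_integral_monotone_convergence_SUP[symmetric])
       (auto simp: incseq_def le_fun_def SUP_mult_left_ennreal[symmetric] expm_quot_SUP \<phi>)
  have "(\<integral>\<^sup>+\<omega>. \<integral>\<^sup>+l. prod_list (map2 (\<lambda>f j. f (J j \<omega>)) (f # fs) l)
             * expm (\<integral>\<^sup>+j. h (J j \<omega>) \<partial>count_space (UNIV - set l))
           \<partial>count_space (distinct_lists (length (f # fs)) UNIV) \<partial>M)
     = (\<integral>\<^sup>+\<omega>. \<integral>\<^sup>+l. (SUP m. 2 ^ m * D m l \<omega>) \<partial>count_space ?D \<partial>M)"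
    unfolding D_sup insert[symmetric] by (simp add: nn_integral_distinct_lists_Suc R_def)
  also have "\<dots> = (SUP m. \<integral>\<^sup>+\<omega>. \<integral>\<^sup>+l. 2 ^ m * D m l \<omega> \<partial>count_space ?D \<partial>M)"
  proof (subst nn_integral_monotone_convergence_SUP[symmetric])
    show "incseq (\<lambda>m \<omega>. \<integral>\<^sup>+l. 2 ^ m * D m l \<omega> \<partial>count_space ?D)"
      using D_inc by (auto simp: incseq_def le_fun_def intro!: nn_integral_mono)
    show "(\<lambda>\<omega>. \<integral>\<^sup>+l. 2 ^ m * D m l \<omega> \<partial>count_space ?D) \<in> borel_measurable M" for m
      by (intro borel_measurable_nn_integral_count_space) auto
    show "(\<integral>\<^sup>+\<omega>. \<integral>\<^sup>+l. (SUP m. 2 ^ m * D m l \<omega>) \<partial>count_space ?D \<partial>M) =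
      (\<integral>\<^sup>+\<omega>. (SUP m. \<integral>\<^sup>+l. 2 ^ m * D m l \<omega> \<partial>count_space ?D) \<partial>M)"
      using D_inc by (intro nn_integral_cong nn_integral_monotone_convergence_SUP) (auto simp: incseq_def le_fun_def)
  qed
  also have "\<dots> = (SUP m. 2 ^ m * (a * expm (\<psi> h) * (1 - expm (b m))))"
    unfolding D_int[symmetric]
    by (simp add: nn_integral_cmult borel_measurable_nn_integral_count_space)
  also have "\<dots> = (SUP m. a * expm (\<psi> h) * (2 ^ m * (1 - expm (y m / 2 ^ m))))"
    by (simp add: b_y[symmetric] mult_ac)
  also have "\<dots> = a * expm (\<psi> h) * (\<integral>\<^sup>+s. f s \<partial>\<mu>)"
    by (simp add: SUP_mult_left_ennreal[symmetric] expm_quot_SUP2[OF y_inc] y_sup)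
  finally show ?case by (simp add: a_def \<psi>_def mult_ac)
qed

section \<open>The partition of a sample from a discrete probability measure\<close>

text \<open>Boxes generate the product \<open>\<sigma>\<close>-algebra, and on a box the product measure is a finite product of measurable functions.\<close>

lemma measurable_PiM_prob_algebra:
  assumes P: "P \<in> M \<rightarrow>\<^sub>M prob_algebra N" and "finite I"
  shows "(\<lambda>\<omega>. \<Pi>\<^sub>M i\<in>I. P \<omega>) \<in> M \<rightarrow>\<^sub>M prob_algebra (\<Pi>\<^sub>M i\<in>I. N)"
proof (rule measurable_prob_algebra_generated[OF sets_PiM Int_stable_prod_algebra])
  have P': "prob_space (P \<omega>)" "sets (P \<omega>) = sets N" if "\<omega> \<in> space M" for \<omega>
    using measurable_space[OF P that] by (auto simp: space_prob_algebra)
  show "prod_algebra I (\<lambda>i. N) \<subseteq> Pow (\<Pi>\<^sub>E i\<in>I. space N)"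
    by (rule prod_algebra_sets_into_space)
  fix \<omega> assume \<omega>: "\<omega> \<in> space M"
  show "prob_space (\<Pi>\<^sub>M i\<in>I. P \<omega>)" using P'[OF \<omega>] by (intro prob_space_PiM)
  show "sets (\<Pi>\<^sub>M i\<in>I. P \<omega>) = sets (\<Pi>\<^sub>M i\<in>I. N)" using P'[OF \<omega>] by (intro sets_PiM_cong) auto
next
  fix A assume "A \<in> prod_algebra I (\<lambda>i. N)"
  then obtain X where X: "A = (\<Pi>\<^sub>E i\<in>I. X i)" "\<And>i. i \<in> I \<Longrightarrow> X i \<in> sets N"
    using \<open>finite I\<close> by (auto simp: prod_algebra_eq_finite)
  have "emeasure (\<Pi>\<^sub>M i\<in>I. P \<omega>) A = (\<Prod>i\<in>I. emeasure (P \<omega>) (X i))" if "\<omega> \<in> space M" for \<omega>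
  proof -
    have P': "prob_space (P \<omega>)" "sets (P \<omega>) = sets N"
      using measurable_space[OF P that] by (auto simp: space_prob_algebra)
    interpret prob_space "P \<omega>" by fact
    interpret product_sigma_finite "\<lambda>_. P \<omega>" ..
    show ?thesis unfolding X(1) using X(2) P'(2) \<open>finite I\<close> by (intro emeasure_PiM) auto
  qed
  moreover have "(\<lambda>\<omega>. \<Prod>i\<in>I. emeasure (P \<omega>) (X i)) \<in> borel_measurable M"
    using X(2) measurable_prob_algebraD[OF P] by (intro borel_measurable_prod_ennreal measurable_emeasure_kernel)
  ultimately show "(\<lambda>\<omega>. emeasure (\<Pi>\<^sub>M i\<in>I. P \<omega>) A) \<in> borel_measurable M"
    by (simp cong: measurable_cong)
qed

lemma equiv_tie: "equiv {1..n} {(i, j). i \<in> {1..n} \<and> j \<in> {1..n} \<and> \<theta> i = \<theta> j}"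
  by (auto intro!: equivI refl_onI symI transI)

lemma partition_on_tie_partition: "partition_on {1..n} (tie_partition n \<theta>)"
  unfolding tie_partition_def by (rule partition_on_quotient[OF equiv_tie])

text \<open>A partition and its equivalence relation determine each other; the labels \<open>b\<close> stand for the relation.\<close>

lemma tie_partition_eq_iff:
  assumes P: "partition_on {1..n} P"
    and b: "\<And>i j. i \<in> {1..n} \<Longrightarrow> j \<in> {1..n} \<Longrightarrow> b i = b j \<longleftrightarrow> (\<exists>B\<in>P. i \<in> B \<and> j \<in> B)"
  shows "tie_partition n \<theta> = P \<longleftrightarrow> (\<forall>i\<in>{1..n}. \<forall>j\<in>{1..n}. \<theta> i = \<theta> j \<longleftrightarrow> b i = b j)"
proof
  assume tie: "tie_partition n \<theta> = P"
  show "\<forall>i\<in>{1..n}. \<forall>j\<in>{1..n}. \<theta> i = \<theta> j \<longleftrightarrow> b i = b j"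
  proof (intro ballI)
    fix i j assume ij: "i \<in> {1..n}" "j \<in> {1..n}"
    have "(\<exists>B\<in>P. i \<in> B \<and> j \<in> B) \<longleftrightarrow> \<theta> i = \<theta> j"
      unfolding tie[symmetric] tie_partition_def quotient_def using ij by auto
    then show "\<theta> i = \<theta> j \<longleftrightarrow> b i = b j" using b[OF ij] by simp
  qed
next
  assume eq: "\<forall>i\<in>{1..n}. \<forall>j\<in>{1..n}. \<theta> i = \<theta> j \<longleftrightarrow> b i = b j"
  have "{(i, j). i \<in> {1..n} \<and> j \<in> {1..n} \<and> \<theta> i = \<theta> j} = {(i, j). \<exists>B\<in>P. i \<in> B \<and> j \<in> B}"
    using eq b partition_onD1[OF P] by blast
  then show "tie_partition n \<theta> = P"
    unfolding tie_partition_def using partition_on_eq_quotient[OF P] by simp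
qed

lemma blocks_of_sizes_labels:
  assumes C: "blocks_of_sizes ns C" and n: "sum_list ns = n"
  shows "\<exists>b. (\<forall>i\<in>{1..n}. b i < length ns \<and> i \<in> C ! b i) \<and>
    (\<forall>c<length ns. \<forall>i\<in>C ! c. i \<in> {1..n} \<and> b i = c) \<and>
    (\<forall>i\<in>{1..n}. \<forall>j\<in>{1..n}. b i = b j \<longleftrightarrow> (\<exists>B\<in>set C. i \<in> B \<and> j \<in> B))"
proof -
  have part: "partition_on {1..n} (set C)" and dist: "distinct C" and card: "map card C = ns"
    using C n by (auto simp: blocks_of_sizes_def)
  have len: "length C = length ns" using card by auto
  define b where "b i = (SOME c. c < length ns \<and> i \<in> C ! c)" for i
  have b: "b i < length ns \<and> i \<in> C ! b i" if "i \<in> {1..n}" for i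
  proof -
    from that obtain B where "B \<in> set C" "i \<in> B" using partition_onD1[OF part] by (metis UnionE)
    then have "\<exists>c. c < length ns \<and> i \<in> C ! c" by (metis in_set_conv_nth len)
    then show ?thesis unfolding b_def by (rule someI_ex)
  qed
  have uniq: "c = c'" if "c < length ns" "c' < length ns" "i \<in> C ! c" "i \<in> C ! c'" for i c c'
  proof -
    have "C ! c \<in> set C" "C ! c' \<in> set C" using that len by auto
    then have "C ! c = C ! c'"
      using partition_onD2[OF part] that unfolding disjoint_def by blast
    then show ?thesis using nth_eq_iff_index_eq[OF dist] that len by auto
  qed
  have b': "i \<in> {1..n} \<and> b i = c" if "c < length ns" "i \<in> C ! c" for i c
  proof -
    have "i \<in> {1..n}" using that len partition_onD1[OF part] by (metis UnionI nth_mem)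
    then show ?thesis using uniq b that by blast
  qed
  have bb: "b i = b j \<longleftrightarrow> (\<exists>B\<in>set C. i \<in> B \<and> j \<in> B)" if "i \<in> {1..n}" "j \<in> {1..n}" for i j
    using b b' that len by (metis in_set_conv_nth)
  show ?thesis
    by (intro exI[of _ b] conjI) (use b in blast, use b' in blast, use bb in blast)
qed

abbreviation tie_event :: "nat \<Rightarrow> (nat \<Rightarrow> 'a) measure \<Rightarrow> nat set set \<Rightarrow> (nat \<Rightarrow> 'a) set" where
  "tie_event n M P \<equiv> {\<theta>\<in>space M. tie_partition n \<theta> = P}"

text \<open>Ties are the zeros of distances, which are measurable because the space is second countable.\<close>

lemma sets_tie_partition:
  fixes N :: "'a :: {second_countable_topology, metric_space} measure"
  assumes id: "(\<lambda>x. x) \<in> borel_measurable N" and P: "partition_on {1..n} P"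
  shows "tie_event n (\<Pi>\<^sub>M i\<in>{1..n}. N) P \<in> sets (\<Pi>\<^sub>M i\<in>{1..n}. N)"
proof -
  define b where "b i = {j. \<exists>B\<in>P. i \<in> B \<and> j \<in> B}" for i
  have bb: "b i = b j \<longleftrightarrow> (\<exists>B\<in>P. i \<in> B \<and> j \<in> B)" if ij: "i \<in> {1..n}" "j \<in> {1..n}" for i j
  proof
    assume "b i = b j"
    moreover have "i \<in> b i" using ij partition_onD1[OF P] by (auto simp: b_def)
    ultimately show "\<exists>B\<in>P. i \<in> B \<and> j \<in> B" by (auto simp: b_def)
  next
    assume "\<exists>B\<in>P. i \<in> B \<and> j \<in> B"
    then obtain B where B: "B \<in> P" "i \<in> B" "j \<in> B" by auto
    then have "b i = B" "b j = B" using partition_onD2[OF P] by (auto simp: b_def disjoint_def)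
    then show "b i = b j" by simp
  qed
  have [measurable]: "(\<lambda>\<theta>. \<theta> i) \<in> borel_measurable (\<Pi>\<^sub>M i\<in>{1..n}. N)" if "i \<in> {1..n}" for i
    using measurable_compose[OF measurable_component_singleton[OF that] id] .
  have iff: "tie_partition n \<theta> = P \<longleftrightarrow> (\<forall>i\<in>{1..n}. \<forall>j\<in>{1..n}. \<theta> i = \<theta> j \<longleftrightarrow> b i = b j)" for \<theta> :: "nat \<Rightarrow> 'a"
    by (rule tie_partition_eq_iff[OF P]) (rule bb)
  have "tie_event n (\<Pi>\<^sub>M i\<in>{1..n}. N) P =
    {\<theta>\<in>space (\<Pi>\<^sub>M i\<in>{1..n}. N). \<forall>i\<in>{1..n}. \<forall>j\<in>{1..n}. dist (\<theta> i) (\<theta> j) = 0 \<longleftrightarrow> b i = b j}"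
    by (simp add: iff)
  also have "\<dots> \<in> sets (\<Pi>\<^sub>M i\<in>{1..n}. N)" by measurable
  finally show ?thesis .
qed

lemma prod_list_map2_conv_prod:
  assumes "length xs = k" "length ys = k"
  shows "prod_list (map2 f xs ys) = (\<Prod>i<k. f (xs ! i) (ys ! i) :: 'a :: comm_monoid_mult)"
  using assms by (simp add: prod.list_conv_set_nth atLeast0LessThan)

text \<open>The atoms are indexed by \<open>S\<close>. The locations must be distinct, so that the mass at \<open>\<tau> j\<close> is exactly \<open>w j\<close>.\<close>

abbreviation has_atoms :: "'a measure \<Rightarrow> nat set \<Rightarrow> (nat \<Rightarrow> ennreal) \<Rightarrow> (nat \<Rightarrow> 'a) \<Rightarrow> 'a measure \<Rightarrow> bool" where
  "has_atoms N S w \<tau> Q \<equiv> inj_on \<tau> S \<and> (\<forall>j\<in>S. \<tau> j \<in> space N) \<and>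
     (\<forall>A\<in>sets N. emeasure Q A = (\<integral>\<^sup>+j. w j * indicator A (\<tau> j) \<partial>count_space S))"

text \<open>The conditional probability, given the atoms, that the blocks of sizes \<open>ns\<close> pick distinct atoms.\<close>

abbreviation atom_sum :: "nat list \<Rightarrow> (nat \<Rightarrow> ennreal) \<Rightarrow> nat set \<Rightarrow> ennreal" where
  "atom_sum ns w S \<equiv> \<integral>\<^sup>+l. prod_list (map2 (\<lambda>m j. w j ^ m) ns l) \<partial>count_space (distinct_lists (length ns) S)"

text \<open>Up to a null set the sample consists of atoms. Then the event is the disjoint union, over the lists \<open>l\<close> of distinct indices, of the boxes on which
  all sample points of the \<open>c\<close>-th block equal the atom with index \<open>l ! c\<close>.\<close>

lemma emeasure_tie_partition_discrete:
  fixes Q :: "'a :: {second_countable_topology, metric_space} measure" and S :: "nat set"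
  assumes "prob_space Q" and id: "(\<lambda>x. x) \<in> borel_measurable Q"
    and inj: "inj_on \<tau> S" and \<tau>: "\<And>j. j \<in> S \<Longrightarrow> \<tau> j \<in> space Q"
    and Q: "\<And>A. A \<in> sets Q \<Longrightarrow> emeasure Q A = (\<integral>\<^sup>+j. w j * indicator A (\<tau> j) \<partial>count_space S)"
    and C: "blocks_of_sizes ns C" and n: "sum_list ns = n"
  shows "emeasure (\<Pi>\<^sub>M i\<in>{1..n}. Q) (tie_event n (\<Pi>\<^sub>M i\<in>{1..n}. Q) (set C)) =
    atom_sum ns w S"
proof -
  interpret Q: prob_space Q by fact
  interpret PQ: product_sigma_finite "\<lambda>_ :: nat. Q" ..
  let ?k = "length ns" and ?\<Pi> = "\<Pi>\<^sub>M i\<in>{1..n}. Q"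
  have part: "partition_on {1..n} (set C)" and dist: "distinct C" and card: "map card C = ns"
    using C n by (auto simp: blocks_of_sizes_def)
  have len: "length C = ?k" using card by auto
  from blocks_of_sizes_labels[OF C n] obtain b where
    "(\<forall>i\<in>{1..n}. b i < ?k \<and> i \<in> C ! b i) \<and>
     (\<forall>c<?k. \<forall>i\<in>C ! c. i \<in> {1..n} \<and> b i = c) \<and>
     (\<forall>i\<in>{1..n}. \<forall>j\<in>{1..n}. b i = b j \<longleftrightarrow> (\<exists>B\<in>set C. i \<in> B \<and> j \<in> B))" ..
  then have b12: "\<forall>i\<in>{1..n}. b i < ?k \<and> i \<in> C ! b i"
    and b3: "\<forall>c<?k. \<forall>i\<in>C ! c. i \<in> {1..n} \<and> b i = c"
    and b4: "\<forall>i\<in>{1..n}. \<forall>j\<in>{1..n}. b i = b j \<longleftrightarrow> (\<exists>B\<in>set C. i \<in> B \<and> j \<in> B)"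
    by - (erule conjE, (erule conjE)?, assumption)+
  have b: "\<And>i. i \<in> {1..n} \<Longrightarrow> b i < ?k" "\<And>i. i \<in> {1..n} \<Longrightarrow> i \<in> C ! b i"
    using b12 by blast+
  note b = b b3[rule_format] b4[rule_format]
  have ex: "\<exists>i\<in>{1..n}. b i = c" if "c < ?k" for c
  proof -
    have "C ! c \<noteq> {}" using partition_onD3[OF part] that len by (metis nth_mem)
    then show ?thesis using b(3)[OF that] by blast
  qed
  have sing: "{\<tau> j} \<in> sets Q" if "j \<in> S" for j
  proof -
    have "(\<lambda>x. x) -` {\<tau> j} \<inter> space Q \<in> sets Q" by (rule measurable_sets[OF id]) simp
    moreover have "(\<lambda>x. x) -` {\<tau> j} \<inter> space Q = {\<tau> j}" using \<tau>[OF that] by auto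
    ultimately show ?thesis by simp
  qed
  have wS: "emeasure Q {\<tau> j} = w j" if "j \<in> S" for j
  proof -
    have "emeasure Q {\<tau> j} = (\<integral>\<^sup>+i. w i * indicator {j} i \<partial>count_space S)"
      unfolding Q[OF sing[OF that]] using that inj
      by (intro nn_integral_cong) (auto simp: inj_on_def split: split_indicator)
    also have "\<dots> = w j" using that by (subst nn_integral_indicator_finite) auto
    finally show ?thesis .
  qed
  \<comment> \<open>\<open>b i\<close> is the position of the block that contains \<open>i\<close>\<close>
  define Box where "Box l = (\<Pi>\<^sub>E i\<in>{1..n}. {\<tau> (l ! b i)})" for l
  let ?D = "distinct_lists ?k S"
  have lS: "l ! b i \<in> S" if "l \<in> ?D" "i \<in> {1..n}" for l i
    using that b(1) by (auto simp: distinct_lists_def)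
  have Box_sets: "Box l \<in> sets ?\<Pi>" if "l \<in> ?D" for l
    unfolding Box_def using sing lS[OF that] by (intro sets_PiM_I_finite) auto
  have Box_emeasure: "emeasure ?\<Pi> (Box l) = prod_list (map2 (\<lambda>m j. w j ^ m) ns l)" if l: "l \<in> ?D" for l
  proof -
    have "emeasure ?\<Pi> (Box l) = (\<Prod>i\<in>{1..n}. w (l ! b i))"
      unfolding Box_def using sing lS[OF l] wS by (subst PQ.emeasure_PiM) auto
    also have "\<dots> = (\<Prod>c<?k. \<Prod>i\<in>{i\<in>{1..n}. b i = c}. w (l ! b i))"
      using b(1) by (intro prod.group[symmetric]) auto
    also have "\<dots> = (\<Prod>c<?k. w (l ! c) ^ (ns ! c))"
    proof (intro prod.cong refl)
      fix c assume c: "c \<in> {..<?k}"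
      have eq: "{i\<in>{1..n}. b i = c} = C ! c" using b(2,3) c by auto
      have cd: "card (C ! c) = ns ! c"
        unfolding card[symmetric] using c len by (subst nth_map) auto
      have "(\<Prod>i\<in>C ! c. w (l ! b i)) = (\<Prod>i\<in>C ! c. w (l ! c))"
        using b(3) c by (intro prod.cong refl) simp
      then show "(\<Prod>i\<in>{i\<in>{1..n}. b i = c}. w (l ! b i)) = w (l ! c) ^ (ns ! c)"
        unfolding eq by (simp add: cd)
    qed
    also have "\<dots> = prod_list (map2 (\<lambda>m j. w j ^ m) ns l)"
      using l by (subst prod_list_map2_conv_prod[where k="?k"]) (auto simp: distinct_lists_def)
    finally show ?thesis .
  qed
  have disj: "disjoint_family_on Box ?D"
    unfolding disjoint_family_on_def
  proof (intro ballI impI, rule ccontr)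
    fix l l' assume l: "l \<in> ?D" "l' \<in> ?D" "l \<noteq> l'" and "Box l \<inter> Box l' \<noteq> {}"
    then obtain \<theta> where "\<theta> \<in> Box l" "\<theta> \<in> Box l'" by auto
    then have "\<tau> (l ! b i) = \<tau> (l' ! b i)" if "i \<in> {1..n}" for i
      using that by (auto simp: Box_def PiE_iff)
    then have "l ! b i = l' ! b i" if "i \<in> {1..n}" for i
      using inj lS l that by (auto simp: inj_on_def)
    then have "l ! c = l' ! c" if "c < ?k" for c using ex[OF that] by auto
    then show False using l by (auto simp: distinct_lists_def list_eq_iff_nth_eq)
  qed
  let ?E = "tie_event n ?\<Pi> (set C)"
  have tie_iff: "tie_partition n \<theta> = set C \<longleftrightarrow> (\<forall>i\<in>{1..n}. \<forall>j\<in>{1..n}. \<theta> i = \<theta> j \<longleftrightarrow> b i = b j)"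
    for \<theta> :: "nat \<Rightarrow> 'a"
    by (rule tie_partition_eq_iff[OF part]) (rule b(4))
  have iff: "\<theta> \<in> (\<Union>l\<in>?D. Box l) \<longleftrightarrow> \<theta> \<in> ?E"
    if \<theta>: "\<theta> \<in> space ?\<Pi>" "\<forall>i\<in>{1..n}. \<theta> i \<in> \<tau> ` S" for \<theta>
  proof
    assume "\<theta> \<in> (\<Union>l\<in>?D. Box l)"
    then obtain l where l: "l \<in> ?D" "\<theta> \<in> Box l" by auto
    have "\<theta> i = \<theta> j \<longleftrightarrow> b i = b j" if "i \<in> {1..n}" "j \<in> {1..n}" for i j
    proof -
      have "\<theta> i = \<theta> j \<longleftrightarrow> \<tau> (l ! b i) = \<tau> (l ! b j)"
        using l(2) that by (auto simp: Box_def PiE_iff)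
      also have "\<dots> \<longleftrightarrow> l ! b i = l ! b j"
        using inj lS[OF l(1)] that by (auto simp: inj_on_def)
      also have "\<dots> \<longleftrightarrow> b i = b j"
        using l(1) b(1) that by (auto simp: distinct_lists_def nth_eq_iff_index_eq)
      finally show ?thesis .
    qed
    then have "tie_partition n \<theta> = set C" unfolding tie_iff by blast
    then show "\<theta> \<in> ?E" using \<theta> by simp
  next
    assume "\<theta> \<in> ?E"
    then have tie: "\<theta> i = \<theta> j \<longleftrightarrow> b i = b j" if "i \<in> {1..n}" "j \<in> {1..n}" for i j
      using that tie_iff by blast
    \<comment> \<open>read off from the sample which atom the \<open>c\<close>-th block has picked; blocks are nonempty\<close>
    have "\<forall>c\<in>{..<?k}. \<exists>j\<in>S. \<exists>i\<in>{1..n}. b i = c \<and> \<tau> j = \<theta> i"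
      using ex \<theta>(2) by (metis imageE lessThan_iff)
    then obtain s where s: "\<And>c. c < ?k \<Longrightarrow> s c \<in> S \<and> (\<exists>i\<in>{1..n}. b i = c \<and> \<tau> (s c) = \<theta> i)"
      by (metis lessThan_iff)
    define l where "l = map s [0..<?k]"
    have "inj_on s {..<?k}"
    proof (rule inj_onI)
      fix c d assume cd: "c \<in> {..<?k}" "d \<in> {..<?k}" "s c = s d"
      with s[of c] s[of d] obtain i j where "i \<in> {1..n}" "j \<in> {1..n}" "b i = c" "b j = d" "\<theta> i = \<theta> j"
        by auto
      then show "c = d" using tie by blast
    qed
    then have "l \<in> ?D"
      using s by (auto simp: l_def distinct_lists_def distinct_map atLeast0LessThan)
    moreover have "\<theta> i = \<tau> (l ! b i)" if "i \<in> {1..n}" for i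
      using s[of "b i"] b(1)[OF that] tie that by (force simp: l_def)
    then have "\<theta> \<in> Box l"
      using \<theta>(1) by (auto simp: Box_def space_PiM PiE_iff)
    ultimately show "\<theta> \<in> (\<Union>l\<in>?D. Box l)" by auto
  qed
  \<comment> \<open>the atoms carry all of the mass, hence almost every sample consists of atoms\<close>
  have \<tau>S: "\<tau> ` S \<in> sets Q"
  proof -
    have "(\<Union>j\<in>S. {\<tau> j}) \<in> sets Q" using sing by (intro sets.countable_UN') auto
    moreover have "(\<Union>j\<in>S. {\<tau> j}) = \<tau> ` S" by auto
    ultimately show ?thesis by simp
  qed
  have "emeasure Q (\<tau> ` S) = emeasure Q (space Q)"
    using \<tau> by (subst (1 2) Q) (auto intro!: nn_integral_cong \<tau>S)
  then have "AE x in Q. x \<in> \<tau> ` S"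
    using \<tau>S by (subst Q.AE_in_set_eq_1) (auto simp: Q.prob_space Q.emeasure_eq_measure)
  then have "AE \<theta> in ?\<Pi>. \<forall>i\<in>{1..n}. \<theta> i \<in> \<tau> ` S"
    by (intro AE_finite_allI AE_PiM_component) (auto intro: Q.prob_space_axioms)
  then have "emeasure ?\<Pi> ?E = emeasure ?\<Pi> (\<Union>l\<in>?D. Box l)"
  proof (intro emeasure_eq_AE)
    assume "AE \<theta> in ?\<Pi>. \<forall>i\<in>{1..n}. \<theta> i \<in> \<tau> ` S"
    with AE_space show "AE \<theta> in ?\<Pi>. \<theta> \<in> ?E \<longleftrightarrow> \<theta> \<in> (\<Union>l\<in>?D. Box l)"
      by eventually_elim (use iff in blast)
    show "?E \<in> sets ?\<Pi>" by (rule sets_tie_partition[OF id part])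
    show "(\<Union>l\<in>?D. Box l) \<in> sets ?\<Pi>" using Box_sets by (intro sets.countable_UN') auto
  qed
  also have "\<dots> = (\<integral>\<^sup>+l. emeasure ?\<Pi> (Box l) \<partial>count_space ?D)"
    using Box_sets disj by (intro emeasure_UN_countable) auto
  also have "\<dots> = (\<integral>\<^sup>+l. prod_list (map2 (\<lambda>m j. w j ^ m) ns l) \<partial>count_space ?D)"
    by (intro nn_integral_cong Box_emeasure) simp
  finally show ?thesis .
qed

text \<open>Consecutive intervals. Existence is what makes the value of \<open>eppf\<close> unique.\<close>

lemma blocks_of_sizes_exists:
  assumes "\<And>m. m \<in> set ns \<Longrightarrow> m > 0"
  shows "\<exists>C. blocks_of_sizes ns C"
  using assms
proof (induction ns rule: rev_induct)
  case Nil
  then show ?case by (intro exI[of _ "[]"]) (auto simp: blocks_of_sizes_def partition_on_empty)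
next
  case (snoc m ns)
  then obtain C where C: "blocks_of_sizes ns C" by auto
  let ?B = "{sum_list ns + 1..sum_list ns + m}"
  have un: "\<Union>(set C) = {1..sum_list ns}" using C by (auto simp: blocks_of_sizes_def partition_on_def)
  have "m > 0" using snoc.prems by auto
  have "partition_on {1..sum_list ns + m} (insert ?B (set C))"
  proof (subst partition_on_insert)
    have "{1..sum_list ns + m} - ?B = {1..sum_list ns}" by auto
    then show "partition_on ({1..sum_list ns + m} - ?B) (set C) \<and> ?B \<subseteq> {1..sum_list ns + m} \<and> ?B \<noteq> {}"
      using C \<open>m > 0\<close> by (auto simp: blocks_of_sizes_def)
  qed (auto simp: un disjnt_iff)
  moreover have "?B \<notin> set C" 
  proof
    assume "?B \<in> set C"
    then have "?B \<subseteq> {1..sum_list ns}" using un by blast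
    then show False using \<open>m > 0\<close> by auto
  qed
  ultimately have "blocks_of_sizes (ns @ [m]) (C @ [?B])"
    using C by (auto simp: blocks_of_sizes_def insert_commute)
  then show ?case by blast
qed

lemma blocks_of_sizes_of_partition:
  assumes "partition_on {1..n} P"
  obtains C where "set C = P" "blocks_of_sizes (map card C) C" "sum_list (map card C) = n"
    "\<And>m. m \<in> set (map card C) \<Longrightarrow> m > 0"
proof -
  have "finite P" using assms finite_elements[of "{1..n}" P] by auto
  then obtain C where C: "set C = P" "distinct C" using finite_distinct_list by auto
  have "sum_list (map card C) = (\<Sum>B\<in>P. card B)"
    using C by (simp add: sum_list_distinct_conv_sum_set)
  also have "\<dots> = n"
    using product_partition[OF assms] partition_onD1[OF assms]
    by (metis card_atLeastAtMost diff_Suc_1 finite_Union finite_atLeastAtMost finite_subset Union_upper)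
  finally have n: "sum_list (map card C) = n" .
  have "m > 0" if "m \<in> set (map card C)" for m
  proof -
    from that C obtain B where B: "B \<in> P" "m = card B" by auto
    have "B \<subseteq> {1..n}" using B partition_onD1[OF assms] by blast
    then have "finite B" by (rule finite_subset) simp
    moreover have "B \<noteq> {}" using B partition_onD3[OF assms] by auto
    ultimately have "B \<noteq> {}" "finite B" by auto
    then show "m > 0" using B by (simp add: card_gt_0_iff)
  qed
  then show ?thesis using that[OF C(1) _ n] assms C n by (auto simp: blocks_of_sizes_def)
qed

lemma prob_tie_partition:
  fixes N :: "'a :: {second_countable_topology, metric_space} measure" and S :: "'w \<Rightarrow> nat set"
  assumes M: "prob_space M" and P: "P \<in> M \<rightarrow>\<^sub>M prob_algebra N" and id: "(\<lambda>x. x) \<in> borel_measurable N"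
    and rep: "AE \<omega> in M. has_atoms N (S \<omega>) (w \<omega>) (\<tau> \<omega>) (P \<omega>)"
    and C: "blocks_of_sizes ns C" and n: "sum_list ns = n"
  shows "emeasure (sample_law M P n) {\<theta>\<in>space (sample_law M P n). tie_partition n \<theta> = set C} =
    (\<integral>\<^sup>+\<omega>. atom_sum ns (w \<omega>) (S \<omega>) \<partial>M)"
proof -
  interpret prob_space M by fact
  let ?\<Pi> = "\<Pi>\<^sub>M i\<in>{1..n}. N"
  have part: "partition_on {1..n} (set C)" using C n by (auto simp: blocks_of_sizes_def)
  have K: "(\<lambda>\<omega>. \<Pi>\<^sub>M i\<in>{1..n}. P \<omega>) \<in> M \<rightarrow>\<^sub>M subprob_algebra ?\<Pi>"
    by (rule measurable_prob_algebraD[OF measurable_PiM_prob_algebra[OF P]]) simp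
  have space: "space (sample_law M P n) = space ?\<Pi>"
    unfolding sample_law_def by (rule space_bind_measurable[OF K not_empty])
  have "emeasure (sample_law M P n) (tie_event n ?\<Pi> (set C)) =
     (\<integral>\<^sup>+\<omega>. emeasure (\<Pi>\<^sub>M i\<in>{1..n}. P \<omega>) (tie_event n ?\<Pi> (set C)) \<partial>M)"
    unfolding sample_law_def by (rule emeasure_bind[OF not_empty K sets_tie_partition[OF id part]])
  also have "\<dots> = (\<integral>\<^sup>+\<omega>. atom_sum ns (w \<omega>) (S \<omega>) \<partial>M)"
  proof (rule nn_integral_cong_AE)
    have "emeasure (\<Pi>\<^sub>M i\<in>{1..n}. P \<omega>) (tie_event n ?\<Pi> (set C)) =
        atom_sum ns (w \<omega>) (S \<omega>)"
      if \<omega>: "\<omega> \<in> space M" and elim: "has_atoms N (S \<omega>) (w \<omega>) (\<tau> \<omega>) (P \<omega>)" for \<omega>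
    proof -
      have P': "prob_space (P \<omega>)" "sets (P \<omega>) = sets N"
        using measurable_space[OF P \<omega>] by (auto simp: space_prob_algebra)
      have sp: "space (\<Pi>\<^sub>M i\<in>{1..n}. P \<omega>) = space ?\<Pi>"
        using P'(2) by (intro sets_eq_imp_space_eq sets_PiM_cong) auto
      have id': "(\<lambda>x. x) \<in> borel_measurable (P \<omega>)"
        using id measurable_cong_sets[OF P'(2) refl] by blast
      have space': "space (P \<omega>) = space N" by (rule sets_eq_imp_space_eq[OF P'(2)])
      show ?thesis unfolding sp[symmetric]
      proof (rule emeasure_tie_partition_discrete[OF P'(1) id' _ _ _ C n])
        show "inj_on (\<tau> \<omega>) (S \<omega>)" using elim by blast
        show "\<tau> \<omega> j \<in> space (P \<omega>)" if "j \<in> S \<omega>" for j using elim that unfolding space' by blast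
        show "emeasure (P \<omega>) A = (\<integral>\<^sup>+j. w \<omega> j * indicator A (\<tau> \<omega> j) \<partial>count_space (S \<omega>))"
          if "A \<in> sets (P \<omega>)" for A using elim that unfolding P'(2) by blast
      qed
    qed
    note inner = this
    show "AE \<omega> in M. emeasure (\<Pi>\<^sub>M i\<in>{1..n}. P \<omega>) (tie_event n ?\<Pi> (set C)) =
        atom_sum ns (w \<omega>) (S \<omega>)"
      using rep AE_space[of M] by eventually_elim (rule inner)
  qed
  finally show ?thesis by (simp only: space)
qed

lemma prob_space_sample_law:
  assumes M: "prob_space M" and P: "P \<in> M \<rightarrow>\<^sub>M prob_algebra N"
  shows "prob_space (sample_law M P n)" "sets (sample_law M P n) = sets (\<Pi>\<^sub>M i\<in>{1..n}. N)"
    "space (sample_law M P n) = space (\<Pi>\<^sub>M i\<in>{1..n}. N)"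
proof -
  have K: "(\<lambda>\<omega>. \<Pi>\<^sub>M i\<in>{1..n}. P \<omega>) \<in> M \<rightarrow>\<^sub>M prob_algebra (\<Pi>\<^sub>M i\<in>{1..n}. N)"
    by (rule measurable_PiM_prob_algebra[OF P]) simp
  have M': "M \<in> space (prob_algebra M)" using M by (simp add: space_prob_algebra)
  show "prob_space (sample_law M P n)" unfolding sample_law_def by (rule prob_space_bind'[OF M' K])
  show sets: "sets (sample_law M P n) = sets (\<Pi>\<^sub>M i\<in>{1..n}. N)"
    unfolding sample_law_def by (rule sets_bind'[OF M' K])
  show "space (sample_law M P n) = space (\<Pi>\<^sub>M i\<in>{1..n}. N)"
    by (rule sets_eq_imp_space_eq[OF sets])
qed

text \<open>The right-hand side of \<open>prob_tie_partition\<close> depends on the blocks only through their sizes, so the definite description in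
  \<open>eppf\<close> denotes it.\<close>

lemma eppf_eq:
  fixes N :: "'a :: {second_countable_topology, metric_space} measure" and S :: "'w \<Rightarrow> nat set"
  assumes M: "prob_space M" and P: "P \<in> M \<rightarrow>\<^sub>M prob_algebra N" and id: "(\<lambda>x. x) \<in> borel_measurable N"
    and rep: "AE \<omega> in M. has_atoms N (S \<omega>) (w \<omega>) (\<tau> \<omega>) (P \<omega>)"
  shows "(\<And>m. m \<in> set ns \<Longrightarrow> m > 0) \<Longrightarrow> ennreal (eppf M P ns) =
    (\<integral>\<^sup>+\<omega>. atom_sum ns (w \<omega>) (S \<omega>) \<partial>M)"
    and "blocks_of_sizes ns C \<Longrightarrow> sum_list ns = n \<Longrightarrow> (\<And>m. m \<in> set ns \<Longrightarrow> m > 0) \<Longrightarrow>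
      \<P>(\<theta> in sample_law M P n. tie_partition n \<theta> = set C) = eppf M P ns"
proof -
  let ?I = "\<lambda>ns. \<integral>\<^sup>+\<omega>. atom_sum ns (w \<omega>) (S \<omega>) \<partial>M"
  have *: "ennreal (\<P>(\<theta> in sample_law M P (sum_list ns). tie_partition (sum_list ns) \<theta> = set C)) = ?I ns"
    if "blocks_of_sizes ns C" for ns C
  proof -
    interpret prob_space "sample_law M P (sum_list ns)" by (rule prob_space_sample_law[OF M P])
    show ?thesis using prob_tie_partition[OF M P id rep that refl] by (simp add: emeasure_eq_measure)
  qed
  have **: "\<P>(\<theta> in sample_law M P (sum_list ns). tie_partition (sum_list ns) \<theta> = set C) = enn2real (?I ns)"
    if "blocks_of_sizes ns C" for ns C
    unfolding *[OF that, symmetric] by (rule enn2real_ennreal[symmetric]) (rule measure_nonneg)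
  have eq: "eppf M P ns = enn2real (?I ns)" if pos: "\<And>m. m \<in> set ns \<Longrightarrow> m > 0" for ns
    unfolding eppf_def
  proof (rule the_equality)
    show "\<forall>C. blocks_of_sizes ns C \<longrightarrow>
      \<P>(\<theta> in sample_law M P (sum_list ns). tie_partition (sum_list ns) \<theta> = set C) = enn2real (?I ns)"
      using ** by blast
    obtain C where C: "blocks_of_sizes ns C" using blocks_of_sizes_exists[OF pos] by blast
    show "p = enn2real (?I ns)" if "\<forall>C. blocks_of_sizes ns C \<longrightarrow>
      \<P>(\<theta> in sample_law M P (sum_list ns). tie_partition (sum_list ns) \<theta> = set C) = p" for p
      using that[rule_format, OF C] **[OF C] by (rule trans[OF sym])
  qed
  show "ennreal (eppf M P ns) = ?I ns" if pos: "\<And>m. m \<in> set ns \<Longrightarrow> m > 0"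
  proof -
    have e: "eppf M P ns = enn2real (?I ns)" by (rule eq) (rule pos)
    obtain C where C: "blocks_of_sizes ns C" using blocks_of_sizes_exists[OF pos] by blast
    show ?thesis
      unfolding e by (rule *[OF C, unfolded **[OF C]])
  qed
  show "\<P>(\<theta> in sample_law M P n. tie_partition n \<theta> = set C) = eppf M P ns"
    if "blocks_of_sizes ns C" "sum_list ns = n" "\<And>m. m \<in> set ns \<Longrightarrow> m > 0"
  proof -
    have "eppf M P ns = enn2real (?I ns)" by (rule eq) (rule that(3))
    then show ?thesis unfolding that(2)[symmetric] by (rule trans[OF **[OF that(1)] sym])
  qed
qed

lemma sum_prob_tie_partition:
  fixes N :: "'a :: {second_countable_topology, metric_space} measure"
  assumes M: "prob_space M" and P: "P \<in> M \<rightarrow>\<^sub>M prob_algebra N" and id: "(\<lambda>x. x) \<in> borel_measurable N"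
  shows "(\<Sum>\<pi> | partition_on {1..n} \<pi>. \<P>(\<theta> in sample_law M P n. tie_partition n \<theta> = \<pi>)) = 1"
proof -
  note sl = prob_space_sample_law[OF M P, of n]
  interpret prob_space "sample_law M P n" by fact
  let ?E = "\<lambda>\<pi>. {\<theta>\<in>space (sample_law M P n). tie_partition n \<theta> = \<pi>}"
  let ?\<Pi> = "{\<pi>. partition_on {1..n} \<pi>}"
  have add: "prob (\<Union>\<pi>\<in>?\<Pi>. ?E \<pi>) = (\<Sum>\<pi>\<in>?\<Pi>. prob (?E \<pi>))"
  proof (rule finite_measure_finite_Union)
    show "?E ` ?\<Pi> \<subseteq> events" using sets_tie_partition[OF id] sl by auto
    show "disjoint_family_on ?E ?\<Pi>" by (auto simp: disjoint_family_on_def)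
  qed (simp add: finitely_many_partition_on)
  have un: "(\<Union>\<pi>\<in>?\<Pi>. ?E \<pi>) = space (sample_law M P n)"
    by (auto simp: partition_on_tie_partition simp del: One_nat_def)
  show ?thesis unfolding add[symmetric] un by (rule prob_space)
qed

section \<open>Removing the normalization\<close>

text \<open>The density, without the exponential factor, of the Gamma distribution with shape \<open>n\<close>.\<close>

definition gamma_weight :: "nat \<Rightarrow> real \<Rightarrow> ennreal" where
  "gamma_weight n u = indicator {0<..} u * ennreal (u ^ (n - 1) / Gamma (real n))"

lemma measurable_gamma_weight [measurable]: "gamma_weight n \<in> borel_measurable borel"
  unfolding gamma_weight_def by measurable

lemma gamma_weight_nonpos: "u \<le> 0 \<Longrightarrow> gamma_weight n u = 0"
  by (simp add: gamma_weight_def)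

text \<open>The Erlang density with rate \<open>t\<close> integrates to 1.\<close>

lemma nn_integral_gamma_weight:
  assumes "n > 0" and t: "0 < t" "t < \<top>"
  shows "(\<integral>\<^sup>+u. gamma_weight n u * expm (ennreal u * t) \<partial>lborel) = inverse t ^ n"
proof -
  obtain r where r: "t = ennreal r" "r > 0" using t by (cases t) auto
  obtain k where n: "n = Suc k" using \<open>n > 0\<close> by (cases n) auto
  interpret E: prob_space "density lborel (erlang_density k r)"
    by (rule prob_space_erlang_density[OF r(2)])
  \<comment> \<open>at \<open>u = 0\<close> the weight vanishes but the Erlang density may not\<close>
  have "AE u in lborel. u \<noteq> (0::real)" by (rule AE_lborel_singleton)
  then have "(\<integral>\<^sup>+u. gamma_weight n u * expm (ennreal u * t) \<partial>lborel) =
      (\<integral>\<^sup>+u. ennreal ((1 / r) ^ n) * ennreal (erlang_density k r u) \<partial>lborel)"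
  proof (rule nn_integral_cong_AE[OF AE_mp[OF _ AE_I2[OF impI]]])
    fix u :: real assume "u \<noteq> 0"
    show "gamma_weight n u * expm (ennreal u * t) = ennreal ((1 / r) ^ n) * ennreal (erlang_density k r u)"
    proof (cases "u > 0")
      case True
      have "ennreal u * t = ennreal (u * r)" using r True by (simp add: ennreal_mult)
      then have "expm (ennreal u * t) = ennreal (exp (- (u * r)))" using r True by simp
      moreover have "Gamma (real n) = fact k" using n Gamma_fact[of k, where 'a=real] by (simp add: add.commute)
      ultimately have "gamma_weight n u * expm (ennreal u * t) = ennreal (u ^ k / fact k * exp (- (u * r)))"
        using True n by (simp add: gamma_weight_def flip: ennreal_mult)
      also have "u ^ k / fact k * exp (- (u * r)) = (1 / r) ^ n * erlang_density k r u"
        using True r(2) n by (simp add: erlang_density_def power_divide mult_ac)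
      finally show ?thesis using r(2) by (simp add: ennreal_mult)
    qed (use \<open>u \<noteq> 0\<close> in \<open>simp add: gamma_weight_def erlang_density_def\<close>)
  qed
  also have "\<dots> = ennreal ((1 / r) ^ n)"
    using E.emeasure_space_1 by (simp add: nn_integral_cmult emeasure_density)
  also have "\<dots> = inverse t ^ n"
    using r by (simp add: inverse_ennreal ennreal_power divide_inverse)
  finally show ?thesis .
qed

lemma prod_list_normalized_weights:
  assumes "length l = length ns"
  shows "prod_list (map2 (\<lambda>m j. (x j / t) ^ m) ns l) =
    inverse t ^ sum_list ns * prod_list (map2 (\<lambda>m j. x j ^ m) ns l :: ennreal list)"
  using assms[symmetric]
  by (induction ns l rule: list_induct2)
     (simp_all add: divide_ennreal_def power_mult_distrib power_add mult_ac)

text \<open>The contribution of a chosen jump \<open>s\<close>: it occurs \<open>m\<close> times in the sample and carries its share \<open>exp (- u s)\<close> of \<open>exp (- u T)\<close>.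
  It is extended by 0 because only the half-line carries jumps.\<close>

definition tilted_power :: "real \<Rightarrow> nat \<Rightarrow> real \<Rightarrow> ennreal" where
  "tilted_power u m s = indicator {0<..} s * ennreal (s ^ m * exp (- (u * s)))"

lemma measurable_tilted_power [measurable]: "tilted_power u m \<in> borel_measurable borel"
  unfolding tilted_power_def by measurable

lemma tilted_power_finite: "tilted_power u m s < \<top>"
  by (simp add: tilted_power_def ennreal_mult_less_top split: split_indicator)

lemma tilted_power_eq:
  assumes "0 \<le> u" "0 < s"
  shows "tilted_power u m s = ennreal s ^ m * expm (ennreal (u * s))"
proof -
  have "expm (ennreal (u * s)) = ennreal (exp (- (u * s)))"
    using assms by (intro expm_simps) simp
  then show ?thesis
    using assms by (simp only: tilted_power_def) (simp add: ennreal_mult ennreal_power)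
qed

text \<open>The exponential of the total mass is distributed to the individual jumps, chosen or not.\<close>

lemma prod_list_tilted_power:
  fixes S :: "'b set"
  assumes "l \<in> distinct_lists (length ns) S" and "0 \<le> u" and "\<And>j. j \<in> S \<Longrightarrow> 0 < x j"
  shows "prod_list (map2 (\<lambda>m j. ennreal (x j) ^ m) ns l) * expm (ennreal u * (\<integral>\<^sup>+j. ennreal (x j) \<partial>count_space S)) =
    prod_list (map2 (\<lambda>f j. f (x j)) (map (tilted_power u) ns) l) *
    expm (\<integral>\<^sup>+j. ennreal (u * x j) \<partial>count_space (S - set l))"
proof -
  have "length l = length ns" using assms by (simp add: distinct_lists_def)
  from this[symmetric] assms show ?thesis
  proof (induction ns l arbitrary: S rule: list_induct2)
    case Nil
    have "ennreal u * (\<integral>\<^sup>+j. ennreal (x j) \<partial>count_space S) = (\<integral>\<^sup>+j. ennreal (u * x j) \<partial>count_space S)"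
      using Nil by (subst nn_integral_cmult[symmetric]) (auto intro!: nn_integral_cong simp: ennreal_mult')
    then show ?case by simp
  next
    case (Cons m ns j l)
    have j: "j \<in> S" "l \<in> distinct_lists (length ns) (S - {j})"
      using Cons.prems Cons.hyps by (auto simp: distinct_lists_def)
    have S: "S - set (j # l) = S - {j} - set l" by auto
    have IH: "prod_list (map2 (\<lambda>m j. ennreal (x j) ^ m) ns l) * expm (ennreal u * (\<integral>\<^sup>+j. ennreal (x j) \<partial>count_space (S - {j}))) =
      prod_list (map2 (\<lambda>f j. f (x j)) (map (tilted_power u) ns) l) *
      expm (\<integral>\<^sup>+j. ennreal (u * x j) \<partial>count_space (S - {j} - set l))"
      using Cons.prems j(2) by (intro Cons.IH) auto
    have "tilted_power u m (x j) = ennreal (x j) ^ m * expm (ennreal (u * x j))"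
      using Cons.prems j(1) by (intro tilted_power_eq) auto
    moreover have "ennreal u * (\<integral>\<^sup>+i. ennreal (x i) \<partial>count_space S) =
      ennreal (u * x j) + ennreal u * (\<integral>\<^sup>+i. ennreal (x i) \<partial>count_space (S - {j}))"
      using nn_integral_count_space_remove[OF j(1), of "\<lambda>i. ennreal (x i)"] \<open>0 \<le> u\<close>
      by (simp add: distrib_left ennreal_mult')
    ultimately show ?case
      unfolding S using IH by (simp add: expm_add mult_ac)
  qed
qed

lemma nn_integral_normalized_weights:
  fixes S :: "nat set"
  assumes "\<And>j. j \<in> S \<Longrightarrow> 0 < x j" and "sum_list ns = n" "n > 0"
    and T: "T = (\<integral>\<^sup>+j. ennreal (x j) \<partial>count_space S)" "0 < T" "T < \<top>"
    and l: "l \<in> distinct_lists (length ns) S"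
  shows "prod_list (map2 (\<lambda>m j. (ennreal (x j) / T) ^ m) ns l) =
    (\<integral>\<^sup>+u. gamma_weight n u * (prod_list (map2 (\<lambda>f j. f (x j)) (map (tilted_power u) ns) l) *
      expm (\<integral>\<^sup>+j. ennreal (u * x j) \<partial>count_space (S - set l))) \<partial>lborel)"
proof -
  have "prod_list (map2 (\<lambda>m j. (ennreal (x j) / T) ^ m) ns l) =
      inverse T ^ n * prod_list (map2 (\<lambda>m j. ennreal (x j) ^ m) ns l)"
    using l assms(2) by (subst prod_list_normalized_weights) (auto simp: distinct_lists_def)
  also have "\<dots> = (\<integral>\<^sup>+u. gamma_weight n u * (prod_list (map2 (\<lambda>m j. ennreal (x j) ^ m) ns l) * expm (ennreal u * T)) \<partial>lborel)"
    unfolding nn_integral_gamma_weight[OF \<open>n > 0\<close> T(2,3), symmetric]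
    by (subst nn_integral_multc[symmetric]) (auto simp: mult_ac)
  also have "\<dots> = (\<integral>\<^sup>+u. gamma_weight n u * (prod_list (map2 (\<lambda>f j. f (x j)) (map (tilted_power u) ns) l) *
      expm (\<integral>\<^sup>+j. ennreal (u * x j) \<partial>count_space (S - set l))) \<partial>lborel)"
  proof (intro nn_integral_cong)
    fix u :: real
    show "gamma_weight n u * (prod_list (map2 (\<lambda>m j. ennreal (x j) ^ m) ns l) * expm (ennreal u * T)) =
      gamma_weight n u * (prod_list (map2 (\<lambda>f j. f (x j)) (map (tilted_power u) ns) l) *
      expm (\<integral>\<^sup>+j. ennreal (u * x j) \<partial>count_space (S - set l)))"
    proof (cases "u > 0")
      case True
      then show ?thesis unfolding T(1) using prod_list_tilted_power[OF l, of u x] assms(1) by simp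
    qed (simp add: gamma_weight_nonpos)
  qed
  finally show ?thesis .
qed

section \<open>Normalized completely random measures\<close>

abbreviation tilted_moment :: "real measure \<Rightarrow> real \<Rightarrow> nat \<Rightarrow> ennreal" where
  "tilted_moment \<mu> u m \<equiv> \<integral>\<^sup>+s. tilted_power u m s \<partial>\<mu>"

abbreviation tilted_moment_above :: "real measure \<Rightarrow> real \<Rightarrow> real \<Rightarrow> nat \<Rightarrow> ennreal" where
  "tilted_moment_above \<mu> \<epsilon> u m \<equiv> \<integral>\<^sup>+s. indicator {\<epsilon><..} s * tilted_power u m s \<partial>\<mu>"

abbreviation laplace_transform :: "real measure \<Rightarrow> real \<Rightarrow> ennreal" where
  "laplace_transform \<mu> u \<equiv> \<integral>\<^sup>+s. expm (ennreal (u * s)) \<partial>\<mu>"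

abbreviation laplace_exponent :: "real measure \<Rightarrow> real \<Rightarrow> ennreal" where
  "laplace_exponent \<mu> u \<equiv> \<integral>\<^sup>+s. 1 - expm (ennreal (u * s)) \<partial>\<mu>"

abbreviation has_normalized_atoms :: "'a measure \<Rightarrow> nat set \<Rightarrow> (nat \<Rightarrow> real) \<Rightarrow> (nat \<Rightarrow> 'a) \<Rightarrow> 'a measure \<Rightarrow> bool" where
  "has_normalized_atoms N S x \<tau> Q \<equiv>
     has_atoms N S (\<lambda>j. ennreal (x j) / (\<integral>\<^sup>+i. ennreal (x i) \<partial>count_space S)) \<tau> Q"

text \<open>After Tonelli's theorem has moved the integral over \<open>u\<close> to the outside, the inner expectation is the one of
  \<open>poisson_campbell_mecke\<close> with \<open>h s = u s\<close>.\<close>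

lemma eppf_norm_crm:
  fixes P0 :: "'a :: {second_countable_topology, metric_space} measure"
  assumes M: "prob_space M" and P: "P \<in> M \<rightarrow>\<^sub>M prob_algebra P0" and id: "(\<lambda>x. x) \<in> borel_measurable P0"
    and J: "poisson_process_points M \<mu> J" and sets: "sets \<mu> = sets borel" and sf: "sigma_finite_measure \<mu>"
    and rep: "AE \<omega> in M. has_normalized_atoms P0 UNIV (\<lambda>j. J j \<omega>) (\<lambda>j. \<tau> j \<omega>) (P \<omega>)"
    and fin: "AE \<omega> in M. (\<integral>\<^sup>+i. ennreal (J i \<omega>) \<partial>count_space (UNIV :: nat set)) < \<top>"
    and ns: "\<And>m. m \<in> set ns \<Longrightarrow> m > 0" "sum_list ns = n" "n > 0"
    and tilt: "\<And>u m. u > 0 \<Longrightarrow> m > 0 \<Longrightarrow> tilted_moment \<mu> u m < \<top>"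
  shows "ennreal (eppf M P ns) = (\<integral>\<^sup>+u. gamma_weight n u *
    (prod_list (map (tilted_moment \<mu> u) ns) * expm (laplace_exponent \<mu> u)) \<partial>lborel)"
proof -
  interpret prob_space M by fact
  interpret LM: pair_sigma_finite lborel M ..
  have J_meas [measurable]: "J j \<in> borel_measurable M" for j
    using J by (auto simp: poisson_process_points_def)
  define T where "T \<omega> = (\<integral>\<^sup>+i. ennreal (J i \<omega>) \<partial>count_space (UNIV :: nat set))" for \<omega>
  have [measurable]: "T \<in> borel_measurable M"
    unfolding T_def by (intro borel_measurable_nn_integral_count_space) auto
  let ?D = "distinct_lists (length ns) (UNIV :: nat set)"
  define G where "G u l \<omega> = prod_list (map2 (\<lambda>f j. f (J j \<omega>)) (map (tilted_power u) ns) l) *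
      expm (\<integral>\<^sup>+j. ennreal (u * J j \<omega>) \<partial>count_space (UNIV - set l))" for u l \<omega>
  define C where "C l \<omega> = prod_list (map2 (\<lambda>m j. ennreal (J j \<omega>) ^ m) ns l)" for l \<omega>
  have [measurable]: "C l \<in> borel_measurable M" for l
    unfolding C_def by (intro measurable_prod_list_map2) auto
  have J_pos: "0 < J j \<omega>" if "\<omega> \<in> space M" for j \<omega>
    using J that by (auto simp: poisson_process_points_def)
  have G: "gamma_weight n u * G u l \<omega> = gamma_weight n u * (C l \<omega> * expm (ennreal u * T \<omega>))"
    if "\<omega> \<in> space M" "l \<in> ?D" for u l \<omega>
  proof (cases "u > 0")
    case True
    then show ?thesis
      unfolding G_def C_def T_def using prod_list_tilted_power[OF that(2), of u "\<lambda>j. J j \<omega>"] J_pos[OF that(1)] by simp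
  qed (simp add: gamma_weight_nonpos)
  have "ennreal (eppf M P ns) = (\<integral>\<^sup>+\<omega>. \<integral>\<^sup>+l. prod_list (map2 (\<lambda>m j. (ennreal (J j \<omega>) / T \<omega>) ^ m) ns l) \<partial>count_space ?D \<partial>M)"
    unfolding T_def by (rule eppf_eq(1)[OF M P id rep]) (rule ns(1))
  also have "\<dots> = (\<integral>\<^sup>+\<omega>. \<integral>\<^sup>+l. \<integral>\<^sup>+u. gamma_weight n u * (C l \<omega> * expm (ennreal u * T \<omega>)) \<partial>lborel \<partial>count_space ?D \<partial>M)"
  proof (rule nn_integral_cong_AE)
    show "AE \<omega> in M. (\<integral>\<^sup>+l. prod_list (map2 (\<lambda>m j. (ennreal (J j \<omega>) / T \<omega>) ^ m) ns l) \<partial>count_space ?D) =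
      (\<integral>\<^sup>+l. \<integral>\<^sup>+u. gamma_weight n u * (C l \<omega> * expm (ennreal u * T \<omega>)) \<partial>lborel \<partial>count_space ?D)"
      using fin AE_space[of M]
    proof eventually_elim
      case (elim \<omega>)
      have "ennreal (J 0 \<omega>) \<le> T \<omega>"
        unfolding T_def using nn_integral_count_space_remove[of 0 UNIV "\<lambda>i. ennreal (J i \<omega>)"] by simp
      then have T: "0 < T \<omega>" "T \<omega> < \<top>"
        using J_pos[OF elim(2), of 0] elim(1) by (auto simp: T_def intro: less_le_trans[of 0 "ennreal (J 0 \<omega>)"])
      show ?case
      proof (intro nn_integral_cong)
        fix l assume "l \<in> space (count_space ?D)"
        then have l: "l \<in> ?D" by simp
        have "prod_list (map2 (\<lambda>m j. (ennreal (J j \<omega>) / T \<omega>) ^ m) ns l) = (\<integral>\<^sup>+u. gamma_weight n u * G u l \<omega> \<partial>lborel)"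
          unfolding G_def by (rule nn_integral_normalized_weights[OF J_pos[OF elim(2)] ns(2,3) T_def T l])
        then show "prod_list (map2 (\<lambda>m j. (ennreal (J j \<omega>) / T \<omega>) ^ m) ns l) =
          (\<integral>\<^sup>+u. gamma_weight n u * (C l \<omega> * expm (ennreal u * T \<omega>)) \<partial>lborel)"
          by (simp only: G[OF elim(2) l])
      qed
    qed
  qed
  also have "\<dots> = (\<integral>\<^sup>+l. \<integral>\<^sup>+\<omega>. \<integral>\<^sup>+u. gamma_weight n u * (C l \<omega> * expm (ennreal u * T \<omega>)) \<partial>lborel \<partial>M \<partial>count_space ?D)"
    by (rule nn_integral_count_space_nn_integral) auto
  also have "\<dots> = (\<integral>\<^sup>+l. \<integral>\<^sup>+u. \<integral>\<^sup>+\<omega>. gamma_weight n u * (C l \<omega> * expm (ennreal u * T \<omega>)) \<partial>M \<partial>lborel \<partial>count_space ?D)"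
    by (intro nn_integral_cong LM.Fubini') measurable
  also have "\<dots> = (\<integral>\<^sup>+u. \<integral>\<^sup>+l. \<integral>\<^sup>+\<omega>. gamma_weight n u * (C l \<omega> * expm (ennreal u * T \<omega>)) \<partial>M \<partial>count_space ?D \<partial>lborel)"
    by (rule nn_integral_count_space_nn_integral[symmetric]) auto
  also have "\<dots> = (\<integral>\<^sup>+u. \<integral>\<^sup>+\<omega>. \<integral>\<^sup>+l. gamma_weight n u * (C l \<omega> * expm (ennreal u * T \<omega>)) \<partial>count_space ?D \<partial>M \<partial>lborel)"
    by (intro nn_integral_cong nn_integral_count_space_nn_integral[symmetric]) auto
  also have "\<dots> = (\<integral>\<^sup>+u. \<integral>\<^sup>+\<omega>. gamma_weight n u * (\<integral>\<^sup>+l. G u l \<omega> \<partial>count_space ?D) \<partial>M \<partial>lborel)"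
  proof (intro nn_integral_cong)
    fix u \<omega> assume "\<omega> \<in> space M"
    then have "(\<integral>\<^sup>+l. gamma_weight n u * (C l \<omega> * expm (ennreal u * T \<omega>)) \<partial>count_space ?D) =
        (\<integral>\<^sup>+l. gamma_weight n u * G u l \<omega> \<partial>count_space ?D)"
      using G by (intro nn_integral_cong) auto
    then show "(\<integral>\<^sup>+l. gamma_weight n u * (C l \<omega> * expm (ennreal u * T \<omega>)) \<partial>count_space ?D) =
        gamma_weight n u * (\<integral>\<^sup>+l. G u l \<omega> \<partial>count_space ?D)"
      by (simp add: nn_integral_cmult)
  qed
  also have "\<dots> = (\<integral>\<^sup>+u. gamma_weight n u * (prod_list (map (tilted_moment \<mu> u) ns) *
      expm (laplace_exponent \<mu> u)) \<partial>lborel)"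
  proof (intro nn_integral_cong)
    fix u :: real
    have [measurable]: "G u l \<in> borel_measurable M" for l
      unfolding G_def
      by (intro borel_measurable_times_ennreal measurable_prod_list_map2 measurable_compose[OF _ measurable_expm]
          borel_measurable_nn_integral_count_space) auto
    have "(\<integral>\<^sup>+\<omega>. gamma_weight n u * (\<integral>\<^sup>+l. G u l \<omega> \<partial>count_space ?D) \<partial>M) =
        gamma_weight n u * (\<integral>\<^sup>+\<omega>. \<integral>\<^sup>+l. G u l \<omega> \<partial>count_space ?D \<partial>M)"
      by (intro nn_integral_cmult borel_measurable_nn_integral_count_space) auto
    also have "\<dots> = gamma_weight n u * (prod_list (map (tilted_moment \<mu> u) ns) *
      expm (laplace_exponent \<mu> u))"
    proof (cases "u > 0")
      case True
      let ?fs = "map (tilted_power u) ns"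
      have "(\<integral>\<^sup>+\<omega>. \<integral>\<^sup>+l. G u l \<omega> \<partial>count_space (distinct_lists (length ?fs) UNIV) \<partial>M) =
          prod_list (map (\<lambda>f. \<integral>\<^sup>+s. f s \<partial>\<mu>) ?fs) * expm (laplace_exponent \<mu> u)"
        unfolding G_def
        by (rule poisson_campbell_mecke[OF M J sets sf])
           (use tilt[OF True] ns(1) tilted_power_finite in auto)
      then show ?thesis by (simp add: comp_def)
    qed (simp add: gamma_weight_nonpos)
    finally show "(\<integral>\<^sup>+\<omega>. gamma_weight n u * (\<integral>\<^sup>+l. G u l \<omega> \<partial>count_space ?D) \<partial>M) =
      gamma_weight n u * (prod_list (map (tilted_moment \<mu> u) ns) *
      expm (laplace_exponent \<mu> u))" .
  qed
  finally show ?thesis .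
qed

text \<open>Measurability of the identity says that all Borel sets are events, so singletons and coincidences of locations are.\<close>

locale diffuse_prob = P0: prob_space P0 for P0 :: "'a :: {second_countable_topology, metric_space} measure" +
  assumes id_measurable: "(\<lambda>x. x) \<in> borel_measurable P0"
    and diffuse: "x \<in> space P0 \<Longrightarrow> emeasure P0 {x} = 0"
begin

text \<open>By Fubini the diagonal is a null set for the square of a diffuse measure.\<close>

lemma AE_neq_of_product_law:
  assumes [measurable]: "X \<in> M \<rightarrow>\<^sub>M P0" "Y \<in> M \<rightarrow>\<^sub>M P0"
    and law: "\<And>A B. A \<in> sets P0 \<Longrightarrow> B \<in> sets P0 \<Longrightarrow>
      emeasure M {\<omega>\<in>space M. X \<omega> \<in> A \<and> Y \<omega> \<in> B} = emeasure P0 A * emeasure P0 B"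
  shows "AE \<omega> in M. X \<omega> \<noteq> Y \<omega>"
proof -
  interpret NN: pair_sigma_finite P0 P0 ..
  have eq: "P0 \<Otimes>\<^sub>M P0 = distr M (P0 \<Otimes>\<^sub>M P0) (\<lambda>\<omega>. (X \<omega>, Y \<omega>))"
  proof (rule pair_measure_eqI)
    fix A B assume [measurable]: "A \<in> sets P0" "B \<in> sets P0"
    have "(\<lambda>\<omega>. (X \<omega>, Y \<omega>)) -` (A \<times> B) \<inter> space M = {\<omega>\<in>space M. X \<omega> \<in> A \<and> Y \<omega> \<in> B}" by auto
    then show "emeasure P0 A * emeasure P0 B = emeasure (distr M (P0 \<Otimes>\<^sub>M P0) (\<lambda>\<omega>. (X \<omega>, Y \<omega>))) (A \<times> B)"
      by (simp add: emeasure_distr law)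
  qed (auto intro: P0.sigma_finite_measure_axioms)
  have [measurable]: "(\<lambda>p. fst p) \<in> borel_measurable (P0 \<Otimes>\<^sub>M P0)" "(\<lambda>p. snd p) \<in> borel_measurable (P0 \<Otimes>\<^sub>M P0)"
    using measurable_compose[OF measurable_fst id_measurable] measurable_compose[OF measurable_snd id_measurable] by auto
  have D: "{p\<in>space (P0 \<Otimes>\<^sub>M P0). dist (fst p) (snd p) = 0} \<in> sets (P0 \<Otimes>\<^sub>M P0)" by measurable
  have "emeasure (P0 \<Otimes>\<^sub>M P0) {p\<in>space (P0 \<Otimes>\<^sub>M P0). dist (fst p) (snd p) = 0} = (\<integral>\<^sup>+x. 0 \<partial>P0)"
    unfolding P0.emeasure_pair_measure_alt[OF D]
  proof (intro nn_integral_cong)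
    fix x assume "x \<in> space P0"
    moreover from this have "Pair x -` {p \<in> space (P0 \<Otimes>\<^sub>M P0). dist (fst p) (snd p) = 0} = {x}"
      by (auto simp: space_pair_measure)
    ultimately show "emeasure P0 (Pair x -` {p \<in> space (P0 \<Otimes>\<^sub>M P0). dist (fst p) (snd p) = 0}) = 0"
      using diffuse by simp
  qed
  then have "AE p in P0 \<Otimes>\<^sub>M P0. fst p \<noteq> snd p"
    using D by (intro AE_I[of _ _ "{p\<in>space (P0 \<Otimes>\<^sub>M P0). dist (fst p) (snd p) = 0}"]) auto
  then have "AE p in distr M (P0 \<Otimes>\<^sub>M P0) (\<lambda>\<omega>. (X \<omega>, Y \<omega>)). fst p \<noteq> snd p"
    by (subst eq[symmetric])
  from AE_distrD[OF _ this] show ?thesis by simp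
qed

text \<open>That \<open>P \<omega>\<close> is a probability measure forces the sum of the jumps to be finite: otherwise all normalized jumps, and with them
  \<open>P \<omega>\<close>, would vanish.\<close>

lemma norm_crm_representation:
  assumes "norm_crm \<rho> \<kappa> P0 M P"
  obtains J \<tau> where "poisson_process_points M (crm_intensity \<rho> \<kappa>) J"
    "AE \<omega> in M. has_normalized_atoms P0 UNIV (\<lambda>j. J j \<omega>) (\<lambda>j. \<tau> j \<omega>) (P \<omega>)"
    "AE \<omega> in M. (\<integral>\<^sup>+i. ennreal (J i \<omega>) \<partial>count_space (UNIV :: nat set)) < \<top>"
proof -
  from assms obtain J \<tau> where M: "prob_space M" and P: "P \<in> M \<rightarrow>\<^sub>M prob_algebra P0"
    and J: "poisson_process_points M (crm_intensity \<rho> \<kappa>) J"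
    and \<tau>: "prob_space.indep_vars M (\<lambda>_. P0) \<tau> (UNIV :: nat set)" "\<And>j. distr M P0 (\<tau> j) = P0"
    and rep: "AE \<omega> in M. \<forall>A\<in>sets P0. emeasure (P \<omega>) A =
             (\<Sum>j. ennreal (J j \<omega>) / (\<Sum>i. ennreal (J i \<omega>)) * indicator A (\<tau> j \<omega>))"
    unfolding norm_crm_def by blast
  interpret prob_space M by fact
  have \<tau>_meas [measurable]: "\<tau> j \<in> M \<rightarrow>\<^sub>M P0" for j using \<tau>(1) by (auto simp: indep_vars_def)
  have neq: "AE \<omega> in M. \<tau> i \<omega> \<noteq> \<tau> j \<omega>" if "i \<noteq> j" for i j
  proof (rule AE_neq_of_product_law)
    fix A B assume AB [measurable]: "A \<in> sets P0" "B \<in> sets P0"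
    have "indep_vars (\<lambda>_. P0) \<tau> {i, j}" by (rule indep_vars_subset[OF \<tau>(1)]) auto
    from indep_varsD_finite[OF this, of "\<lambda>k. if k = i then A else B"]
    have "prob (\<Inter>k\<in>{i, j}. \<tau> k -` (if k = i then A else B) \<inter> space M) =
        (\<Prod>k\<in>{i, j}. prob (\<tau> k -` (if k = i then A else B) \<inter> space M))"
      using AB by auto
    moreover have "(\<Inter>k\<in>{i, j}. \<tau> k -` (if k = i then A else B) \<inter> space M) = {\<omega>\<in>space M. \<tau> i \<omega> \<in> A \<and> \<tau> j \<omega> \<in> B}"
      using that by auto
    moreover have "emeasure M (\<tau> k -` C \<inter> space M) = emeasure P0 C" if "C \<in> sets P0" for k C
      using that \<tau>(2)[of k] emeasure_distr[OF \<tau>_meas that, of k] by simp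
    ultimately show "emeasure M {\<omega>\<in>space M. \<tau> i \<omega> \<in> A \<and> \<tau> j \<omega> \<in> B} = emeasure P0 A * emeasure P0 B"
      using that AB by (simp add: emeasure_eq_measure ennreal_mult)
  qed auto
  have "AE \<omega> in M. \<forall>i j. i \<noteq> j \<longrightarrow> \<tau> i \<omega> \<noteq> \<tau> j \<omega>"
    unfolding AE_all_countable
  proof (intro allI)
    fix i j show "AE \<omega> in M. i \<noteq> j \<longrightarrow> \<tau> i \<omega> \<noteq> \<tau> j \<omega>" using neq[of i j] by (cases "i = j") auto
  qed
  with rep AE_space[of M] have rep': "AE \<omega> in M. has_normalized_atoms P0 UNIV (\<lambda>j. J j \<omega>) (\<lambda>j. \<tau> j \<omega>) (P \<omega>)"
  proof eventually_elim
    case (elim \<omega>)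
    have "\<tau> j \<omega> \<in> space P0" for j using measurable_space[OF \<tau>_meas elim(2)] .
    moreover have "inj (\<lambda>j. \<tau> j \<omega>)" using elim(3) by (auto simp: inj_on_def)
    ultimately show ?case using elim(1) by (simp add: nn_integral_count_space_nat)
  qed
  moreover from rep' AE_space[of M]
  have "AE \<omega> in M. (\<integral>\<^sup>+i. ennreal (J i \<omega>) \<partial>count_space (UNIV :: nat set)) < \<top>"
  proof eventually_elim
    case (elim \<omega>)
    let ?T = "\<integral>\<^sup>+i. ennreal (J i \<omega>) \<partial>count_space (UNIV :: nat set)"
    have P': "prob_space (P \<omega>)" "sets (P \<omega>) = sets P0"
      using measurable_space[OF P elim(2)] by (auto simp: space_prob_algebra)
    have "emeasure (P \<omega>) (space P0) = 1"
      using prob_space.emeasure_space_1[OF P'(1)] sets_eq_imp_space_eq[OF P'(2)] by simp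
    then have "(\<integral>\<^sup>+j. ennreal (J j \<omega>) / ?T \<partial>count_space UNIV) = 1"
      using elim(1) by simp
    then have "?T \<noteq> \<top>" by (intro notI) simp
    then show ?case by (simp add: less_top)
  qed
  ultimately show thesis using that J by blast
qed

end

section \<open>Conditionally iid jumps with a Poisson number\<close>

text \<open>The association list hands the functions \<open>fs\<close> to the elements of \<open>l\<close>; all other elements of \<open>S\<close> get the default \<open>e\<close>.
  This writes a term of the sum over \<open>l\<close> as a product over all jumps, which is what independence requires.\<close>

lemma prod_map_of_zip:
  fixes \<Phi> :: "'f \<Rightarrow> 'b \<Rightarrow> 'c :: comm_monoid_mult"
  assumes "length fs = length l" "distinct l" "finite S" "set l \<subseteq> S"
  shows "(\<Prod>j\<in>S. \<Phi> (case map_of (zip l fs) j of None \<Rightarrow> e | Some f \<Rightarrow> f) j) =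
    prod_list (map2 \<Phi> fs l) * (\<Prod>j\<in>S - set l. \<Phi> e j)"
  using assms
proof (induction fs l arbitrary: S rule: list_induct2)
  case (Cons f fs j l)
  have "(\<Prod>i\<in>S. \<Phi> (case map_of (zip (j # l) (f # fs)) i of None \<Rightarrow> e | Some f \<Rightarrow> f) i) =
    \<Phi> f j * (\<Prod>i\<in>S - {j}. \<Phi> (case map_of (zip (j # l) (f # fs)) i of None \<Rightarrow> e | Some f \<Rightarrow> f) i)"
    using Cons.prems by (subst prod.remove[of _ j]) auto
  also have "(\<Prod>i\<in>S - {j}. \<Phi> (case map_of (zip (j # l) (f # fs)) i of None \<Rightarrow> e | Some f \<Rightarrow> f) i) =
    (\<Prod>i\<in>S - {j}. \<Phi> (case map_of (zip l fs) i of None \<Rightarrow> e | Some f \<Rightarrow> f) i)"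
    by (intro prod.cong) auto
  also have "\<dots> = prod_list (map2 \<Phi> fs l) * (\<Prod>i\<in>S - {j} - set l. \<Phi> e i)"
    using Cons.prems by (intro Cons.IH) auto
  also have "S - {j} - set l = S - set (j # l)" by auto
  finally show ?case by (simp add: mult_ac)
qed simp

lemma map2_ignore2: "length xs = length ys \<Longrightarrow> map2 (\<lambda>x y. f x) xs ys = map f xs"
  by (induction xs ys rule: list_induct2) auto

text \<open>The formula for rectangles says that, under the conditional probability, the jumps have the product law.\<close>

lemma nn_integral_conditionally_iid:
  fixes J :: "nat \<Rightarrow> 'w \<Rightarrow> real"
  assumes "prob_space M" and N [measurable]: "N \<in> M \<rightarrow>\<^sub>M count_space UNIV"
    and J [measurable]: "\<And>j. J j \<in> borel_measurable M"
    and \<nu>: "prob_space \<nu>" "sets \<nu> = sets borel"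
    and pos: "0 < \<P>(\<omega> in M. N \<omega> = n)"
    and cond: "\<And>A. (\<And>j. j \<le> n \<Longrightarrow> A j \<in> sets borel) \<Longrightarrow>
      \<P>(\<omega> in M. (\<forall>j\<le>n. J j \<omega> \<in> A j) \<bar> N \<omega> = n) = (\<Prod>j\<le>n. measure \<nu> (A j))"
    and g: "\<And>j. j \<le> n \<Longrightarrow> g j \<in> borel_measurable borel"
  shows "(\<integral>\<^sup>+\<omega>. indicator {\<omega>\<in>space M. N \<omega> = n} \<omega> * (\<Prod>j\<le>n. g j (J j \<omega>)) \<partial>M) =
    ennreal (\<P>(\<omega> in M. N \<omega> = n)) * (\<Prod>j\<le>n. \<integral>\<^sup>+s. g j s \<partial>\<nu>)"
proof -
  interpret prob_space M by fact
  interpret \<nu>: prob_space \<nu> by fact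
  interpret P: product_sigma_finite "\<lambda>_. \<nu>" ..
  note \<nu>(2)[measurable_cong]
  define E where "E = {\<omega>\<in>space M. N \<omega> = n}"
  have E [measurable]: "E \<in> sets M" unfolding E_def by measurable
  have E_pos: "emeasure M E \<noteq> 0" using pos by (auto simp: E_def emeasure_eq_measure)
  \<comment> \<open>the conditional probability given \<open>N = n\<close>\<close>
  define U where "U = uniform_measure M E"
  have U_sets [measurable_cong]: "sets U = sets M" by (simp add: U_def)
  define X where "X \<omega> = restrict (\<lambda>j. J j \<omega>) {..n}" for \<omega>
  have X [measurable]: "X \<in> M \<rightarrow>\<^sub>M (\<Pi>\<^sub>M j\<in>{..n}. \<nu>)" unfolding X_def by measurable
  have "distr U (\<Pi>\<^sub>M j\<in>{..n}. \<nu>) X = (\<Pi>\<^sub>M j\<in>{..n}. \<nu>)"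
  proof (rule P.PiM_eqI)
    fix A :: "nat \<Rightarrow> real set" assume A: "\<And>j. j \<in> {..n} \<Longrightarrow> A j \<in> sets \<nu>"
    have A' [measurable]: "(\<Pi>\<^sub>E j\<in>{..n}. A j) \<in> sets (\<Pi>\<^sub>M j\<in>{..n}. \<nu>)"
      using A by (intro sets_PiM_I_finite) auto
    have "emeasure (distr U (\<Pi>\<^sub>M j\<in>{..n}. \<nu>) X) (\<Pi>\<^sub>E j\<in>{..n}. A j) = emeasure U (X -` (\<Pi>\<^sub>E j\<in>{..n}. A j) \<inter> space M)"
      using sets_eq_imp_space_eq[OF U_sets] by (subst emeasure_distr) auto
    also have "\<dots> = emeasure M (E \<inter> (X -` (\<Pi>\<^sub>E j\<in>{..n}. A j) \<inter> space M)) / emeasure M E"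
      unfolding U_def by (intro emeasure_uniform_measure E measurable_sets[OF X A'])
    also have "E \<inter> (X -` (\<Pi>\<^sub>E j\<in>{..n}. A j) \<inter> space M) = {\<omega>\<in>space M. (\<forall>j\<le>n. J j \<omega> \<in> A j) \<and> N \<omega> = n}"
      by (auto simp: E_def X_def PiE_iff)
    also have "emeasure M \<dots> / emeasure M E = ennreal (\<P>(\<omega> in M. (\<forall>j\<le>n. J j \<omega> \<in> A j) \<bar> N \<omega> = n))"
      using pos by (simp add: emeasure_eq_measure cond_prob_def E_def divide_ennreal)
    also have "\<dots> = (\<Prod>j\<le>n. emeasure \<nu> (A j))"
      using A by (subst cond) (auto simp: \<nu>(2) \<nu>.emeasure_eq_measure prod_ennreal)
    finally show "emeasure (distr U (\<Pi>\<^sub>M j\<in>{..n}. \<nu>) X) (\<Pi>\<^sub>E j\<in>{..n}. A j) = (\<Prod>j\<in>{..n}. emeasure \<nu> (A j))" .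
  qed auto
  moreover have [measurable]: "(\<lambda>x. \<Prod>j\<le>n. g j (x j)) \<in> borel_measurable (\<Pi>\<^sub>M j\<in>{..n}. \<nu>)"
  proof (rule borel_measurable_prod_ennreal)
    fix j assume j: "j \<in> {..n}"
    have "(\<lambda>x. x j) \<in> borel_measurable (\<Pi>\<^sub>M j\<in>{..n}. \<nu>)"
      using measurable_component_singleton[OF j, of "\<lambda>_. \<nu>"] measurable_cong_sets[OF refl \<nu>(2)] by blast
    then show "(\<lambda>x. g j (x j)) \<in> borel_measurable (\<Pi>\<^sub>M j\<in>{..n}. \<nu>)"
      using g j by (auto intro: measurable_compose)
  qed
  moreover have "X \<in> U \<rightarrow>\<^sub>M (\<Pi>\<^sub>M j\<in>{..n}. \<nu>)"
    using X measurable_cong_sets[OF U_sets refl] by blast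
  ultimately have "(\<integral>\<^sup>+\<omega>. (\<Prod>j\<le>n. g j (X \<omega> j)) \<partial>U) = (\<integral>\<^sup>+x. (\<Prod>j\<le>n. g j (x j)) \<partial>(\<Pi>\<^sub>M j\<in>{..n}. \<nu>))"
    using nn_integral_distr[of X U "\<Pi>\<^sub>M j\<in>{..n}. \<nu>" "\<lambda>x. \<Prod>j\<le>n. g j (x j)"] by simp
  also have "\<dots> = (\<Prod>j\<le>n. \<integral>\<^sup>+s. g j s \<partial>\<nu>)"
    using g by (intro P.product_nn_integral_prod) (auto simp: measurable_cong_sets[OF \<nu>(2) refl])
  finally have "(\<integral>\<^sup>+\<omega>. (\<Prod>j\<le>n. g j (J j \<omega>)) \<partial>U) = (\<Prod>j\<le>n. \<integral>\<^sup>+s. g j s \<partial>\<nu>)"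
    by (simp add: X_def)
  moreover have "(\<integral>\<^sup>+\<omega>. (\<Prod>j\<le>n. g j (J j \<omega>)) \<partial>U) = (\<integral>\<^sup>+\<omega>. (\<Prod>j\<le>n. g j (J j \<omega>)) * indicator E \<omega> \<partial>M) / emeasure M E"
    unfolding U_def using g
    by (intro nn_integral_uniform_measure borel_measurable_prod_ennreal) (auto intro: measurable_compose[OF J])
  moreover have "emeasure M E * ((\<integral>\<^sup>+\<omega>. (\<Prod>j\<le>n. g j (J j \<omega>)) * indicator E \<omega> \<partial>M) / emeasure M E) =
      (\<integral>\<^sup>+\<omega>. (\<Prod>j\<le>n. g j (J j \<omega>)) * indicator E \<omega> \<partial>M)"
    using E_pos by (simp add: ennreal_times_divide ennreal_mult_divide_eq mult.commute[of "emeasure M E"])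
  ultimately show ?thesis
    by (simp add: E_def[symmetric] emeasure_eq_measure mult.commute)
qed

text \<open>The lists that avoid the largest index are counted. This index belongs to the additional jump of the truncated measure, which is
  negligible in the limit; without it the Poisson mixture below has a simple closed form.\<close>

lemma card_distinct_lists_ge:
  "fact (m + k) / fact m \<le> real (card (distinct_lists k {..m + k}))"
proof -
  have "finite (distinct_lists k {..m + k})"
    unfolding distinct_lists_def
    by (rule finite_subset[OF _ finite_lists_length_eq[of "{..m + k}" k]]) auto
  then have "card {l. length l = k \<and> distinct l \<and> set l \<subseteq> {..<m + k}} \<le> card (distinct_lists k {..m + k})"
    by (intro card_mono) (auto simp: distinct_lists_def)
  moreover have "card {l. length l = k \<and> distinct l \<and> set l \<subseteq> {..<m + k}} = \<Prod>{m + 1..m + k}"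
    using card_lists_distinct_length_eq[of "{..<m + k}" k] by simp
  ultimately have "real (\<Prod>{m + 1..m + k}) \<le> real (card (distinct_lists k {..m + k}))"
    by (simp only: of_nat_le_iff)
  moreover have e: "real (\<Prod>{m + 1..m + k}) * fact m = fact (m + k)"
  proof (induction k)
    case (Suc k)
    have "\<Prod>{m + 1..m + Suc k} = (m + Suc k) * \<Prod>{m + 1..m + k}"
      by (simp add: prod.nat_ivl_Suc')
    then have "real (\<Prod>{m + 1..m + Suc k}) * fact m = real (m + Suc k) * (real (\<Prod>{m + 1..m + k}) * fact m)"
      by (simp only: of_nat_mult mult.assoc)
    also have "\<dots> = fact (m + Suc k)"
      unfolding Suc.IH by simp
    finally show ?case .
  qed simp
  have "fact (m + k) / fact m = real (\<Prod>{m + 1..m + k})"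
    by (subst e[symmetric]) (rule nonzero_mult_div_cancel_right[OF fact_nonzero])
  ultimately show ?thesis by (simp only:)
qed

text \<open>Only the term of the event that contains \<open>\<omega>\<close> is different from 0.\<close>

lemma nn_integral_measure_split:
  assumes "\<And>n. E n \<in> sets M" "disjoint_family E" "(\<Union>n :: nat. E n) = space M" and "\<And>n. f n \<in> borel_measurable M"
    and "AE \<omega> in M. \<forall>n. \<omega> \<in> E n \<longrightarrow> F \<omega> = f n \<omega>"
  shows "(\<integral>\<^sup>+\<omega>. F \<omega> \<partial>M) = (\<Sum>n. \<integral>\<^sup>+\<omega>. indicator (E n) \<omega> * f n \<omega> \<partial>M)"
proof -
  have "(\<integral>\<^sup>+\<omega>. F \<omega> \<partial>M) = (\<integral>\<^sup>+\<omega>. (\<Sum>n. f n \<omega> * indicator (E n) \<omega>) \<partial>M)"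
  proof (rule nn_integral_cong_AE)
    show "AE \<omega> in M. F \<omega> = (\<Sum>n. f n \<omega> * indicator (E n) \<omega>)"
      using assms(5) AE_space
    proof eventually_elim
      case (elim \<omega>)
      then obtain n where n: "\<omega> \<in> E n" using assms(3) by blast
      show ?case
        unfolding suminf_cmult_indicator[OF assms(2) n, of "\<lambda>n. f n \<omega>"] using elim(1) n by blast
    qed
  qed
  also have "\<dots> = (\<Sum>n. \<integral>\<^sup>+\<omega>. f n \<omega> * indicator (E n) \<omega> \<partial>M)"
    using assms by (intro nn_integral_suminf borel_measurable_times_ennreal borel_measurable_indicator) auto
  finally show ?thesis by (simp add: mult.commute)
qed

text \<open>The terms with \<open>n < k\<close> are dropped. In the others \<open>n = m + k\<close>, and \<open>card_distinct_lists_ge\<close> cancels the factorial of \<open>n\<close>, which leaves the exponential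
  series of \<open>\<Lambda> f\<close>.\<close>

lemma poisson_mixture_ge:
  assumes "0 \<le> \<Lambda>" "0 \<le> f" and r: "(r :: ennreal) = ennreal (f * exp (- (\<Lambda> * (1 - f))))"
  shows "r * (ennreal \<Lambda> ^ k * a) \<le>
    (\<Sum>n. of_nat (card (distinct_lists k {..n})) * (ennreal (\<Lambda> ^ n / fact n * exp (- \<Lambda>)) * (a * ennreal f ^ (Suc n - k))))"
    (is "_ \<le> suminf ?t")
proof -
  let ?s = "\<lambda>m. (\<Lambda> * f) ^ m / fact m * (\<Lambda> ^ k * exp (- \<Lambda>) * f)"
  have s0: "0 \<le> ?s m" for m using assms by simp
  have "(\<lambda>m. (\<Lambda> * f) ^ m / fact m) sums exp (\<Lambda> * f)"
    using exp_converges[of "\<Lambda> * f"] by (simp add: divide_inverse mult_ac)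
  from sums_mult2[OF this, of "\<Lambda> ^ k * exp (- \<Lambda>) * f"]
  have s: "?s sums (exp (\<Lambda> * f) * (\<Lambda> ^ k * exp (- \<Lambda>) * f))" .
  have "exp (\<Lambda> * f) * (\<Lambda> ^ k * exp (- \<Lambda>) * f) = f * exp (- (\<Lambda> * (1 - f))) * \<Lambda> ^ k"
    by (simp add: exp_diff exp_minus right_diff_distrib divide_inverse mult_ac)
  moreover have "r * ennreal \<Lambda> ^ k = ennreal (f * exp (- (\<Lambda> * (1 - f))) * \<Lambda> ^ k)"
    using assms by (simp add: ennreal_mult ennreal_power)
  ultimately have "r * ennreal \<Lambda> ^ k = (\<Sum>m. ennreal (?s m))"
    by (simp only: suminf_ennreal_eq[OF s0 s])
  then have "r * (ennreal \<Lambda> ^ k * a) = (\<Sum>m. ennreal (?s m) * a)"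
    by (simp add: mult.assoc[symmetric])
  also have "\<dots> \<le> (\<Sum>m. ?t (m + k))"
  proof (rule suminf_le)
    fix m
    have "?s m = fact (m + k) / fact m * (\<Lambda> ^ (m + k) / fact (m + k) * exp (- \<Lambda>) * f ^ Suc m)"
      by (simp add: power_add power_mult_distrib)
    also have "\<dots> \<le> real (card (distinct_lists k {..m + k})) * (\<Lambda> ^ (m + k) / fact (m + k) * exp (- \<Lambda>) * f ^ Suc m)"
      using assms by (intro mult_right_mono card_distinct_lists_ge) auto
    finally have "ennreal (?s m) * a \<le>
      ennreal (real (card (distinct_lists k {..m + k})) * (\<Lambda> ^ (m + k) / fact (m + k) * exp (- \<Lambda>) * f ^ Suc m)) * a"
      by (intro mult_right_mono ennreal_leI) auto
    also have "\<dots> = ?t (m + k)"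
    proof -
      have d: "Suc (m + k) - k = Suc m" by simp
      have "ennreal (real c * (q * f ^ Suc m)) = of_nat c * (ennreal q * ennreal f ^ Suc m)" if "0 \<le> q" for c q
        using assms that by (simp only: ennreal_mult ennreal_power ennreal_of_nat_eq_real_of_nat zero_le_power mult_nonneg_nonneg of_nat_0_le_iff)
      then have e: "ennreal (real c * (q * f ^ Suc m)) * a = of_nat c * (ennreal q * (a * ennreal f ^ Suc m))" if "0 \<le> q" for c q
        using that by (simp only: mult_ac)
      show ?thesis
        unfolding d by (rule e) (use \<open>0 \<le> \<Lambda>\<close> in simp)
    qed
    finally show "ennreal (?s m) * a \<le> ?t (m + k)" .
  qed auto
  also have "\<dots> \<le> suminf ?t"
  proof (rule suminf_le_const)
    fix p
    have "(\<Sum>m<p. ?t (m + k)) = sum ?t {k..<p + k}"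
      using sum.shift_bounds_nat_ivl[of ?t 0 k p] by (simp only: add_0 atLeast0LessThan)
    also have "\<dots> \<le> suminf ?t" by (intro sum_le_suminf) auto
    finally show "(\<Sum>m<p. ?t (m + k)) \<le> suminf ?t" .
  qed auto
  finally show ?thesis .
qed

section \<open>The jump intensity and its truncations\<close>

text \<open>The conditional law of a single jump.\<close>

definition eps_law :: "(real \<Rightarrow> real) \<Rightarrow> real \<Rightarrow> real \<Rightarrow> real measure" where
  "eps_law \<rho> \<kappa> \<epsilon> = density lborel (\<lambda>s. ennreal (rho_eps \<rho> \<kappa> \<epsilon> s))"

lemma sets_eps_law [simp, measurable_cong]: "sets (eps_law \<rho> \<kappa> \<epsilon>) = sets borel"
  by (simp add: eps_law_def)

lemma sets_crm_intensity [simp, measurable_cong]: "sets (crm_intensity \<rho> \<kappa>) = sets borel"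
  by (simp add: crm_intensity_def)

lemma power_le_fact_exp: "0 \<le> x \<Longrightarrow> x ^ m / fact m \<le> exp (x :: real)"
proof -
  assume "0 \<le> x"
  have s: "(\<lambda>n. x ^ n / fact n) sums exp x"
    using exp_converges[of x] by (simp add: divide_inverse mult.commute)
  have "(\<Sum>n\<in>{m}. x ^ n / fact n) \<le> (\<Sum>n. x ^ n / fact n)"
    using s \<open>0 \<le> x\<close> by (intro sum_le_suminf) (auto simp: sums_iff)
  then show ?thesis using s by (simp add: sums_iff)
qed

text \<open>For small \<open>s\<close> the exponential is at most 1 and \<open>s ^ m \<le> s\<close>; for large \<open>s\<close> the exponential series gives
  \<open>(u s) ^ m / fact m \<le> exp (u s)\<close>.\<close>

lemma tilted_power_le:
  assumes "0 < u" "0 < m" "0 < s"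
  shows "tilted_power u m s \<le> ennreal (max 1 (fact m / u ^ m) * min 1 s)"
proof -
  have e: "exp (- (u * s)) \<le> 1" using assms by simp
  have "s ^ m * exp (- (u * s)) \<le> max 1 (fact m / u ^ m) * min 1 s"
  proof (cases "s \<le> 1")
    case True
    have "s ^ m \<le> s ^ 1" using True assms by (intro power_decreasing) auto
    then have "s ^ m * exp (- (u * s)) \<le> s * 1" using assms e by (intro mult_mono) auto
    also have "\<dots> \<le> max 1 (fact m / u ^ m) * s" using assms by (simp add: mult_right_mono)
    finally show ?thesis using True by (simp add: min_def)
  next
    case False
    have "(u * s) ^ m / fact m \<le> exp (u * s)" using assms by (intro power_le_fact_exp) simp
    then have "s ^ m * exp (- (u * s)) \<le> fact m / u ^ m"
      using assms by (simp add: exp_minus field_simps power_mult_distrib)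
    also have "\<dots> \<le> max 1 (fact m / u ^ m)" by simp
    finally show ?thesis using False by simp
  qed
  then show ?thesis using assms unfolding tilted_power_def by (simp add: ennreal_leI)
qed

lemma one_minus_expm_le:
  assumes "0 < u" "0 < s"
  shows "1 - expm (ennreal (u * s)) \<le> ennreal (max 1 u * min 1 s)"
proof -
  have "1 - exp (- (u * s)) \<le> u * s" using exp_ge_add_one_self[of "- (u * s)"] by linarith
  moreover have "u * s \<le> max 1 u * s" using assms by (intro mult_right_mono) auto
  ultimately have "1 - exp (- (u * s)) \<le> max 1 u * min 1 s"
    by (cases "s \<le> 1") (auto simp: min_def intro: order_trans[of _ 1])
  moreover have "1 - expm (ennreal (u * s)) = ennreal (1 - exp (- (u * s)))"
    using assms by (subst expm_simps) (auto simp: ennreal_minus simp flip: ennreal_1)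
  ultimately show ?thesis by (simp add: ennreal_leI)
qed

lemma tendsto_prod_list_ennreal:
  assumes "\<And>m. m \<in> set ms \<Longrightarrow> ((\<lambda>i. a i m) \<longlongrightarrow> b m) F" "\<And>m. m \<in> set ms \<Longrightarrow> b m < \<top>"
  shows "((\<lambda>i. prod_list (map (a i) ms)) \<longlongrightarrow> (prod_list (map b ms) :: ennreal)) F"
  using assms
proof (induction ms)
  case (Cons m ms)
  have fin: "prod_list (map b ms) < \<top>" using Cons.prems(2) by (induction ms) (auto simp: ennreal_mult_less_top)
  have bm: "b m \<noteq> \<top>" using Cons.prems(2)[of m] by simp
  have "((\<lambda>i. a i m * prod_list (map (a i) ms)) \<longlongrightarrow> b m * prod_list (map b ms)) F"
    using Cons fin bm by (intro tendsto_mult_ennreal) auto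
  then show ?case by simp
qed simp

lemma prod_list_mult_const:
  "prod_list (map (\<lambda>x. c * f x) xs) = c ^ length xs * prod_list (map f xs :: 'a :: comm_monoid_mult list)"
  by (induction xs) (auto simp: mult_ac)

lemma measurable_tilted_power_pair [measurable (raw)]:
  assumes [measurable]: "f \<in> borel_measurable M" "g \<in> borel_measurable M"
  shows "(\<lambda>x. tilted_power (f x) m (g x)) \<in> borel_measurable M"
  unfolding tilted_power_def by measurable

lemma measurable_prod_list_map:
  assumes "\<And>x. x \<in> set xs \<Longrightarrow> (\<lambda>\<omega>. g x \<omega>) \<in> borel_measurable M"
  shows "(\<lambda>\<omega>. prod_list (map (\<lambda>x. g x \<omega>) xs) :: ennreal) \<in> borel_measurable M"
  using assms
proof (induction xs)
  case (Cons x xs)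
  have [measurable]: "(\<lambda>\<omega>. g x \<omega>) \<in> borel_measurable M"
    "(\<lambda>\<omega>. prod_list (map (\<lambda>x. g x \<omega>) xs)) \<in> borel_measurable M" using Cons by auto
  show ?case by simp
qed simp

locale jump_density =
  fixes \<rho> :: "real \<Rightarrow> real" and \<kappa> :: real
  assumes density_measurable: "\<rho> \<in> borel_measurable (restrict_space borel {0<..})"
    and density_nonneg: "0 < s \<Longrightarrow> 0 \<le> \<rho> s" and \<kappa>_pos: "0 < \<kappa>"
    and density_integrable: "(\<integral>\<^sup>+s\<in>{0<..}. ennreal (min 1 s * \<rho> s) \<partial>lborel) < \<infinity>"
begin

abbreviation \<mu> :: "real measure" where "\<mu> \<equiv> crm_intensity \<rho> \<kappa>"
abbreviation \<Lambda> :: "real \<Rightarrow> real" where "\<Lambda> \<equiv> Lambda_eps \<rho> \<kappa>"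
abbreviation \<nu> :: "real \<Rightarrow> real measure" where "\<nu> \<equiv> eps_law \<rho> \<kappa>"

lemma measurable_density [measurable]: "(\<lambda>s. indicator {0<..} s * \<rho> s) \<in> borel_measurable borel"
  using density_measurable by (subst (asm) borel_measurable_restrict_space_iff) auto

lemma measurable_intensity [measurable]: "(\<lambda>s. indicator {0<..} s * ennreal (\<kappa> * \<rho> s)) \<in> borel_measurable borel"
proof -
  have "(\<lambda>s. indicator {0<..} s * ennreal (\<kappa> * \<rho> s)) = (\<lambda>s. indicator {0<..} s * ennreal (\<kappa> * (indicator {0<..} s * \<rho> s)))"
    by (auto split: split_indicator)
  also have "\<dots> \<in> borel_measurable borel" by measurable
  finally show ?thesis .
qed

lemma nn_integral_intensity:
  "g \<in> borel_measurable borel \<Longrightarrow> (\<integral>\<^sup>+s. g s \<partial>\<mu>) = (\<integral>\<^sup>+s. indicator {0<..} s * ennreal (\<kappa> * \<rho> s) * g s \<partial>lborel)"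
  unfolding crm_intensity_def by (intro nn_integral_density) auto

sublocale intensity: sigma_finite_measure \<mu>
  unfolding crm_intensity_def
  by (subst sigma_finite_measure.sigma_finite_iff_density_finite[OF sigma_finite_lborel])
     (auto simp: ennreal_mult_eq_top_iff split: split_indicator)

text \<open>All integrability questions about the intensity are reduced to the assumption on \<open>min 1 s * \<rho> s\<close>.\<close>

lemma nn_integral_intensity_finite:
  assumes g [measurable]: "g \<in> borel_measurable borel" and bound: "\<And>s. 0 < s \<Longrightarrow> g s \<le> ennreal (c * min 1 s)"
    and "0 \<le> c"
  shows "(\<integral>\<^sup>+s. g s \<partial>\<mu>) < \<top>"
proof -
  have eq: "(\<lambda>s. ennreal (min 1 s * \<rho> s) * indicator {0<..} s) = (\<lambda>s. ennreal (min 1 s * (indicator {0<..} s * \<rho> s)))"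
    by (auto split: split_indicator)
  have [measurable]: "(\<lambda>s. ennreal (min 1 s * \<rho> s) * indicator {0<..} s) \<in> borel_measurable borel"
    unfolding eq by measurable
  have "(\<integral>\<^sup>+s. g s \<partial>\<mu>) = (\<integral>\<^sup>+s. indicator {0<..} s * ennreal (\<kappa> * \<rho> s) * g s \<partial>lborel)"
    by (rule nn_integral_intensity[OF g])
  also have "\<dots> \<le> (\<integral>\<^sup>+s. ennreal (\<kappa> * c) * (ennreal (min 1 s * \<rho> s) * indicator {0<..} s) \<partial>lborel)"
  proof (intro nn_integral_mono)
    fix s :: real
    show "indicator {0<..} s * ennreal (\<kappa> * \<rho> s) * g s \<le> ennreal (\<kappa> * c) * (ennreal (min 1 s * \<rho> s) * indicator {0<..} s)"
    proof (cases "0 < s")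
      case True
      have "ennreal (\<kappa> * \<rho> s) * g s \<le> ennreal (\<kappa> * \<rho> s) * ennreal (c * min 1 s)"
        using bound[OF True] by (rule mult_left_mono) simp
      also have "\<dots> = ennreal (\<kappa> * c) * ennreal (min 1 s * \<rho> s)"
        using True density_nonneg[OF True] \<kappa>_pos \<open>0 \<le> c\<close> by (simp add: mult_ac flip: ennreal_mult)
      finally show ?thesis using True by simp
    qed simp
  qed
  also have "\<dots> = ennreal (\<kappa> * c) * (\<integral>\<^sup>+s\<in>{0<..}. ennreal (min 1 s * \<rho> s) \<partial>lborel)"
    by (rule nn_integral_cmult) simp
  also have "\<dots> < \<top>" using density_integrable by (simp add: ennreal_mult_less_top)
  finally show ?thesis .
qed

lemma nn_integral_intensity_eq_LINT:
  assumes g [measurable]: "g \<in> borel_measurable borel" and gh: "\<And>s. 0 < s \<Longrightarrow> g s = ennreal (h s) \<and> 0 \<le> h s"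
    and h [measurable]: "h \<in> borel_measurable borel"
    and fin: "(\<integral>\<^sup>+s. g s \<partial>\<mu>) < \<top>"
  shows "(\<integral>\<^sup>+s. g s \<partial>\<mu>) = ennreal (LINT s:{0<..}|lborel. \<kappa> * h s * \<rho> s)"
proof -
  have eq: "(\<lambda>s. indicator {0<..} s * (\<kappa> * h s * \<rho> s)) = (\<lambda>s. \<kappa> * h s * (indicator {0<..} s * \<rho> s))"
    by auto
  have [measurable]: "(\<lambda>s. indicator {0<..} s * (\<kappa> * h s * \<rho> s)) \<in> borel_measurable borel"
    unfolding eq by measurable
  have nn: "0 \<le> indicator {0<..} s * (\<kappa> * h s * \<rho> s)" for s
    using density_nonneg[of s] gh[of s] \<kappa>_pos by (auto split: split_indicator)
  have "(\<integral>\<^sup>+s. g s \<partial>\<mu>) = (\<integral>\<^sup>+s. indicator {0<..} s * ennreal (\<kappa> * \<rho> s) * g s \<partial>lborel)"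
    by (rule nn_integral_intensity[OF g])
  also have "\<dots> = (\<integral>\<^sup>+s. ennreal (indicator {0<..} s * (\<kappa> * h s * \<rho> s)) \<partial>lborel)"
  proof (intro nn_integral_cong)
    fix s :: real
    show "indicator {0<..} s * ennreal (\<kappa> * \<rho> s) * g s = ennreal (indicator {0<..} s * (\<kappa> * h s * \<rho> s))"
      using density_nonneg[of s] gh[of s] \<kappa>_pos by (cases "0 < s") (auto simp: mult_ac simp flip: ennreal_mult)
  qed
  finally have e: "(\<integral>\<^sup>+s. g s \<partial>\<mu>) = (\<integral>\<^sup>+s. ennreal (indicator {0<..} s * (\<kappa> * h s * \<rho> s)) \<partial>lborel)" .
  have "integrable lborel (\<lambda>s. indicator {0<..} s * (\<kappa> * h s * \<rho> s))"
    using fin nn unfolding e by (intro integrableI_nonneg) auto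
  then show ?thesis
    unfolding e set_lebesgue_integral_def using nn by (subst nn_integral_eq_integral) auto
qed

lemma tilted_moment_finite:
  assumes "0 < u" "0 < m"
  shows "tilted_moment \<mu> u m < \<top>"
  by (rule nn_integral_intensity_finite[where c="max 1 (fact m / u ^ m)"]) (use tilted_power_le[OF assms] in auto)

lemma laplace_exponent_finite:
  assumes "0 < u"
  shows "laplace_exponent \<mu> u < \<top>"
  by (rule nn_integral_intensity_finite[where c="max 1 u"]) (use one_minus_expm_le[OF assms] in auto)

lemma tail_finite:
  assumes "0 < \<epsilon>"
  shows "emeasure \<mu> {\<epsilon><..} < \<top>"
proof -
  have "(\<integral>\<^sup>+s. indicator {\<epsilon><..} s \<partial>\<mu>) < \<top>"
  proof (rule nn_integral_intensity_finite[where c="1 / min 1 \<epsilon>"])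
    show "indicator {\<epsilon><..} s \<le> ennreal (1 / min 1 \<epsilon> * min 1 s)" for s :: real
    proof (cases "\<epsilon> < s")
      case True
      then have "1 \<le> 1 / min 1 \<epsilon> * min 1 s" using \<open>0 < \<epsilon>\<close> by (auto simp: min_def field_simps)
      then show ?thesis using True by (simp add: ennreal_leI flip: ennreal_1)
    qed simp
  qed (use \<open>0 < \<epsilon>\<close> in auto)
  then show ?thesis by simp
qed

lemma \<Lambda>_eq_tail:
  assumes "0 < \<epsilon>"
  shows "ennreal (\<Lambda> \<epsilon>) = emeasure \<mu> {\<epsilon><..}"
proof -
  let ?h = "\<lambda>s. indicator {\<epsilon><..} s :: real"
  have LINT: "(LINT s:{0<..}|lborel. \<kappa> * ?h s * \<rho> s) = \<Lambda> \<epsilon>"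
  proof -
    have "(LINT s:{0<..}|lborel. \<kappa> * ?h s * \<rho> s) = (LINT s|lborel. \<kappa> * (indicator {\<epsilon><..} s * \<rho> s))"
      unfolding set_lebesgue_integral_def using assms
      by (intro Bochner_Integration.integral_cong refl) (auto split: split_indicator)
    then show ?thesis by (simp add: Lambda_eps_def set_lebesgue_integral_def)
  qed
  have "emeasure \<mu> {\<epsilon><..} = (\<integral>\<^sup>+s. indicator {\<epsilon><..} s \<partial>\<mu>)" by simp
  also have "\<dots> = ennreal (\<Lambda> \<epsilon>)"
    unfolding LINT[symmetric] using tail_finite[OF assms]
    by (intro nn_integral_intensity_eq_LINT) (auto split: split_indicator)
  finally show ?thesis ..
qed

text \<open>The factor \<open>\<Lambda>\<close> undoes the normalization of the density.\<close>

lemma nn_integral_eps_law: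
  assumes "0 < \<epsilon>" and \<Lambda>: "0 < \<Lambda> \<epsilon>" and g [measurable]: "g \<in> borel_measurable borel"
  shows "ennreal (\<Lambda> \<epsilon>) * (\<integral>\<^sup>+s. g s \<partial>\<nu> \<epsilon>) = (\<integral>\<^sup>+s. indicator {\<epsilon><..} s * g s \<partial>\<mu>)"
proof -
  have eq: "rho_eps \<rho> \<kappa> \<epsilon> = (\<lambda>s. \<kappa> * (indicator {0<..} s * \<rho> s) / \<Lambda> \<epsilon> * indicator {\<epsilon><..} s)"
    using \<open>0 < \<epsilon>\<close> by (auto simp: rho_eps_def fun_eq_iff split: split_indicator)
  have [measurable]: "rho_eps \<rho> \<kappa> \<epsilon> \<in> borel_measurable borel" unfolding eq by measurable
  have "ennreal (\<Lambda> \<epsilon>) * (\<integral>\<^sup>+s. g s \<partial>\<nu> \<epsilon>) =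
    (\<integral>\<^sup>+s. ennreal (\<Lambda> \<epsilon>) * (ennreal (rho_eps \<rho> \<kappa> \<epsilon> s) * g s) \<partial>lborel)"
    unfolding eps_law_def by (subst nn_integral_density) (auto simp: nn_integral_cmult)
  also have "\<dots> = (\<integral>\<^sup>+s. indicator {0<..} s * ennreal (\<kappa> * \<rho> s) * (indicator {\<epsilon><..} s * g s) \<partial>lborel)"
  proof (intro nn_integral_cong)
    fix s
    have "ennreal (\<Lambda> \<epsilon>) * ennreal (rho_eps \<rho> \<kappa> \<epsilon> s) = ennreal (\<kappa> * \<rho> s) * indicator {\<epsilon><..} s"
      using \<Lambda> by (simp add: rho_eps_def ennreal_mult'[symmetric] split: split_indicator)
    then show "ennreal (\<Lambda> \<epsilon>) * (ennreal (rho_eps \<rho> \<kappa> \<epsilon> s) * g s) =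
        indicator {0<..} s * ennreal (\<kappa> * \<rho> s) * (indicator {\<epsilon><..} s * g s)"
      using \<open>0 < \<epsilon>\<close> by (simp add: mult.assoc[symmetric] split: split_indicator)
  qed
  also have "\<dots> = (\<integral>\<^sup>+s. indicator {\<epsilon><..} s * g s \<partial>\<mu>)"
    by (rule nn_integral_intensity[symmetric]) measurable
  finally show ?thesis .
qed

lemma prob_space_eps_law:
  assumes "0 < \<epsilon>" and \<Lambda>: "0 < \<Lambda> \<epsilon>"
  shows "prob_space (\<nu> \<epsilon>)" "measure (\<nu> \<epsilon>) {..0} = 0"
proof -
  let ?\<Lambda> = "ennreal (\<Lambda> \<epsilon>)"
  have eq: "?\<Lambda> * emeasure (\<nu> \<epsilon>) A = emeasure \<mu> ({\<epsilon><..} \<inter> A)" if [measurable]: "A \<in> sets borel" for A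
    using nn_integral_eps_law[OF assms, of "indicator A"]
    by (simp add: indicator_inter_arith[symmetric])
  have \<Lambda>: "?\<Lambda> \<noteq> 0" "?\<Lambda> \<noteq> \<top>" using assms by auto
  have "?\<Lambda> * emeasure (\<nu> \<epsilon>) UNIV = ?\<Lambda> * 1"
    using eq[of UNIV] \<Lambda>_eq_tail[OF assms(1)] by simp
  then have "emeasure (\<nu> \<epsilon>) UNIV = 1"
    using \<Lambda> ennreal_mult_cancel_left[of ?\<Lambda> "emeasure (\<nu> \<epsilon>) UNIV" 1] by blast
  then show "prob_space (\<nu> \<epsilon>)"
    by (intro prob_spaceI) (simp add: eps_law_def)
  have "{\<epsilon><..} \<inter> {..0} = {}" using \<open>0 < \<epsilon>\<close> by auto
  then have "emeasure (\<nu> \<epsilon>) {..0} = 0"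
    using eq[of "{..0}"] \<Lambda> by simp
  then show "measure (\<nu> \<epsilon>) {..0} = 0" by (simp add: measure_def)
qed

text \<open>The truncated Laplace exponent is at most the full one. Since \<open>\<Lambda>\<close> tends to infinity, this makes the Laplace transform of a single jump tend to 1.\<close>

lemma laplace_eps_law_bounds:
  assumes "0 < \<epsilon>" and \<Lambda>: "0 < \<Lambda> \<epsilon>"
  shows "laplace_transform (\<nu> \<epsilon>) u \<le> 1"
    and "ennreal (\<Lambda> \<epsilon>) * (1 - laplace_transform (\<nu> \<epsilon>) u)
      \<le> laplace_exponent \<mu> u"
proof -
  define f where "f = laplace_transform (\<nu> \<epsilon>) u"
  interpret \<nu>: prob_space "\<nu> \<epsilon>"
    by (rule prob_space_eps_law[OF assms])
  have "f \<le> (\<integral>\<^sup>+s. 1 \<partial>\<nu> \<epsilon>)" unfolding f_def by (intro nn_integral_mono) (rule expm_le_1)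
  then show le: "laplace_transform (\<nu> \<epsilon>) u \<le> 1" by (simp add: \<nu>.emeasure_space_1 f_def)
  have "laplace_exponent (\<nu> \<epsilon>) u + f = (\<integral>\<^sup>+s. (1 - expm (ennreal (u * s))) + expm (ennreal (u * s)) \<partial>\<nu> \<epsilon>)"
    unfolding f_def by (intro nn_integral_add[symmetric]) measurable
  also have "\<dots> = 1"
    by (simp add: diff_add_cancel_ennreal expm_le_1 \<nu>.emeasure_space_1)
  finally have s: "laplace_exponent (\<nu> \<epsilon>) u + f = 1" .
  have "f \<noteq> \<top>" using le by (auto simp: f_def top_unique)
  from ennreal_add_diff_cancel_right[OF this, of "laplace_exponent (\<nu> \<epsilon>) u"]
  have split: "laplace_exponent (\<nu> \<epsilon>) u = 1 - f" unfolding s ..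
  have "ennreal (\<Lambda> \<epsilon>) * (1 - f) = (\<integral>\<^sup>+s. indicator {\<epsilon><..} s * (1 - expm (ennreal (u * s))) \<partial>\<mu>)"
    unfolding split[symmetric]
    by (rule nn_integral_eps_law[OF assms]) measurable
  also have "\<dots> \<le> laplace_exponent \<mu> u"
    by (intro nn_integral_mono) (auto split: split_indicator)
  finally show "ennreal (\<Lambda> \<epsilon>) * (1 - laplace_transform (\<nu> \<epsilon>) u) \<le> laplace_exponent \<mu> u"
    by (simp only: f_def)
qed

text \<open>Fatou's lemma for indicators; the sequence of thresholds need not be monotone.\<close>

lemma tail_tendsto:
  assumes inf: "(\<integral>\<^sup>+s\<in>{0<..}. ennreal (\<rho> s) \<partial>lborel) = \<infinity>" and X: "X \<longlonglongrightarrow> (0 :: real)"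
  shows "(\<lambda>i. emeasure \<mu> {X i<..}) \<longlonglongrightarrow> \<top>"
proof -
  have eq: "(\<lambda>s. ennreal (\<rho> s) * indicator {0<..} s) = (\<lambda>s. ennreal (indicator {0<..} s * \<rho> s))"
    by (auto split: split_indicator)
  have [measurable]: "(\<lambda>s. ennreal (\<rho> s) * indicator {0<..} s) \<in> borel_measurable borel"
    unfolding eq by measurable
  have "emeasure \<mu> {0<..} = (\<integral>\<^sup>+s. indicator {0<..} s \<partial>\<mu>)" by simp
  also have "\<dots> = (\<integral>\<^sup>+s. ennreal \<kappa> * (ennreal (\<rho> s) * indicator {0<..} s) \<partial>lborel)"
    using \<kappa>_pos by (subst nn_integral_intensity) (auto intro!: nn_integral_cong simp: ennreal_mult' split: split_indicator)
  also have "\<dots> = ennreal \<kappa> * (\<integral>\<^sup>+s\<in>{0<..}. ennreal (\<rho> s) \<partial>lborel)" by (rule nn_integral_cmult) simp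
  also have "\<dots> = \<top>" using inf \<kappa>_pos by (simp add: ennreal_mult_top)
  finally have top: "emeasure \<mu> {0<..} = \<top>" .
  have "(\<integral>\<^sup>+s. indicator {0<..} s \<partial>\<mu>) \<le> (\<integral>\<^sup>+s. liminf (\<lambda>i. indicator {X i<..} s) \<partial>\<mu>)"
  proof (intro nn_integral_mono)
    fix s :: real
    show "indicator {0<..} s \<le> liminf (\<lambda>i. indicator {X i<..} s :: ennreal)"
    proof (cases "0 < s")
      case True
      have "\<forall>\<^sub>F i in sequentially. X i < s" using order_tendstoD(2)[OF X True] .
      then have "\<forall>\<^sub>F i in sequentially. (1 :: ennreal) \<le> indicator {X i<..} s" by eventually_elim simp
      then show ?thesis using True by (simp add: Liminf_bounded)
    qed simp
  qed
  also have "\<dots> \<le> liminf (\<lambda>i. \<integral>\<^sup>+s. indicator {X i<..} s \<partial>\<mu>)" by (rule nn_integral_liminf) measurable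
  finally have "liminf (\<lambda>i. emeasure \<mu> {X i<..}) = \<top>" using top by (simp add: top_unique)
  moreover from this have "limsup (\<lambda>i. emeasure \<mu> {X i<..}) = \<top>"
    using Liminf_le_Limsup[of sequentially "\<lambda>i. emeasure \<mu> {X i<..}"] by (simp add: top_unique)
  ultimately show ?thesis by (simp add: tendsto_iff_Liminf_eq_Limsup)
qed

abbreviation crm_integrand :: "nat list \<Rightarrow> nat \<Rightarrow> real \<Rightarrow> ennreal" where
  "crm_integrand ns n u \<equiv> gamma_weight n u *
     (prod_list (map (tilted_moment \<mu> u) ns) * expm (laplace_exponent \<mu> u))"

abbreviation eps_integrand :: "real \<Rightarrow> nat list \<Rightarrow> nat \<Rightarrow> real \<Rightarrow> ennreal" where
  "eps_integrand \<epsilon> ns n u \<equiv> gamma_weight n u *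
     (laplace_transform (\<nu> \<epsilon>) u * expm (laplace_exponent \<mu> u) *
      prod_list (map (tilted_moment_above \<mu> \<epsilon> u) ns))"

text \<open>Fatou's lemma. For fixed \<open>u\<close> the truncated moments converge by dominated convergence in \<open>s\<close>, and the Laplace transform of a single jump
  tends to 1 since \<open>\<Lambda>\<close> tends to infinity.\<close>

lemma eps_lower_bound_liminf:
  assumes inf: "(\<integral>\<^sup>+s\<in>{0<..}. ennreal (\<rho> s) \<partial>lborel) = \<infinity>"
    and X: "X \<longlonglongrightarrow> 0" "\<And>i. 0 < X i"
  shows "(\<And>m. m \<in> set ns \<Longrightarrow> 0 < m) \<Longrightarrow>
    (\<integral>\<^sup>+u. crm_integrand ns n u \<partial>lborel) \<le> liminf (\<lambda>i. \<integral>\<^sup>+u. eps_integrand (X i) ns n u \<partial>lborel)"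
    and "\<forall>\<^sub>F i in sequentially. 0 < \<Lambda> (X i)"
proof -
  have "(\<lambda>i. ennreal (\<Lambda> (X i))) \<longlonglongrightarrow> \<top>"
    unfolding \<Lambda>_eq_tail[OF X(2)] by (rule tail_tendsto[OF inf X(1)])
  then have \<Lambda>_lim: "filterlim (\<lambda>i. \<Lambda> (X i)) at_top sequentially" by (simp add: ennreal_tendsto_top_eq_at_top)
  then have \<Lambda>_pos: "\<forall>\<^sub>F i in sequentially. 0 < \<Lambda> (X i)" by (simp add: filterlim_at_top_dense)
  then show "\<forall>\<^sub>F i in sequentially. 0 < \<Lambda> (X i)" .
  assume ns: "\<And>m. m \<in> set ns \<Longrightarrow> 0 < m"
  define \<psi> where "\<psi> u = laplace_exponent \<mu> u" for u
  define f where "f i u = laplace_transform (\<nu> (X i)) u" for i u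
  define a where "a i u m = tilted_moment_above \<mu> (X i) u m" for i u m
  have [measurable]: "\<psi> \<in> borel_measurable borel" unfolding \<psi>_def by measurable
  have f_meas [measurable]: "f i \<in> borel_measurable borel" if "0 < \<Lambda> (X i)" for i
  proof -
    interpret prob_space "\<nu> (X i)"
      by (rule prob_space_eps_law[OF X(2) that])
    show ?thesis unfolding f_def by measurable
  qed
  have [measurable]: "(\<lambda>u. a i u m) \<in> borel_measurable borel" for i m unfolding a_def by measurable
  have lim: "(\<lambda>i. f i u * expm (\<psi> u) * prod_list (map (a i u) ns)) \<longlonglongrightarrow>
      1 * expm (\<psi> u) * prod_list (map (tilted_moment \<mu> u) ns)" if u: "0 < u" for u
  proof -
    note fin_tilt = tilted_moment_finite[OF u]
    have "\<psi> u < \<top>"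
      unfolding \<psi>_def by (rule laplace_exponent_finite[OF u])
    then obtain r where r: "\<psi> u = ennreal r" "0 \<le> r" by (cases "\<psi> u") auto
    have f_bound: "\<forall>\<^sub>F i in sequentially. f i u \<le> 1 \<and> 1 - r / \<Lambda> (X i) \<le> enn2real (f i u) \<and> enn2real (f i u) \<le> 1"
      using \<Lambda>_pos
    proof eventually_elim
      case (elim i)
      have b: "f i u \<le> 1" "ennreal (\<Lambda> (X i)) * (1 - f i u) \<le> ennreal r"
        using laplace_eps_law_bounds[OF X(2) elim, of u]
        by (auto simp: f_def r(1)[symmetric] \<psi>_def)
      obtain p where p: "f i u = ennreal p" "0 \<le> p" "p \<le> 1"
        using b(1) by (cases "f i u") (auto simp: top_unique simp flip: ennreal_1)
      have "ennreal (\<Lambda> (X i) * (1 - p)) \<le> ennreal r"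
        using b(2) p elim ennreal_minus[of p 1] by (simp add: ennreal_mult)
      then have "\<Lambda> (X i) * (1 - p) \<le> r" using r(2) by (simp add: ennreal_le_iff)
      then have "1 - r / \<Lambda> (X i) \<le> p" using elim by (simp add: field_simps)
      then show ?case using b(1) p by simp
    qed
    have "(\<lambda>i. r / \<Lambda> (X i)) \<longlonglongrightarrow> 0" by (rule tendsto_divide_0[OF tendsto_const filterlim_at_top_imp_at_infinity[OF \<Lambda>_lim]])
    from tendsto_diff[OF tendsto_const[of 1] this] have l: "(\<lambda>i. 1 - r / \<Lambda> (X i)) \<longlonglongrightarrow> 1" by simp
    have "(\<lambda>i. enn2real (f i u)) \<longlonglongrightarrow> 1"
      by (rule tendsto_sandwich[OF _ _ l tendsto_const[of 1]]) (use f_bound in \<open>auto elim: eventually_mono\<close>)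
    then have "(\<lambda>i. ennreal (enn2real (f i u))) \<longlonglongrightarrow> ennreal 1" by (rule tendsto_ennrealI)
    moreover have "\<forall>\<^sub>F i in sequentially. ennreal (enn2real (f i u)) = f i u"
      using f_bound by eventually_elim (metis ennreal_enn2real ennreal_one_less_top order_le_less_trans)
    ultimately have f_lim: "(\<lambda>i. f i u) \<longlonglongrightarrow> 1"
      using Lim_transform_eventually by fastforce
    have a_lim: "(\<lambda>i. a i u m) \<longlonglongrightarrow> tilted_moment \<mu> u m" if "m \<in> set ns" for m
      unfolding a_def
    proof (rule nn_integral_dominated_convergence[where w="tilted_power u m"])
      show "tilted_moment \<mu> u m < \<infinity>" using fin_tilt ns that by simp
      show "AE s in \<mu>. (\<lambda>i. indicator {X i<..} s * tilted_power u m s) \<longlonglongrightarrow> tilted_power u m s"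
      proof (rule AE_I2)
        fix s :: real
        show "(\<lambda>i. indicator {X i<..} s * tilted_power u m s) \<longlonglongrightarrow> tilted_power u m s"
        proof (cases "0 < s")
          case True
          have "\<forall>\<^sub>F i in sequentially. X i < s" using order_tendstoD(2)[OF X(1) True] .
          then have "\<forall>\<^sub>F i in sequentially. indicator {X i<..} s * tilted_power u m s = tilted_power u m s"
            by eventually_elim simp
          then show ?thesis by (rule tendsto_eventually)
        qed (simp add: tilted_power_def)
      qed
    qed (auto split: split_indicator)
    have P: "(\<lambda>i. prod_list (map (a i u) ns)) \<longlonglongrightarrow> prod_list (map (tilted_moment \<mu> u) ns)"
      by (rule tendsto_prod_list_ennreal) (use a_lim fin_tilt ns in auto)
    have Pfin: "prod_list (map (tilted_moment \<mu> u) ns) < \<top>"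
      using fin_tilt ns by (induction ns) (auto simp: ennreal_mult_less_top)
    show ?thesis
      using Pfin by (intro tendsto_mult_ennreal f_lim tendsto_const P) (auto simp: ennreal_mult_eq_top_iff)
  qed
  \<comment> \<open>the law of a single jump is a probability measure only if \<open>\<Lambda> (X i)\<close> is positive, so an initial segment is skipped\<close>
  obtain i0 where i0: "\<And>i. i0 \<le> i \<Longrightarrow> 0 < \<Lambda> (X i)" using \<Lambda>_pos by (auto simp: eventually_sequentially)
  have "(\<integral>\<^sup>+u. gamma_weight n u * (prod_list (map (tilted_moment \<mu> u) ns) * expm (\<psi> u)) \<partial>lborel)
    = (\<integral>\<^sup>+u. liminf (\<lambda>i. gamma_weight n u * (f (i + i0) u * expm (\<psi> u) * prod_list (map (a (i + i0) u) ns))) \<partial>lborel)"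
  proof (intro nn_integral_cong)
    fix u :: real
    show "gamma_weight n u * (prod_list (map (tilted_moment \<mu> u) ns) * expm (\<psi> u)) =
      liminf (\<lambda>i. gamma_weight n u * (f (i + i0) u * expm (\<psi> u) * prod_list (map (a (i + i0) u) ns)))"
    proof (cases "0 < u")
      case True
      have "gamma_weight n u < \<top>" by (simp add: gamma_weight_def ennreal_mult_less_top split: split_indicator)
      then have "(\<lambda>i. gamma_weight n u * (f (i + i0) u * expm (\<psi> u) * prod_list (map (a (i + i0) u) ns))) \<longlonglongrightarrow>
          gamma_weight n u * (1 * expm (\<psi> u) * prod_list (map (tilted_moment \<mu> u) ns))"
        by (intro ennreal_tendsto_cmult LIMSEQ_ignore_initial_segment[OF lim[OF True], where k=i0])
      from lim_imp_Liminf[OF _ this] show ?thesis by (simp add: mult_ac)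
    qed (simp add: gamma_weight_nonpos Liminf_const)
  qed
  also have "\<dots> \<le> liminf (\<lambda>i. \<integral>\<^sup>+u. gamma_weight n u * (f (i + i0) u * expm (\<psi> u) * prod_list (map (a (i + i0) u) ns)) \<partial>lborel)"
  proof (rule nn_integral_liminf)
    fix i
    have [measurable]: "f (i + i0) \<in> borel_measurable borel" using i0 by (intro f_meas) simp
    have [measurable]: "(\<lambda>u. prod_list (map (a (i + i0) u) ns)) \<in> borel_measurable borel"
      by (intro measurable_prod_list_map) measurable
    show "(\<lambda>u. gamma_weight n u * (f (i + i0) u * expm (\<psi> u) * prod_list (map (a (i + i0) u) ns))) \<in> borel_measurable lborel"
      by measurable
  qed
  also have "\<dots> = liminf (\<lambda>i. \<integral>\<^sup>+u. gamma_weight n u * (f i u * expm (\<psi> u) * prod_list (map (a i u) ns)) \<partial>lborel)"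
    by (rule liminf_shift_k)
  finally show "(\<integral>\<^sup>+u. crm_integrand ns n u \<partial>lborel) \<le> liminf (\<lambda>i. \<integral>\<^sup>+u. eps_integrand (X i) ns n u \<partial>lborel)"
    unfolding f_def \<psi>_def a_def .
qed

end

section \<open>The partition function of the truncated measure\<close>

lemma map2_map1: "map2 g (map f xs) ys = map2 (\<lambda>x y. g (f x) y) xs ys"
  by (induction xs ys rule: list_induct2') auto

text \<open>Given \<open>N = n\<close>, the \<open>n + 1\<close> jumps are iid: the chosen ones contribute tilted moments and each of the others a Laplace
  transform. Every list of distinct indices gives the same value.\<close>

lemma eppf_eps_eq:
  fixes P0 :: "'a :: {second_countable_topology, metric_space} measure"
  assumes M: "prob_space M" and P: "P \<in> M \<rightarrow>\<^sub>M prob_algebra P0" and id: "(\<lambda>x. x) \<in> borel_measurable P0"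
    and N [measurable]: "N \<in> M \<rightarrow>\<^sub>M count_space UNIV" and J [measurable]: "\<And>j. J j \<in> borel_measurable M"
    and \<nu>: "prob_space \<nu>" "sets \<nu> = sets borel"
    and pos: "\<And>n. 0 < \<P>(\<omega> in M. N \<omega> = n)"
    and cond: "\<And>n A. (\<And>j. j \<le> n \<Longrightarrow> A j \<in> sets borel) \<Longrightarrow>
      \<P>(\<omega> in M. (\<forall>j\<le>n. J j \<omega> \<in> A j) \<bar> N \<omega> = n) = (\<Prod>j\<le>n. measure \<nu> (A j))"
    and rep: "AE \<omega> in M. has_normalized_atoms P0 {..N \<omega>} (\<lambda>j. J j \<omega>) (\<lambda>j. \<tau> j \<omega>) (P \<omega>)"
    and J_pos: "AE \<omega> in M. \<forall>j\<in>{..N \<omega>}. 0 < J j \<omega>"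
    and ns: "\<And>m. m \<in> set ns \<Longrightarrow> m > 0" "sum_list ns = q" "q > 0"
  shows "ennreal (eppf M P ns) = (\<integral>\<^sup>+u. gamma_weight q u * (\<Sum>n. of_nat (card (distinct_lists (length ns) {..n})) *
    (ennreal (\<P>(\<omega> in M. N \<omega> = n)) * (prod_list (map (tilted_moment \<nu> u) ns) *
      laplace_transform \<nu> u ^ (Suc n - length ns)))) \<partial>lborel)"
proof -
  interpret prob_space M by fact
  interpret \<nu>: prob_space \<nu> by fact
  interpret LM: pair_sigma_finite lborel M ..
  note \<nu>(2)[measurable_cong]
  define k where "k = length ns"
  define D where "D n = distinct_lists k {..n}" for n :: nat
  have finD: "finite (D n)" for n
    unfolding D_def distinct_lists_def
    by (rule finite_subset[OF _ finite_lists_length_eq[of "{..n}" k]]) auto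
  define E where "E n = {\<omega>\<in>space M. N \<omega> = n}" for n
  have [measurable]: "E n \<in> sets M" for n unfolding E_def by measurable
  define G where "G n u l \<omega> = prod_list (map2 (\<lambda>m j. tilted_power u m (J j \<omega>)) ns l) *
      (\<Prod>j\<in>{..n} - set l. expm (ennreal (u * J j \<omega>)))" for n :: nat and u l \<omega>
  have [measurable]: "(\<lambda>p. G n (snd p) l (fst p)) \<in> borel_measurable (M \<Otimes>\<^sub>M borel)"
    "(\<lambda>p. G n (fst p) l (snd p)) \<in> borel_measurable (borel \<Otimes>\<^sub>M M)"
    "G n u l \<in> borel_measurable M" "(\<lambda>u. G n u l \<omega>) \<in> borel_measurable borel" for n u l \<omega>
    unfolding G_def
    by (intro borel_measurable_times_ennreal measurable_prod_list_map2 borel_measurable_prod_ennreal; measurable)+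
  define p where "p n = ennreal (\<P>(\<omega> in M. N \<omega> = n))" for n
  define a where "a u = prod_list (map (tilted_moment \<nu> u) ns)" for u
  define f where "f u = laplace_transform \<nu> u" for u
  have [measurable]: "a \<in> borel_measurable borel"
    unfolding a_def by (intro measurable_prod_list_map) measurable
  have [measurable]: "f \<in> borel_measurable borel" unfolding f_def by measurable
  have G_int: "(\<integral>\<^sup>+\<omega>. indicator (E n) \<omega> * G n u l \<omega> \<partial>M) = p n * (a u * f u ^ (Suc n - k))"
    if l: "l \<in> D n" for n u l
  proof -
    \<comment> \<open>a chosen jump contributes its tilted power, any other jump its exponential\<close>
    define g where "g j = (case map_of (zip l (map (tilted_power u) ns)) j of None \<Rightarrow> (\<lambda>s. expm (ennreal (u * s))) | Some h \<Rightarrow> h)" for j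
    have len: "length (map (tilted_power u) ns) = length l" and l': "distinct l" "set l \<subseteq> {..n}" "length l = k"
      using l by (auto simp: D_def distinct_lists_def k_def)
    have g [measurable]: "g j \<in> borel_measurable borel" for j
    proof (cases "map_of (zip l (map (tilted_power u) ns)) j")
      case (Some h)
      then have "h \<in> set (map (tilted_power u) ns)"
        by (auto dest!: map_of_SomeD set_zip_rightD)
      then show ?thesis using Some by (auto simp: g_def)
    qed (simp add: g_def)
    have G_prod: "G n u l \<omega> = (\<Prod>j\<le>n. g j (J j \<omega>))" for \<omega>
      using prod_map_of_zip[OF len l'(1) finite_atMost l'(2), of "\<lambda>h j. h (J j \<omega>)" "\<lambda>s. expm (ennreal (u * s))"]
      by (simp add: G_def g_def map2_map1)
    have int_prod: "(\<Prod>j\<le>n. \<integral>\<^sup>+s. g j s \<partial>\<nu>) = a u * f u ^ (Suc n - k)"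
    proof -
      have "(\<Prod>j\<le>n. \<integral>\<^sup>+s. g j s \<partial>\<nu>) = prod_list (map2 (\<lambda>h j. \<integral>\<^sup>+s. h s \<partial>\<nu>) (map (tilted_power u) ns) l) *
          (\<Prod>j\<in>{..n} - set l. f u)"
        using prod_map_of_zip[OF len l'(1) finite_atMost l'(2), of "\<lambda>h j. \<integral>\<^sup>+s. h s \<partial>\<nu>" "\<lambda>s. expm (ennreal (u * s))"]
        by (simp add: g_def f_def)
      also have "card ({..n} - set l) = Suc n - k"
        using l' by (simp add: card_Diff_subset distinct_card)
      then have "(\<Prod>j\<in>{..n} - set l. f u) = f u ^ (Suc n - k)" by simp
      also have "prod_list (map2 (\<lambda>h j. \<integral>\<^sup>+s. h s \<partial>\<nu>) (map (tilted_power u) ns) l) = a u"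
        unfolding map2_ignore2[OF len] a_def by (simp add: comp_def)
      finally show ?thesis .
    qed
    show ?thesis
      unfolding G_prod E_def p_def int_prod[symmetric]
      by (rule nn_integral_conditionally_iid[OF M N J \<nu> pos cond g])
  qed
  define H where "H n \<omega> = (\<Sum>l\<in>D n. \<integral>\<^sup>+u. gamma_weight q u * G n u l \<omega> \<partial>lborel)" for n \<omega>
  have [measurable]: "H n \<in> borel_measurable M" for n
    unfolding H_def by measurable
  have "ennreal (eppf M P ns) = (\<integral>\<^sup>+\<omega>. \<integral>\<^sup>+l. prod_list (map2 (\<lambda>m j. (ennreal (J j \<omega>) / (\<integral>\<^sup>+i. ennreal (J i \<omega>) \<partial>count_space {..N \<omega>})) ^ m) ns l)
      \<partial>count_space (distinct_lists (length ns) {..N \<omega>}) \<partial>M)"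
    by (rule eppf_eq(1)[OF M P id rep]) (rule ns(1))
  also have "\<dots> = (\<Sum>n. \<integral>\<^sup>+\<omega>. indicator (E n) \<omega> * H n \<omega> \<partial>M)"
  proof (rule nn_integral_measure_split)
    show "disjoint_family E" by (auto simp: disjoint_family_on_def E_def)
    show "(\<Union>n. E n) = space M" by (auto simp: E_def)
    show "AE \<omega> in M. \<forall>n. \<omega> \<in> E n \<longrightarrow>
        (\<integral>\<^sup>+l. prod_list (map2 (\<lambda>m j. (ennreal (J j \<omega>) / (\<integral>\<^sup>+i. ennreal (J i \<omega>) \<partial>count_space {..N \<omega>})) ^ m) ns l)
         \<partial>count_space (distinct_lists (length ns) {..N \<omega>})) = H n \<omega>"
      using J_pos
    proof eventually_elim
      case (elim \<omega>)
      show ?case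
      proof (intro allI impI)
        fix n assume "\<omega> \<in> E n"
        then have n: "N \<omega> = n" by (simp add: E_def)
        define T where "T = (\<integral>\<^sup>+i. ennreal (J i \<omega>) \<partial>count_space {..n})"
        have Jp: "0 < J j \<omega>" if "j \<in> {..n}" for j using elim that n by auto
        have "ennreal (J 0 \<omega>) \<le> T"
          unfolding T_def using nn_integral_count_space_remove[of 0 "{..n}" "\<lambda>i. ennreal (J i \<omega>)"] by simp
        then have T: "0 < T" "T < \<top>"
          using Jp[of 0] by (auto simp: T_def nn_integral_count_space_finite intro: less_le_trans[of 0 "ennreal (J 0 \<omega>)"])
        have "(\<integral>\<^sup>+l. prod_list (map2 (\<lambda>m j. (ennreal (J j \<omega>) / T) ^ m) ns l) \<partial>count_space (D n)) =
            (\<Sum>l\<in>D n. prod_list (map2 (\<lambda>m j. (ennreal (J j \<omega>) / T) ^ m) ns l))"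
          by (rule nn_integral_count_space_finite[OF finD])
        also have "\<dots> = H n \<omega>"
          unfolding H_def
        proof (intro sum.cong refl)
          fix l assume "l \<in> D n"
          then have l: "l \<in> distinct_lists (length ns) {..n}" by (simp add: D_def k_def)
          have eq: "expm (\<integral>\<^sup>+j. ennreal (u * J j \<omega>) \<partial>count_space ({..n} - set l)) = (\<Prod>j\<in>{..n} - set l. expm (ennreal (u * J j \<omega>)))" for u
            by (simp add: nn_integral_count_space_finite expm_sum)
          show "prod_list (map2 (\<lambda>m j. (ennreal (J j \<omega>) / T) ^ m) ns l) = (\<integral>\<^sup>+u. gamma_weight q u * G n u l \<omega> \<partial>lborel)"
            using nn_integral_normalized_weights[OF Jp ns(2,3) T_def T l]
            unfolding eq by (simp add: G_def map2_map1)
        qed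
        finally show "(\<integral>\<^sup>+l. prod_list (map2 (\<lambda>m j. (ennreal (J j \<omega>) / (\<integral>\<^sup>+i. ennreal (J i \<omega>) \<partial>count_space {..N \<omega>})) ^ m) ns l)
          \<partial>count_space (distinct_lists (length ns) {..N \<omega>})) = H n \<omega>"
          unfolding n T_def[symmetric] D_def k_def .
      qed
    qed
  qed auto
  also have "\<dots> = (\<Sum>n. \<integral>\<^sup>+u. gamma_weight q u * (of_nat (card (D n)) * (p n * (a u * f u ^ (Suc n - k)))) \<partial>lborel)"
  proof (intro arg_cong[where f=suminf] ext)
    fix n
    have "(\<integral>\<^sup>+\<omega>. indicator (E n) \<omega> * H n \<omega> \<partial>M) =
        (\<integral>\<^sup>+\<omega>. (\<Sum>l\<in>D n. \<integral>\<^sup>+u. indicator (E n) \<omega> * (gamma_weight q u * G n u l \<omega>) \<partial>lborel) \<partial>M)"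
      unfolding H_def sum_distrib_left by (simp add: nn_integral_cmult)
    also have "\<dots> = (\<Sum>l\<in>D n. \<integral>\<^sup>+\<omega>. \<integral>\<^sup>+u. indicator (E n) \<omega> * (gamma_weight q u * G n u l \<omega>) \<partial>lborel \<partial>M)"
      by (rule nn_integral_sum) measurable
    also have "\<dots> = (\<Sum>l\<in>D n. \<integral>\<^sup>+u. \<integral>\<^sup>+\<omega>. indicator (E n) \<omega> * (gamma_weight q u * G n u l \<omega>) \<partial>M \<partial>lborel)"
      by (intro sum.cong refl LM.Fubini') measurable
    also have "\<dots> = (\<Sum>l\<in>D n. \<integral>\<^sup>+u. gamma_weight q u * (p n * (a u * f u ^ (Suc n - k))) \<partial>lborel)"
    proof (intro sum.cong refl nn_integral_cong)
      fix l u assume l: "l \<in> D n"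
      have "(\<integral>\<^sup>+\<omega>. indicator (E n) \<omega> * (gamma_weight q u * G n u l \<omega>) \<partial>M) =
          (\<integral>\<^sup>+\<omega>. gamma_weight q u * (indicator (E n) \<omega> * G n u l \<omega>) \<partial>M)"
        by (simp add: mult_ac)
      also have "\<dots> = gamma_weight q u * (\<integral>\<^sup>+\<omega>. indicator (E n) \<omega> * G n u l \<omega> \<partial>M)"
        by (rule nn_integral_cmult) measurable
      finally show "(\<integral>\<^sup>+\<omega>. indicator (E n) \<omega> * (gamma_weight q u * G n u l \<omega>) \<partial>M) =
          gamma_weight q u * (p n * (a u * f u ^ (Suc n - k)))"
        by (simp only: G_int[OF l])
    qed
    also have "\<dots> = (\<integral>\<^sup>+u. of_nat (card (D n)) * (gamma_weight q u * (p n * (a u * f u ^ (Suc n - k)))) \<partial>lborel)"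
      by (subst nn_integral_cmult) auto
    finally show "(\<integral>\<^sup>+\<omega>. indicator (E n) \<omega> * H n \<omega> \<partial>M) =
        (\<integral>\<^sup>+u. gamma_weight q u * (of_nat (card (D n)) * (p n * (a u * f u ^ (Suc n - k)))) \<partial>lborel)"
      by (simp add: mult_ac)
  qed
  also have "\<dots> = (\<integral>\<^sup>+u. (\<Sum>n. gamma_weight q u * (of_nat (card (D n)) * (p n * (a u * f u ^ (Suc n - k))))) \<partial>lborel)"
    by (rule nn_integral_suminf[symmetric]) measurable
  also have "\<dots> = (\<integral>\<^sup>+u. gamma_weight q u * (\<Sum>n. of_nat (card (D n)) * (p n * (a u * f u ^ (Suc n - k)))) \<partial>lborel)"
    by (simp only: ennreal_suminf_cmult)
  finally show ?thesis unfolding D_def p_def a_def f_def k_def .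
qed

locale diffuse_jump_density = jump_density \<rho> \<kappa> + diffuse_prob P0
  for \<rho> :: "real \<Rightarrow> real" and \<kappa> :: real and P0 :: "'a :: {second_countable_topology, metric_space} measure"
begin

text \<open>What the proofs use of a truncated measure: the law of the number of jumps, the conditional law of the jumps, and the atoms. Of the locations only
  their distinctness is retained.\<close>

definition eps_representation ::
  "real \<Rightarrow> 'w measure \<Rightarrow> ('w \<Rightarrow> 'a measure) \<Rightarrow> ('w \<Rightarrow> nat) \<Rightarrow> (nat \<Rightarrow> 'w \<Rightarrow> real) \<Rightarrow> (nat \<Rightarrow> 'w \<Rightarrow> 'a) \<Rightarrow> bool" where
  "eps_representation \<epsilon> M P N J \<tau> \<longleftrightarrow>
    N \<in> M \<rightarrow>\<^sub>M count_space UNIV \<and> (\<forall>j. J j \<in> borel_measurable M) \<and>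
    (\<forall>n. \<P>(\<omega> in M. N \<omega> = n) = \<Lambda> \<epsilon> ^ n / fact n * exp (- \<Lambda> \<epsilon>)) \<and>
    (\<forall>n A. (\<forall>j\<le>n. A j \<in> sets borel) \<longrightarrow>
      \<P>(\<omega> in M. (\<forall>j\<le>n. J j \<omega> \<in> A j) \<bar> N \<omega> = n) = (\<Prod>j\<le>n. measure (\<nu> \<epsilon>) (A j))) \<and>
    (AE \<omega> in M. has_normalized_atoms P0 {..N \<omega>} (\<lambda>j. J j \<omega>) (\<lambda>j. \<tau> j \<omega>) (P \<omega>)) \<and>
    (AE \<omega> in M. \<forall>j\<in>{..N \<omega>}. 0 < J j \<omega>)"

text \<open>For each value of \<open>N\<close> the conditional law determines the jumps and locations up to index \<open>N\<close>. Countably many exceptional sets, one for each value of \<open>N\<close> and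
  each choice of indices, remain null.\<close>

lemma eps_norm_crm_representation:
  assumes crm: "eps_norm_crm \<rho> \<kappa> P0 \<epsilon> M P" and "0 < \<epsilon>" and \<Lambda>: "0 < \<Lambda> \<epsilon>"
  shows "\<exists>N J \<tau>. eps_representation \<epsilon> M P N J \<tau>"
proof -
  let ?\<Lambda> = "\<Lambda> \<epsilon>" and ?\<nu> = "\<nu> \<epsilon>"
  from crm obtain N J \<tau> where M: "prob_space M" and P: "P \<in> M \<rightarrow>\<^sub>M prob_algebra P0"
    and N [measurable]: "N \<in> M \<rightarrow>\<^sub>M count_space UNIV" and J [measurable]: "\<And>j. J j \<in> borel_measurable M"
    and \<tau> [measurable]: "\<And>j. \<tau> j \<in> M \<rightarrow>\<^sub>M P0"
    and Nd: "distr M (count_space UNIV) N = measure_pmf (poisson_pmf ?\<Lambda>)"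
    and cond: "\<And>(n :: nat) A B. (\<forall>j\<le>n. A j \<in> sets borel \<and> B j \<in> sets P0) \<Longrightarrow>
           \<P>(\<omega> in M. (\<forall>j\<le>n. J j \<omega> \<in> A j \<and> \<tau> j \<omega> \<in> B j) \<bar> N \<omega> = n) =
             (\<Prod>j\<le>n. measure ?\<nu> (A j)) * (\<Prod>j\<le>n. measure P0 (B j))"
    and rep: "AE \<omega> in M. \<forall>A\<in>sets P0. emeasure (P \<omega>) A =
             (\<Sum>j\<le>N \<omega>. ennreal (J j \<omega>) / (\<Sum>i\<le>N \<omega>. ennreal (J i \<omega>)) * indicator A (\<tau> j \<omega>))"
    unfolding eps_norm_crm_def eps_law_def by blast
  interpret prob_space M by fact
  interpret \<nu>: prob_space ?\<nu> by (rule prob_space_eps_law[OF assms(2,3)])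
  have \<nu>UNIV: "measure ?\<nu> UNIV = 1" using \<nu>.prob_space by (simp add: eps_law_def)
  have \<tau>_space: "\<tau> j \<omega> \<in> space P0" if "\<omega> \<in> space M" for j \<omega> using measurable_space[OF \<tau> that] .
  have pN: "\<P>(\<omega> in M. N \<omega> = n) = ?\<Lambda> ^ n / fact n * exp (- ?\<Lambda>)" for n
  proof -
    have "measure (distr M (count_space UNIV) N) {n} = prob (N -` {n} \<inter> space M)"
      by (intro measure_distr) auto
    also have "N -` {n} \<inter> space M = {\<omega>\<in>space M. N \<omega> = n}" by auto
    finally show ?thesis using \<Lambda> by (simp add: Nd measure_pmf_single)
  qed
  have pN_pos: "0 < \<P>(\<omega> in M. N \<omega> = n)" for n using \<Lambda> by (simp add: pN)
  define E where "E n = {\<omega>\<in>space M. N \<omega> = n}" for n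
  have E [measurable]: "E n \<in> sets M" for n unfolding E_def by measurable
  have E_pos: "emeasure M (E n) \<noteq> 0" for n using pN_pos[of n] by (simp add: E_def emeasure_eq_measure)
  have condJ: "\<P>(\<omega> in M. (\<forall>j\<le>n. J j \<omega> \<in> A j) \<bar> N \<omega> = n) = (\<Prod>j\<le>n. measure ?\<nu> (A j))"
    if "\<And>j. j \<le> n \<Longrightarrow> A j \<in> sets borel" for n A
  proof -
    have "{\<omega>\<in>space M. (\<forall>j\<le>n. J j \<omega> \<in> A j) \<and> N \<omega> = n} = {\<omega>\<in>space M. (\<forall>j\<le>n. J j \<omega> \<in> A j \<and> \<tau> j \<omega> \<in> space P0) \<and> N \<omega> = n}"
      using \<tau>_space by auto
    then show ?thesis
      using cond[of n A "\<lambda>_. space P0"] that by (simp add: cond_prob_def P0.prob_space)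
  qed
  have AE_N: "AE \<omega> in M. Q (N \<omega>) \<omega>" if "\<And>n. AE \<omega> in M. N \<omega> = n \<longrightarrow> Q n \<omega>" for Q
  proof -
    have "AE \<omega> in M. \<forall>n. N \<omega> = n \<longrightarrow> Q n \<omega>" unfolding AE_all_countable using that by blast
    then show ?thesis by eventually_elim blast
  qed
  have pos: "AE \<omega> in M. \<forall>j\<in>{..N \<omega>}. 0 < J j \<omega>"
  proof (rule AE_N)
    fix n
    have "AE \<omega> in M. \<forall>j. N \<omega> = n \<longrightarrow> j \<le> n \<longrightarrow> 0 < J j \<omega>"
      unfolding AE_all_countable
    proof
      fix j
      show "AE \<omega> in M. N \<omega> = n \<longrightarrow> j \<le> n \<longrightarrow> 0 < J j \<omega>"
      proof (cases "j \<le> n")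
        case True
        \<comment> \<open>the rectangle that restricts only the \<open>j\<close>-th jump\<close>
        define A where "A i = (if i = j then {..0::real} else UNIV)" for i
        have "(\<Prod>i\<le>n. measure ?\<nu> (A i)) = 0"
          using True prob_space_eps_law(2)[OF assms(2,3)] by (intro prod_zero) (auto simp: A_def intro!: bexI[of _ j])
        then have "\<P>(\<omega> in M. (\<forall>i\<le>n. J i \<omega> \<in> A i) \<bar> N \<omega> = n) = 0"
          by (subst condJ) (auto simp: A_def)
        then have "prob {\<omega>\<in>space M. (\<forall>i\<le>n. J i \<omega> \<in> A i) \<and> N \<omega> = n} = 0"
          using pN_pos[of n] by (simp add: cond_prob_def)
        moreover have "{\<omega>\<in>space M. (\<forall>i\<le>n. J i \<omega> \<in> A i) \<and> N \<omega> = n} = {\<omega>\<in>space M. J j \<omega> \<le> 0 \<and> N \<omega> = n}"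
          using True by (auto simp: A_def)
        ultimately have "prob {\<omega>\<in>space M. J j \<omega> \<le> 0 \<and> N \<omega> = n} = 0" by simp
        then have "AE \<omega> in M. \<not> (J j \<omega> \<le> 0 \<and> N \<omega> = n)"
          by (intro AE_I[of _ _ "{\<omega>\<in>space M. J j \<omega> \<le> 0 \<and> N \<omega> = n}"]) (auto simp: emeasure_eq_measure)
        then show ?thesis by eventually_elim auto
      qed simp
    qed
    then show "AE \<omega> in M. N \<omega> = n \<longrightarrow> (\<forall>j\<in>{..n}. 0 < J j \<omega>)" by eventually_elim auto
  qed
  have neq: "AE \<omega> in M. N \<omega> = n \<longrightarrow> \<tau> i \<omega> \<noteq> \<tau> j \<omega>" if ij: "i \<le> n" "j \<le> n" "i \<noteq> j" for n i j
  proof -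
    let ?U = "uniform_measure M (E n)"
    have "AE \<omega> in ?U. \<tau> i \<omega> \<noteq> \<tau> j \<omega>"
    proof (rule AE_neq_of_product_law)
      show "\<tau> i \<in> ?U \<rightarrow>\<^sub>M P0" "\<tau> j \<in> ?U \<rightarrow>\<^sub>M P0" by auto
      fix A B assume AB [measurable]: "A \<in> sets P0" "B \<in> sets P0"
      \<comment> \<open>the rectangle that restricts only the \<open>i\<close>-th and the \<open>j\<close>-th location\<close>
      define C where "C k = (if k = i then A else if k = j then B else space P0)" for k
      have "emeasure ?U {\<omega>\<in>space ?U. \<tau> i \<omega> \<in> A \<and> \<tau> j \<omega> \<in> B} =
          emeasure M (E n \<inter> {\<omega>\<in>space M. \<tau> i \<omega> \<in> A \<and> \<tau> j \<omega> \<in> B}) / emeasure M (E n)"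
        unfolding space_uniform_measure by (intro emeasure_uniform_measure) auto
      also have "E n \<inter> {\<omega>\<in>space M. \<tau> i \<omega> \<in> A \<and> \<tau> j \<omega> \<in> B} =
          {\<omega>\<in>space M. (\<forall>k\<le>n. J k \<omega> \<in> UNIV \<and> \<tau> k \<omega> \<in> C k) \<and> N \<omega> = n}"
        using ij \<tau>_space by (auto simp: E_def C_def)
      also have "emeasure M \<dots> / emeasure M (E n) =
          ennreal (\<P>(\<omega> in M. (\<forall>k\<le>n. J k \<omega> \<in> UNIV \<and> \<tau> k \<omega> \<in> C k) \<bar> N \<omega> = n))"
        unfolding cond_prob_def E_def emeasure_eq_measure using pN_pos[of n] by (intro divide_ennreal) auto
      also have "\<dots> = ennreal (\<Prod>k\<le>n. measure P0 (C k))"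
        using AB by (subst cond) (auto simp: C_def \<nu>UNIV)
      also have "(\<Prod>k\<le>n. measure P0 (C k)) = measure P0 A * (measure P0 B * 1)"
      proof -
        have "(\<Prod>k\<le>n. measure P0 (C k)) = measure P0 (C i) * (measure P0 (C j) * (\<Prod>k\<in>{..n} - {i} - {j}. measure P0 (C k)))"
          using ij by (subst prod.remove[of _ i]; (subst prod.remove[of _ j])?) auto
        also have "(\<Prod>k\<in>{..n} - {i} - {j}. measure P0 (C k)) = 1"
          by (intro prod.neutral) (auto simp: C_def P0.prob_space)
        finally show ?thesis using ij by (simp add: C_def)
      qed
      finally show "emeasure ?U {\<omega>\<in>space ?U. \<tau> i \<omega> \<in> A \<and> \<tau> j \<omega> \<in> B} = emeasure P0 A * emeasure P0 B"
        by (simp add: P0.emeasure_eq_measure ennreal_mult)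
    qed
    then have "AE \<omega> in M. \<omega> \<in> E n \<longrightarrow> \<tau> i \<omega> \<noteq> \<tau> j \<omega>"
      using E_pos[of n] by (simp add: AE_uniform_measure less_top[symmetric])
    with AE_space[of M] show ?thesis by eventually_elim (auto simp: E_def)
  qed
  have "AE \<omega> in M. inj_on (\<lambda>j. \<tau> j \<omega>) {..N \<omega>}"
  proof (rule AE_N)
    fix n
    have "AE \<omega> in M. \<forall>i j. N \<omega> = n \<longrightarrow> i \<le> n \<longrightarrow> j \<le> n \<longrightarrow> i \<noteq> j \<longrightarrow> \<tau> i \<omega> \<noteq> \<tau> j \<omega>"
      unfolding AE_all_countable
    proof (intro allI)
      fix i j
      show "AE \<omega> in M. N \<omega> = n \<longrightarrow> i \<le> n \<longrightarrow> j \<le> n \<longrightarrow> i \<noteq> j \<longrightarrow> \<tau> i \<omega> \<noteq> \<tau> j \<omega>"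
      proof (cases "i \<le> n \<and> j \<le> n \<and> i \<noteq> j")
        case True
        then show ?thesis using neq[of i n j] by auto
      qed auto
    qed
    then show "AE \<omega> in M. N \<omega> = n \<longrightarrow> inj_on (\<lambda>j. \<tau> j \<omega>) {..n}"
      by eventually_elim (auto simp: inj_on_def)
  qed
  with rep AE_space[of M] have rep': "AE \<omega> in M. has_normalized_atoms P0 {..N \<omega>} (\<lambda>j. J j \<omega>) (\<lambda>j. \<tau> j \<omega>) (P \<omega>)"
  proof eventually_elim
    case (elim \<omega>)
    have "\<forall>j\<in>{..N \<omega>}. \<tau> j \<omega> \<in> space P0" using \<tau>_space elim(2) by blast
    then show ?case
      using elim(1,3) by (simp only: nn_integral_count_space_finite finite_atMost)
  qed
  show ?thesis
    unfolding eps_representation_def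
    by (intro exI[of _ N] exI[of _ J] exI[of _ \<tau>] conjI allI impI N J pN condJ rep' pos) blast
qed

lemma eppf_eps_tie:
  assumes crm: "eps_norm_crm \<rho> \<kappa> P0 \<epsilon> M P" and "0 < \<epsilon>" and \<Lambda>: "0 < \<Lambda> \<epsilon>"
    and C: "blocks_of_sizes ns C" "sum_list ns = n" and ns: "\<And>m. m \<in> set ns \<Longrightarrow> m > 0"
  shows "\<P>(\<theta> in sample_law M P n. tie_partition n \<theta> = set C) = eppf M P ns"
proof -
  have M: "prob_space M" and P: "P \<in> M \<rightarrow>\<^sub>M prob_algebra P0" using crm by (auto simp: eps_norm_crm_def)
  from eps_norm_crm_representation[OF assms(1-3)] obtain N J \<tau> where
    "AE \<omega> in M. has_normalized_atoms P0 {..N \<omega>} (\<lambda>j. J j \<omega>) (\<lambda>j. \<tau> j \<omega>) (P \<omega>)"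
    unfolding eps_representation_def by (elim exE conjE) (rule that)
  from eppf_eq(2)[OF M P id_measurable this C ns] show ?thesis by simp
qed

text \<open>Two simplifications make the bound explicit and monotone in the right way: only lists of jumps that leave out the additional one are counted,
  and in the exponential the truncated Laplace exponent is replaced by the full one. The factors that still depend on \<open>\<epsilon>\<close> converge.\<close>

lemma eppf_eps_ge:
  assumes crm: "eps_norm_crm \<rho> \<kappa> P0 \<epsilon> M P" and "0 < \<epsilon>" and \<Lambda>: "0 < \<Lambda> \<epsilon>"
    and ns: "\<And>m. m \<in> set ns \<Longrightarrow> m > 0" "sum_list ns = n" "n > 0"
  shows "(\<integral>\<^sup>+u. eps_integrand \<epsilon> ns n u \<partial>lborel) \<le> ennreal (eppf M P ns)"
proof -
  let ?\<Lambda> = "\<Lambda> \<epsilon>" and ?\<nu> = "\<nu> \<epsilon>"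
  note \<nu> = prob_space_eps_law(1)[OF assms(2,3)]
  interpret \<nu>: prob_space ?\<nu> by (rule \<nu>)
  have M: "prob_space M" and P: "P \<in> M \<rightarrow>\<^sub>M prob_algebra P0" using crm by (auto simp: eps_norm_crm_def)
  from eps_norm_crm_representation[OF assms(1-3)] obtain N J \<tau> where "eps_representation \<epsilon> M P N J \<tau>"
    by blast
  note rep = this[unfolded eps_representation_def]
  have r: "N \<in> M \<rightarrow>\<^sub>M count_space UNIV" "\<And>j. J j \<in> borel_measurable M"
    "\<And>n. \<P>(\<omega> in M. N \<omega> = n) = ?\<Lambda> ^ n / fact n * exp (- ?\<Lambda>)"
    using rep by blast+
  have cond: "\<P>(\<omega> in M. (\<forall>j\<le>n. J j \<omega> \<in> A j) \<bar> N \<omega> = n) = (\<Prod>j\<le>n. measure ?\<nu> (A j))"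
    if "\<And>j. j \<le> n \<Longrightarrow> A j \<in> sets borel" for n A using rep that by blast
  note ae = rep[THEN conjunct2, THEN conjunct2, THEN conjunct2, THEN conjunct2]
  have pos: "0 < \<P>(\<omega> in M. N \<omega> = n)" for n using \<Lambda> by (simp add: r(3))
  note law = nn_integral_eps_law[OF assms(2,3)]
  have eq: "ennreal (eppf M P ns) = (\<integral>\<^sup>+u. gamma_weight n u * (\<Sum>n. of_nat (card (distinct_lists (length ns) {..n})) *
    (ennreal (\<P>(\<omega> in M. N \<omega> = n)) * (prod_list (map (tilted_moment ?\<nu> u) ns) *
      laplace_transform ?\<nu> u ^ (Suc n - length ns)))) \<partial>lborel)"
    by (rule eppf_eps_eq[OF M P id_measurable r(1,2) \<nu> sets_eps_law pos _ conjunct1[OF ae] conjunct2[OF ae] _ ns(2,3)])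
       (fact cond ns(1))+
  show ?thesis
    unfolding eq r(3)
  proof (intro nn_integral_mono)
    fix u :: real
    define f where "f = laplace_transform ?\<nu> u"
    have bound: "f \<le> 1" "ennreal ?\<Lambda> * (1 - f) \<le> laplace_exponent \<mu> u"
      unfolding f_def
      by (rule laplace_eps_law_bounds[OF assms(2,3)])+
    then obtain fr where fr: "f = ennreal fr" "0 \<le> fr" "fr \<le> 1"
      by (cases f) (auto simp: top_unique simp flip: ennreal_1)
    have "ennreal (?\<Lambda> * (1 - fr)) = ennreal ?\<Lambda> * (1 - f)"
      using \<Lambda> fr ennreal_minus[of fr 1] by (simp add: ennreal_mult)
    also note bound(2)
    finally have "expm (laplace_exponent \<mu> u) \<le> expm (ennreal (?\<Lambda> * (1 - fr)))"
      by (rule expm_antimono)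
    also have "\<dots> = ennreal (exp (- (?\<Lambda> * (1 - fr))))" using \<Lambda> fr by (intro expm_simps) simp
    finally have "f * expm (laplace_exponent \<mu> u) \<le> f * ennreal (exp (- (?\<Lambda> * (1 - fr))))"
      by (intro mult_left_mono) auto
    also have "\<dots> = ennreal (fr * exp (- (?\<Lambda> * (1 - fr))))" using fr by (simp add: ennreal_mult)
    finally have le: "f * expm (laplace_exponent \<mu> u) \<le> ennreal (fr * exp (- (?\<Lambda> * (1 - fr))))" .
    have "prod_list (map (tilted_moment_above \<mu> \<epsilon> u) ns) =
        ennreal ?\<Lambda> ^ length ns * prod_list (map (tilted_moment ?\<nu> u) ns)"
      by (simp add: law prod_list_mult_const[symmetric])
    then have "f * expm (laplace_exponent \<mu> u) *
        prod_list (map (tilted_moment_above \<mu> \<epsilon> u) ns) \<le>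
        ennreal (fr * exp (- (?\<Lambda> * (1 - fr)))) * (ennreal ?\<Lambda> ^ length ns * prod_list (map (tilted_moment ?\<nu> u) ns))"
      using le by (auto intro!: mult_right_mono)
    also have "\<dots> \<le> (\<Sum>n. of_nat (card (distinct_lists (length ns) {..n})) * (ennreal (?\<Lambda> ^ n / fact n * exp (- ?\<Lambda>)) *
        (prod_list (map (tilted_moment ?\<nu> u) ns) * f ^ (Suc n - length ns))))"
      unfolding fr(1) using \<Lambda> fr by (intro poisson_mixture_ge) auto
    finally show "gamma_weight n u * (laplace_transform ?\<nu> u *
      expm (laplace_exponent \<mu> u) *
      prod_list (map (tilted_moment_above \<mu> \<epsilon> u) ns)) \<le>
      gamma_weight n u * (\<Sum>n. of_nat (card (distinct_lists (length ns) {..n})) * (ennreal (?\<Lambda> ^ n / fact n * exp (- ?\<Lambda>)) *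
        (prod_list (map (tilted_moment ?\<nu> u) ns) * laplace_transform ?\<nu> u ^ (Suc n - length ns))))"
      unfolding f_def by (rule mult_left_mono) simp
  qed
qed

end

section \<open>The limit\<close>

text \<open>The complement of \<open>\<pi>\<close> has at least its limiting mass, up to an error, so \<open>\<pi>\<close> itself has at most its limiting mass.\<close>

lemma tendsto_of_lower_bounds_and_total_mass:
  fixes f :: "'i \<Rightarrow> 'b \<Rightarrow> real"
  assumes "finite A" and sum: "\<forall>\<^sub>F i in F. (\<Sum>\<pi>\<in>A. f i \<pi>) = 1" and p: "(\<Sum>\<pi>\<in>A. p \<pi>) = 1"
    and lower: "\<And>\<pi> \<delta>. \<pi> \<in> A \<Longrightarrow> 0 < \<delta> \<Longrightarrow> \<forall>\<^sub>F i in F. p \<pi> - \<delta> \<le> f i \<pi>"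
    and \<pi>: "\<pi> \<in> A"
  shows "((\<lambda>i. f i \<pi>) \<longlongrightarrow> p \<pi>) F"
proof (rule tendstoI)
  fix e :: real assume "0 < e"
  \<comment> \<open>at most \<open>card A\<close> errors accumulate\<close>
  define \<delta> where "\<delta> = e / (2 * real (card A))"
  have c: "0 < card A" using \<pi> \<open>finite A\<close> by (auto simp: card_gt_0_iff)
  then have \<delta>: "0 < \<delta>" using \<open>0 < e\<close> by (simp add: \<delta>_def)
  have "\<forall>\<^sub>F i in F. \<forall>\<pi>\<in>A. p \<pi> - \<delta> \<le> f i \<pi>"
    using \<open>finite A\<close> lower \<delta> by (simp add: eventually_ball_finite_distrib)
  with sum show "\<forall>\<^sub>F i in F. dist (f i \<pi>) (p \<pi>) < e"
  proof eventually_elim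
    case (elim i)
    have "(\<Sum>\<pi>'\<in>A - {\<pi>}. p \<pi>' - \<delta>) \<le> (\<Sum>\<pi>'\<in>A - {\<pi>}. f i \<pi>')"
      using elim by (intro sum_mono) auto
    moreover have "(\<Sum>\<pi>'\<in>A - {\<pi>}. f i \<pi>') = 1 - f i \<pi>" "(\<Sum>\<pi>'\<in>A - {\<pi>}. p \<pi>') = 1 - p \<pi>"
      using elim(1) p \<open>finite A\<close> \<pi> by (simp_all add: sum_diff1)
    ultimately have "f i \<pi> \<le> p \<pi> + real (card (A - {\<pi>})) * \<delta>"
      by (simp add: sum_subtractf)
    also have "real (card (A - {\<pi>})) * \<delta> \<le> real (card A) * \<delta>"
      using \<delta> \<open>finite A\<close> by (intro mult_right_mono) (auto intro: card_mono)
    also have "real (card A) * \<delta> = e / 2" using c by (simp add: \<delta>_def)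
    finally have "f i \<pi> \<le> p \<pi> + e / 2" by simp
    moreover have "p \<pi> - \<delta> \<le> f i \<pi>" using elim \<pi> by auto
    moreover have "\<delta> \<le> e / 2"
      using c \<open>0 < e\<close> by (simp add: \<delta>_def field_simps)
    ultimately show ?case using \<open>0 < e\<close> by (auto simp: dist_real_def)
  qed
qed

text \<open>A singleton has no subsets except itself and the empty set, so one of positive measure is an atom.\<close>

lemma non_atomic_singleton:
  assumes "non_atomic \<mu>" "{x} \<in> sets \<mu>"
  shows "emeasure \<mu> {x} = 0"
proof (rule ccontr)
  assume "emeasure \<mu> {x} \<noteq> 0"
  then have "atom \<mu> {x}"
    using assms(2) by (auto simp: atom_def subset_singleton_iff zero_less_iff_neq_zero)
  then show False using assms(1) by (auto simp: non_atomic_def)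
qed

theorem proposition2:
  fixes \<Theta> :: "(real ^ 'm) set"
    and P0 :: "(real ^ 'm) measure"
    and \<rho> :: "real \<Rightarrow> real"
    and \<kappa> :: real
    and M0 :: "'w measure" and P :: "'w \<Rightarrow> (real ^ 'm) measure"
    and M :: "real \<Rightarrow> 'v measure" and P_eps :: "real \<Rightarrow> 'v \<Rightarrow> (real ^ 'm) measure"
    and ns :: "nat list" and n k :: nat
  assumes "\<Theta> \<in> sets borel"
    and "sets P0 = sets (restrict_space borel \<Theta>)" and "prob_space P0" and "non_atomic P0"
    and "\<kappa> > 0"
    and "\<rho> \<in> borel_measurable (restrict_space borel {0<..})" and "\<And>s. s > 0 \<Longrightarrow> \<rho> s \<ge> 0"
    and "(\<integral>\<^sup>+s\<in>{0<..}. ennreal (min 1 s * \<rho> s) \<partial>lborel) < \<infinity>"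
    and "(\<integral>\<^sup>+s\<in>{0<..}. ennreal (\<rho> s) \<partial>lborel) = \<infinity>"
    and "norm_crm \<rho> \<kappa> P0 M0 P"
    and "\<And>\<epsilon>. \<epsilon> > 0 \<Longrightarrow> Lambda_eps \<rho> \<kappa> \<epsilon> > 0 \<Longrightarrow> eps_norm_crm \<rho> \<kappa> P0 \<epsilon> (M \<epsilon>) (P_eps \<epsilon>)"
    and "length ns = k" and "k > 0" and "\<And>i. i < k \<Longrightarrow> ns ! i > 0" and "sum_list ns = n"
  shows "((\<lambda>\<epsilon>. eppf (M \<epsilon>) (P_eps \<epsilon>) ns) \<longlongrightarrow> eppf M0 P ns) (at_right 0) \<and>
    eppf M0 P ns =
      (LINT u:{0<..}|lborel. u ^ (n - 1) / Gamma (real n)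
         * exp (\<kappa> * (LINT s:{0<..}|lborel. (exp (- u * s) - 1) * \<rho> s))
         * (\<Prod>i<k. LINT s:{0<..}|lborel. \<kappa> * s ^ (ns ! i) * exp (- u * s) * \<rho> s))"
proof -
  interpret P0: prob_space P0 by fact
  have id: "(\<lambda>x. x) \<in> borel_measurable P0"
    using measurable_cong_sets[OF assms(2) refl] measurable_restrict_space1[OF measurable_ident_sets[OF refl]] by blast
  have diffuse: "\<forall>x\<in>space P0. emeasure P0 {x} = 0"
  proof
    fix x assume x: "x \<in> space P0"
    have "(\<lambda>x. x) -` {x} \<inter> space P0 \<in> sets P0" by (rule measurable_sets[OF id]) simp
    moreover have "(\<lambda>x. x) -` {x} \<inter> space P0 = {x}" using x by auto
    ultimately show "emeasure P0 {x} = 0" using non_atomic_singleton[OF assms(4)] by simp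
  qed
  interpret diffuse_jump_density \<rho> \<kappa> P0
    by unfold_locales (use assms(5-8) id diffuse in auto)
  have M0: "prob_space M0" and P: "P \<in> M0 \<rightarrow>\<^sub>M prob_algebra P0" using assms(10) by (auto simp: norm_crm_def)
  obtain J \<tau> where J: "poisson_process_points M0 \<mu> J"
    and rep: "AE \<omega> in M0. has_normalized_atoms P0 UNIV (\<lambda>j. J j \<omega>) (\<lambda>j. \<tau> j \<omega>) (P \<omega>)"
    and Tfin: "AE \<omega> in M0. (\<integral>\<^sup>+i. ennreal (J i \<omega>) \<partial>count_space (UNIV :: nat set)) < \<top>"
    using norm_crm_representation[OF assms(10)] by blast
  have ns_pos: "0 < m" if "m \<in> set ns" for m
    using that assms(12,14) by (metis in_set_conv_nth)
  have n_pos: "0 < n"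
  proof -
    have "ns ! 0 \<in> set ns" using assms(12,13) by auto
    then have "ns ! 0 \<le> n" using member_le_sum_list[of "ns ! 0" ns] assms(15) by simp
    then show ?thesis using assms(13) assms(14)[of 0] by simp
  qed
  define I where "I ms = (\<integral>\<^sup>+u. crm_integrand ms n u \<partial>lborel)" for ms
  have eppf0: "ennreal (eppf M0 P ms) = I ms" if "\<And>m. m \<in> set ms \<Longrightarrow> 0 < m" "sum_list ms = n" for ms
    unfolding I_def
    by (rule eppf_norm_crm[OF M0 P id J sets_crm_intensity intensity.sigma_finite_measure_axioms rep Tfin])
       (use that n_pos tilted_moment_finite in auto)
  have tie0: "\<P>(\<theta> in sample_law M0 P n. tie_partition n \<theta> = set C) = eppf M0 P ms"
    if "blocks_of_sizes ms C" "sum_list ms = n" "\<And>m. m \<in> set ms \<Longrightarrow> 0 < m" for C ms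
    by (rule eppf_eq(2)[OF M0 P id rep that(1,2)]) (rule that(3))
  \<comment> \<open>one partition with the given block sizes represents the value of \<open>eppf\<close>, but the argument below is about all partitions\<close>
  obtain C where C: "blocks_of_sizes ns C" using blocks_of_sizes_exists[of ns] ns_pos by blast
  have part_C: "partition_on {1..n} (set C)" using C assms(15) by (simp add: blocks_of_sizes_def)
  have lim: "((\<lambda>\<epsilon>. eppf (M \<epsilon>) (P_eps \<epsilon>) ns) \<longlongrightarrow> eppf M0 P ns) (at_right 0)"
    unfolding tendsto_at_iff_sequentially
  proof (intro allI impI)
    fix X :: "nat \<Rightarrow> real" assume X: "\<forall>i. X i \<in> {0<..} - {0}" "X \<longlonglongrightarrow> 0"
    have X_pos: "0 < X i" for i using X(1) by auto
    have ev: "\<forall>\<^sub>F i in sequentially. 0 < Lambda_eps \<rho> \<kappa> (X i)"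
      by (rule eps_lower_bound_liminf(2)[OF assms(9) X(2) X_pos])
    define Mi where "Mi i = M (X i)" for i
    define Pi where "Pi i = P_eps (X i)" for i
    have crm: "eps_norm_crm \<rho> \<kappa> P0 (X i) (Mi i) (Pi i)" if "0 < Lambda_eps \<rho> \<kappa> (X i)" for i
      unfolding Mi_def Pi_def using assms(11) X_pos that by blast
    have tie_eps: "\<P>(\<theta> in sample_law (Mi i) (Pi i) n. tie_partition n \<theta> = set C) = eppf (Mi i) (Pi i) ms"
      if "0 < Lambda_eps \<rho> \<kappa> (X i)" "blocks_of_sizes ms C" "sum_list ms = n" "\<And>m. m \<in> set ms \<Longrightarrow> 0 < m" for i C ms
      by (rule eppf_eps_tie[OF crm[OF that(1)] X_pos that(1-3)]) (rule that(4))
    define f where "f i \<pi> = \<P>(\<theta> in sample_law (Mi i) (Pi i) n. tie_partition n \<theta> = \<pi>)" for i \<pi>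
    define p where "p \<pi> = \<P>(\<theta> in sample_law M0 P n. tie_partition n \<theta> = \<pi>)" for \<pi>
    have "(\<lambda>i. f i (set C)) \<longlonglongrightarrow> p (set C)"
    proof (rule tendsto_of_lower_bounds_and_total_mass[where A="{\<pi>. partition_on {1..n} \<pi>}"])
      show "finite {\<pi>. partition_on {1..n} \<pi>}" by (rule finitely_many_partition_on) simp
      show "\<forall>\<^sub>F i in sequentially. (\<Sum>\<pi> | partition_on {1..n} \<pi>. f i \<pi>) = 1"
        using ev
      proof eventually_elim
        case (elim i)
        have "prob_space (Mi i)" "Pi i \<in> Mi i \<rightarrow>\<^sub>M prob_algebra P0"
          using crm[OF elim] by (auto simp: eps_norm_crm_def)
        then show ?case unfolding f_def by (rule sum_prob_tie_partition[OF _ _ id])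
      qed
      show "(\<Sum>\<pi> | partition_on {1..n} \<pi>. p \<pi>) = 1"
        unfolding p_def by (rule sum_prob_tie_partition[OF M0 P id])
      show "set C \<in> {\<pi>. partition_on {1..n} \<pi>}" using part_C by simp
      fix \<pi> and \<delta> :: real assume "\<pi> \<in> {\<pi>. partition_on {1..n} \<pi>}" and \<delta>: "0 < \<delta>"
      then have "partition_on {1..n} \<pi>" by simp
      then obtain D where D: "set D = \<pi>" "blocks_of_sizes (map card D) D" "sum_list (map card D) = n"
        and D_pos: "\<And>m. m \<in> set (map card D) \<Longrightarrow> 0 < m"
        by (rule blocks_of_sizes_of_partition) blast
      let ?ms = "map card D"
      have "p \<pi> = eppf M0 P ?ms" unfolding p_def D(1)[symmetric] by (rule tie0[OF D(2,3)]) (rule D_pos)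
      then have "ennreal (p \<pi>) = I ?ms" using eppf0[OF D_pos D(3)] by simp
      also have "\<dots> \<le> liminf (\<lambda>i. \<integral>\<^sup>+u. eps_integrand (X i) ?ms n u \<partial>lborel)"
        unfolding I_def
        by (rule eps_lower_bound_liminf(1)[OF assms(9) X(2) X_pos]) (rule D_pos)
      also have "\<dots> \<le> liminf (\<lambda>i. ennreal (f i \<pi>))"
      proof (rule Liminf_mono)
        show "\<forall>\<^sub>F i in sequentially. (\<integral>\<^sup>+u. eps_integrand (X i) ?ms n u \<partial>lborel) \<le> ennreal (f i \<pi>)"
          using ev
        proof eventually_elim
          case (elim i)
          have "f i \<pi> = eppf (Mi i) (Pi i) ?ms"
            unfolding f_def D(1)[symmetric] by (rule tie_eps[OF elim D(2,3)]) (rule D_pos)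
          then show ?case
            using eppf_eps_ge[OF crm[OF elim] X_pos elim, of ?ms n] D(3) D_pos n_pos by auto
        qed
      qed
      finally have le: "ennreal (p \<pi>) \<le> liminf (\<lambda>i. ennreal (f i \<pi>))" .
      \<comment> \<open>a negative \<open>p \<pi> - \<delta>\<close> is embedded as 0, so this trivial case is separate\<close>
      show "\<forall>\<^sub>F i in sequentially. p \<pi> - \<delta> \<le> f i \<pi>"
      proof (cases "p \<pi> - \<delta> < 0")
        case True
        then show ?thesis by (intro always_eventually allI) (auto simp: f_def intro: order_trans[of _ 0])
      next
        case False
        then have "ennreal (p \<pi> - \<delta>) < ennreal (p \<pi>)" using \<delta> by (intro ennreal_lessI) auto
        then have "\<forall>\<^sub>F i in sequentially. ennreal (p \<pi> - \<delta>) < ennreal (f i \<pi>)"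
          using le by (simp add: le_Liminf_iff)
        then show ?thesis by eventually_elim (use False in \<open>auto simp: ennreal_less_iff\<close>)
      qed
    qed
    moreover have "p (set C) = eppf M0 P ns"
      unfolding p_def by (rule tie0[OF C assms(15)]) (rule ns_pos)
    moreover have "\<forall>\<^sub>F i in sequentially. f i (set C) = eppf (Mi i) (Pi i) ns"
      using ev
    proof eventually_elim
      case (elim i)
      show ?case unfolding f_def by (rule tie_eps[OF elim C assms(15)]) (rule ns_pos)
    qed
    ultimately have "(\<lambda>i. eppf (Mi i) (Pi i) ns) \<longlonglongrightarrow> eppf M0 P ns"
      using Lim_transform_eventually by fastforce
    then show "((\<lambda>\<epsilon>. eppf (M \<epsilon>) (P_eps \<epsilon>) ns) \<circ> X) \<longlonglongrightarrow> eppf M0 P ns"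
      by (simp add: comp_def Mi_def Pi_def)
  qed
  \<comment> \<open>the extended nonnegative integrals are now identified with the real integrals of the claim\<close>
  define F where "F u = u ^ (n - 1) / Gamma (real n)
         * exp (\<kappa> * (LINT s:{0<..}|lborel. (exp (- u * s) - 1) * \<rho> s))
         * (\<Prod>i<k. LINT s:{0<..}|lborel. \<kappa> * s ^ (ns ! i) * exp (- u * s) * \<rho> s)" for u
  define G where "G u = crm_integrand ns n u" for u
  have FG: "ennreal (indicator {0<..} u * F u) = G u \<and> 0 \<le> indicator {0<..} u * F u" for u
  proof (cases "0 < u")
    case True
    define B where "B m = (LINT s:{0<..}|lborel. \<kappa> * s ^ m * exp (- u * s) * \<rho> s)" for m
    have B: "tilted_moment \<mu> u m = ennreal (B m)" if "0 < m" for m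
    proof -
      have "tilted_moment \<mu> u m = ennreal (LINT s:{0<..}|lborel. \<kappa> * (s ^ m * exp (- u * s)) * \<rho> s)"
        by (rule nn_integral_intensity_eq_LINT[OF _ _ _ tilted_moment_finite[OF True that]])
           (auto simp: tilted_power_def)
      then show ?thesis by (simp add: B_def mult.assoc)
    qed
    have B0: "0 \<le> B m" for m
      unfolding B_def set_lebesgue_integral_def
      by (rule Bochner_Integration.integral_nonneg) (use density_nonneg \<kappa>_pos in \<open>auto split: split_indicator\<close>)
    define L where "L = (LINT s:{0<..}|lborel. \<kappa> * (1 - exp (- u * s)) * \<rho> s)"
    have L: "laplace_exponent \<mu> u = ennreal L"
      unfolding L_def
    proof (rule nn_integral_intensity_eq_LINT[OF _ _ _ laplace_exponent_finite[OF True]])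
      fix s :: real assume "0 < s"
      then show "1 - expm (ennreal (u * s)) = ennreal (1 - exp (- u * s)) \<and> 0 \<le> 1 - exp (- u * s)"
        using True by (subst expm_simps) (auto simp: ennreal_minus simp flip: ennreal_1)
    qed auto
    have L0: "0 \<le> L"
      unfolding L_def set_lebesgue_integral_def
      by (rule Bochner_Integration.integral_nonneg) (use density_nonneg \<kappa>_pos True in \<open>auto split: split_indicator\<close>)
    have "\<kappa> * (LINT s:{0<..}|lborel. (exp (- u * s) - 1) * \<rho> s) = (LINT s:{0<..}|lborel. - (\<kappa> * (1 - exp (- u * s)) * \<rho> s))"
      unfolding set_integral_mult_right[symmetric] by (simp add: algebra_simps)
    also have "\<dots> = - L" unfolding L_def set_lebesgue_integral_def by simp
    finally have "expm (laplace_exponent \<mu> u) =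
        ennreal (exp (\<kappa> * (LINT s:{0<..}|lborel. (exp (- u * s) - 1) * \<rho> s)))"
      unfolding L using L0 by simp
    moreover have "prod_list (map (tilted_moment \<mu> u) ns) = ennreal (\<Prod>i<k. B (ns ! i))"
    proof -
      have "prod_list (map (tilted_moment \<mu> u) ns) = prod_list (map (\<lambda>m. ennreal (B m)) ns)"
        using B ns_pos by (intro arg_cong[where f=prod_list] map_cong) auto
      also have "\<dots> = (\<Prod>i<k. ennreal (B (ns ! i)))"
        using assms(12) by (simp add: prod.list_conv_set_nth atLeast0LessThan)
      finally show ?thesis using B0 by (simp add: prod_ennreal)
    qed
    moreover have "0 \<le> (\<Prod>i<k. B (ns ! i))" using B0 by (simp add: prod_nonneg)
    moreover have "0 < Gamma (real n)" using n_pos by (intro Gamma_real_pos) simp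
    ultimately show ?thesis
      using True by (simp add: F_def G_def gamma_weight_def B_def mult_ac flip: ennreal_mult)
  qed (simp add: G_def gamma_weight_nonpos)
  have [measurable]: "G \<in> borel_measurable borel"
    unfolding G_def
    by (intro borel_measurable_times_ennreal measurable_gamma_weight measurable_prod_list_map
        measurable_compose[OF _ measurable_expm]) measurable
  have "(\<lambda>u. indicator {0<..} u * F u) = (\<lambda>u. enn2real (G u))"
    using FG by (metis enn2real_ennreal)
  then have meas: "(\<lambda>u. indicator {0<..} u * F u) \<in> borel_measurable lborel" by simp
  have "(LINT u:{0<..}|lborel. F u) = enn2real (\<integral>\<^sup>+u. ennreal (indicator {0<..} u * F u) \<partial>lborel)"
    unfolding set_lebesgue_integral_def using FG meas by (subst integral_eq_nn_integral) auto
  also have "\<dots> = enn2real (I ns)" using FG by (simp add: I_def G_def)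
  also have "\<dots> = enn2real (ennreal (eppf M0 P ns))"
    using eppf0[OF ns_pos assms(15)] by simp
  also have "\<dots> = eppf M0 P ns"
  proof (rule enn2real_ennreal)
    have "eppf M0 P ns = \<P>(\<theta> in sample_law M0 P n. tie_partition n \<theta> = set C)"
      by (rule tie0[OF C assms(15), symmetric]) (rule ns_pos)
    then show "0 \<le> eppf M0 P ns" by simp
  qed
  finally have "eppf M0 P ns = (LINT u:{0<..}|lborel. F u)" ..
  with lim show ?thesis unfolding F_def by blast
qed

end
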